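(* Let $\delta$ be a rational space quartic curve in $\mathbb{C}\mathbb{P}^3$. If $\delta$ is of the first species, then for every $n$ there exist $n$ points on $\delta$ that span $\Theta(n^3)$ coplanar quadruples. If $\delta$ is of the second species, then any $n$ points on $\delta$ span $O(n^{8/3})$ coplanar quadruples.
   Context: A space quartic is an irreducible non-planar curve of degree $4$ in $\mathbb{C}\mathbb{P}^3$; every space quartic lies on some quadric surface. It is of the first species if it is contained in more than one quadric surface, and of the second species if it is contained in a unique quadric. A coplanar quadruple of a point set is a set of four distinct points of it lying on a common plane. *)

theory Defs
  imports "HOL-Analysis.Analysis"
begin

text \<open>Points of complex projective 3-space are modelled as 1-dimensional
  linear subspaces (lines through the origin) of complex^4.\<close>

type_synonym cvec = "complex ^ 4"
type_synonym ppoint = "cvec set"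

definition pt :: "cvec \<Rightarrow> ppoint" where
  "pt v = range (\<lambda>c::complex. c *s v)"

definition lin :: "cvec \<Rightarrow> cvec \<Rightarrow> complex" where
  "lin a v = (\<Sum>i\<in>UNIV. a $ i * v $ i)"

definition qf :: "complex ^ 4 ^ 4 \<Rightarrow> cvec \<Rightarrow> complex" where
  "qf A v = (\<Sum>i\<in>UNIV. \<Sum>j\<in>UNIV. A $ i $ j * v $ i * v $ j)"

definition plane :: "ppoint set \<Rightarrow> bool" where
  "plane H \<longleftrightarrow> (\<exists>a. a \<noteq> 0 \<and> H = {pt v | v. v \<noteq> 0 \<and> lin a v = 0})"

definition quadric :: "ppoint set \<Rightarrow> bool" where
  "quadric S \<longleftrightarrow> (\<exists>A. (\<exists>v. qf A v \<noteq> 0) \<and> S = {pt v | v. v \<noteq> 0 \<and> qf A v = 0})"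

definition bq :: "(nat \<Rightarrow> cvec) \<Rightarrow> complex \<Rightarrow> complex \<Rightarrow> cvec" where
  "bq c s t = (\<Sum>k\<le>4. (s ^ k * t ^ (4 - k)) *s c k)"

text \<open>A rational space quartic: the image of CP^1 under [f0:f1:f2:f3] with f_i binary
  quartic forms without common zero on CP^1, whose image is not contained in a plane
  (non-planar; this forces the map to be birational onto an irreducible curve of degree 4).\<close>
definition rational_space_quartic :: "ppoint set \<Rightarrow> bool" where
  "rational_space_quartic \<delta> \<longleftrightarrow>
     (\<exists>c. (\<forall>s t. (s, t) \<noteq> (0, 0) \<longrightarrow> bq c s t \<noteq> 0)
        \<and> \<not> (\<exists>a. a \<noteq> 0 \<and> (\<forall>s t. lin a (bq c s t) = 0))
        \<and> \<delta> = {pt (bq c s t) | s t. (s, t) \<noteq> (0, 0)})"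

definition first_species :: "ppoint set \<Rightarrow> bool" where
  "first_species \<delta> \<longleftrightarrow>
     (\<exists>S1 S2. quadric S1 \<and> quadric S2 \<and> S1 \<noteq> S2 \<and> \<delta> \<subseteq> S1 \<and> \<delta> \<subseteq> S2)"

definition second_species :: "ppoint set \<Rightarrow> bool" where
  "second_species \<delta> \<longleftrightarrow> (\<exists>!S. quadric S \<and> \<delta> \<subseteq> S)"

definition coplanar_quadruples :: "ppoint set \<Rightarrow> nat" where
  "coplanar_quadruples P = card {Q. Q \<subseteq> P \<and> card Q = 4 \<and> (\<exists>H. plane H \<and> Q \<subseteq> H)}"

end

theory Submission
  imports Defs "HOL-Computational_Algebra.Fundamental_Theorem_Algebra"
begin


text \<open>
  Let \<open>c\<^sub>0, \<dots>, c\<^sub>4\<close> be the coefficient vectors of the parametrization and \<open>\<Sum> g\<^sub>k c\<^sub>k = 0\<close> a linear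
  relation between them. Four distinct parameters give coplanar points iff they satisfy
  \<open>g\<^sub>4 - g\<^sub>3 e\<^sub>1 + g\<^sub>2 e\<^sub>2 - g\<^sub>1 e\<^sub>3 + g\<^sub>0 e\<^sub>4 = 0\<close>, where \<open>e\<^sub>i\<close> are their elementary symmetric functions.
  The species is decided by the \<open>3 \<times> 3\<close> Hankel matrix of \<open>g\<close>. If it is singular, a change of
  coordinate on the line turns the relation into \<open>e\<^sub>4 = const\<close> or \<open>e\<^sub>1 = const\<close>, so that there are two
  quadrics, and geometric or arithmetic progressions give cubically many quadruples.

  If it is regular, the quadric is unique, and for fixed \<open>x, y\<close> the relation is an involution
  \<open>z \<mapsto> t\<close> of the complex line which determines \<open>{x, y}\<close> and is itself determined by two of its orbits.
  Call a pair of points of the parameter set \<open>A\<close>, \<open>|A| = n\<close>, close if a disc that is roughly centred at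
  the first and contains the second has at most \<open>m\<close> points of \<open>A\<close>: there are \<open>O(nm)\<close> close pairs. An
  involution mapping \<open>k\<close> points of \<open>A\<close> into \<open>A\<close> carries at least \<open>\<epsilon>k - O(n/m)\<close> close pairs to
  close pairs, because nearest-neighbour discs overlap boundedly. Hence \<open>n\<^sup>2\<close> involutions have
  \<open>O(n\<^sup>3/m + n\<^sup>2m\<^sup>2)\<close> incidences, and \<open>m = n\<^bsup>1/3\<^esup>\<close> gives the exponent \<open>8/3\<close>.
\<close>

section \<open>Close pairs\<close>

text \<open>The complex numbers have no order in which two points could be neighbours, so discs take
  the place of intervals, and closeness has to survive maps that carry discs to discs but not
  centres to centres. Hence a disc need only be roughly centred. The tolerance, a fifth of the
  distance of the pair, is small enough for the cone argument that bounds the number of close pairs,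
  and large enough for the image of a nearest-neighbour disc under an inversion whose pole is at
  least six radii away. Points nearer to the pole have to be treated separately. Parameters at
  infinity are removed by a change of parameter adapted to the given points. The relation
  \<open>g\<close> therefore varies with the points, and the incidence bound has to be uniform in
  \<open>g\<close>. To avoid transforming \<open>g\<close>, singularity of the Hankel matrix is
  expressed by plane sections: some nonzero quadratic form has only plane sections as its quartic
  multiples, a property that plain substitution preserves.\<close>

definition direction_net :: "complex set \<Rightarrow> bool" where
  "direction_net T \<longleftrightarrow> finite T \<and> (\<forall>v. norm v = 1 \<longrightarrow> (\<exists>t\<in>T. dist v t < 1/40))"

lemma direction_net_exists: "\<exists>T. direction_net T"
proof -
  have "compact (sphere 0 1 :: complex set)" by simp
  then obtain k where k: "finite k" "sphere 0 1 \<subseteq> (\<Union>x\<in>k. ball (x::complex) (1/40))"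
    unfolding compact_eq_totally_bounded by (meson zero_less_divide_1_iff zero_less_numeral)
  show ?thesis unfolding direction_net_def
  proof (intro exI conjI allI impI)
    show "finite k" by fact
    fix v :: complex assume "norm v = 1"
    then have "v \<in> sphere 0 1" by simp
    then obtain x where "x \<in> k" "v \<in> ball x (1/40)" using k(2) by blast
    then show "\<exists>t\<in>k. dist v t < 1/40" by (auto simp: dist_commute)
  qed
qed

text \<open>The radius 1/40 makes the directions of two members differ by at most 1/20, so that the
  cosine of their angle is at least 1 - 1/800, well above the 7/8 used for inner products.\<close>

definition cone_at :: "complex \<Rightarrow> complex set" where
  "cone_at t = {x. x \<noteq> 0 \<and> dist (sgn x) t < 1/40}"

lemma direction_net_cover:
  assumes "direction_net T" "x \<noteq> 0"
  shows "\<exists>t\<in>T. x \<in> cone_at t"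
  using assms by (auto simp: direction_net_def cone_at_def norm_sgn)

lemma weighted_card_le_by_cones:
  assumes "direction_net T" "finite S" "\<And>x. x \<in> S \<Longrightarrow> f x \<noteq> 0"
    and "\<And>t. t \<in> T \<Longrightarrow> m * card {x\<in>S. f x \<in> cone_at t} \<le> M"
  shows "m * card S \<le> card T * M"
proof -
  have fT: "finite T" using assms(1) by (simp add: direction_net_def)
  have "S \<subseteq> (\<Union>t\<in>T. {x\<in>S. f x \<in> cone_at t})"
    using direction_net_cover[OF assms(1)] assms(3) by blast
  then have "card S \<le> card (\<Union>t\<in>T. {x\<in>S. f x \<in> cone_at t})"
    by (intro card_mono) (use fT assms(2) in auto)
  also have "\<dots> \<le> (\<Sum>t\<in>T. card {x\<in>S. f x \<in> cone_at t})" by (rule card_UN_le[OF fT])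
  finally have "m * card S \<le> (\<Sum>t\<in>T. m * card {x\<in>S. f x \<in> cone_at t})"
    by (simp flip: sum_distrib_left)
  also have "\<dots> \<le> card T * M" using sum_bounded_above[of T _ M] assms(4) by force
  finally show ?thesis .
qed

lemma card_le_by_cones:
  assumes "direction_net T" "finite S" "\<And>x. x \<in> S \<Longrightarrow> f x \<noteq> 0"
    and "\<And>t. t \<in> T \<Longrightarrow> card {x\<in>S. f x \<in> cone_at t} \<le> M"
  shows "card S \<le> card T * M"
  using weighted_card_le_by_cones[of T S f 1 M] assms by simp

lemma cone_at_sgn_diff:
  assumes "x \<in> cone_at t" "y \<in> cone_at t"
  shows "norm (sgn x - sgn y) \<le> 1/20"
proof -
  have "dist (sgn x) (sgn y) \<le> dist (sgn x) t + dist (sgn y) t"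
    by (metis dist_commute dist_triangle)
  then show ?thesis using assms by (simp add: cone_at_def dist_norm)
qed

lemma cone_at_inner:
  assumes "x \<in> cone_at t" "y \<in> cone_at t"
  shows "inner x y \<ge> 7/8 * (norm x * norm y)"
proof -
  have n: "norm (sgn x) = 1" "norm (sgn y) = 1" using assms by (auto simp: cone_at_def norm_sgn)
  have "(norm (sgn x - sgn y))\<^sup>2 = (norm (sgn x))\<^sup>2 + (norm (sgn y))\<^sup>2 - 2 * inner (sgn x) (sgn y)"
    by (simp add: power2_norm_eq_inner inner_diff inner_commute)
  moreover have "(norm (sgn x - sgn y))\<^sup>2 \<le> (1/20)\<^sup>2"
    by (rule power_mono[OF cone_at_sgn_diff[OF assms]]) simp
  ultimately have "inner (sgn x) (sgn y) \<ge> 7/8" using n by (simp add: power2_eq_square)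
  then have "(norm x * norm y) * (7/8) \<le> (norm x * norm y) * inner (sgn x) (sgn y)"
    by (intro mult_left_mono) auto
  also have "\<dots> = inner (norm x *\<^sub>R sgn x) (norm y *\<^sub>R sgn y)" by simp
  also have "\<dots> = inner x y" using assms by (simp add: cone_at_def sgn_div_norm del: inner_scaleR_left inner_scaleR_right)
  finally show ?thesis by simp
qed

text \<open>Not symmetric: \<open>x\<close> is the point near the centre. The conditions force
  \<open>r\<close> to be at least 4/5 of \<open>dist x u\<close>, so the disc contains
  \<open>x\<close> as well as \<open>u\<close>.\<close>

definition close :: "complex set \<Rightarrow> nat \<Rightarrow> complex \<Rightarrow> complex \<Rightarrow> bool" where
  "close A m x u \<longleftrightarrow> x \<noteq> u \<and>
     (\<exists>z r. dist x z \<le> dist x u / 5 \<and> u \<in> cball z r \<and> card (A \<inter> cball z r) \<le> m)"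

text \<open>The point \<open>x\<close> is no farther from \<open>z\<close> than \<open>u\<close> is,
  exactly when \<open>2 * inner w (z - u) \<ge> (norm w)\<^sup>2\<close>. The small angle
  contributes 7/8 and the displaced centre costs 1/5, which leaves more than the required
  1/2.\<close>

lemma close_in_disc:
  assumes "x - u \<in> cone_at t" "y - u \<in> cone_at t" "dist x u \<le> dist y u"
    and "dist y z \<le> dist y u / 5" "u \<in> cball z r"
  shows "x \<in> cball z r"
proof -
  define w v where "w = x - u" and "v = y - u"
  have wv: "norm w \<le> norm v" using assms(3) by (simp add: w_def v_def dist_norm)
  have i: "inner w v \<ge> 7/8 * (norm w * norm v)"
    unfolding w_def v_def by (rule cone_at_inner[OF assms(1,2)])
  have "norm (z - y) \<le> norm v / 5" using assms(4) by (simp add: v_def dist_norm norm_minus_commute)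
  then have "norm w * norm (z - y) \<le> norm w * (norm v / 5)" by (intro mult_left_mono) auto
  moreover have "\<bar>inner w (z - y)\<bar> \<le> norm w * norm (z - y)" by (rule Cauchy_Schwarz_ineq2)
  ultimately have "inner w (z - y) \<ge> - (norm w * norm v) / 5" by linarith
  moreover have "z - u = v + (z - y)" by (simp add: v_def)
  ultimately have "inner w (z - u) \<ge> 7/8 * (norm w * norm v) - (norm w * norm v)/5"
    using i by (simp only: inner_add_right)
  moreover have "norm w * norm w \<le> norm w * norm v" using wv by (intro mult_left_mono) auto
  moreover have "0 \<le> norm w * norm w" by simp
  ultimately have "2 * inner w (z - u) \<ge> (norm w)\<^sup>2" unfolding power2_eq_square by linarith
  moreover have "(norm (x - z))\<^sup>2 = (norm w)\<^sup>2 - 2 * inner w (z - u) + (norm (z - u))\<^sup>2"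
  proof -
    have "x - z = w - (z - u)" by (simp add: w_def)
    then show ?thesis by (simp only:) (simp add: power2_norm_eq_inner inner_diff inner_commute)
  qed
  ultimately have "(norm (x - z))\<^sup>2 \<le> (norm (z - u))\<^sup>2" by linarith
  then have "norm (x - z) \<le> norm (z - u)" by (rule power2_le_imp_le) simp
  then show ?thesis using assms(5) by (simp add: dist_norm norm_minus_commute)
qed

text \<open>For fixed \<open>u\<close> and one cone of directions \<open>x - u\<close>, the disc
  that belongs to the farthest \<open>x\<close> contains all the other ones, so at most
  \<open>m\<close> of them exist.\<close>

lemma card_close_le:
  assumes T: "direction_net T" and A: "finite A"
  shows "card {(x, u). x \<in> A \<and> u \<in> A \<and> close A m x u} \<le> card A * (card T * m)"
proof -
  have bound: "card {x\<in>A. close A m x u} \<le> card T * m" for u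
  proof (rule card_le_by_cones[OF T, where f = "\<lambda>x. x - u"])
    show "finite {x\<in>A. close A m x u}" using A by simp
    show "\<And>x. x \<in> {x\<in>A. close A m x u} \<Longrightarrow> x - u \<noteq> 0" by (simp add: close_def)
    fix t assume "t \<in> T"
    define S where "S = {x \<in> {x \<in> A. close A m x u}. x - u \<in> cone_at t}"
    have fS: "finite S" using A by (simp add: S_def)
    show "card S \<le> m"
    proof (cases "S = {}")
      case False
      obtain y where y: "y \<in> S" "\<And>x. x \<in> S \<Longrightarrow> dist x u \<le> dist y u"
        using obtains_MAX[OF fS False, of "\<lambda>x. dist x u"] fS by (metis Max_ge finite_imageI imageI)
      obtain z r where zr: "dist y z \<le> dist y u / 5" "u \<in> cball z r" "card (A \<inter> cball z r) \<le> m"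
        using y(1) by (auto simp: S_def close_def)
      have "S \<subseteq> A \<inter> cball z r"
        using close_in_disc[OF _ _ _ zr(1,2)] y unfolding S_def by blast
      then have "card S \<le> card (A \<inter> cball z r)" using A by (intro card_mono) auto
      then show ?thesis using zr(3) by simp
    qed simp
  qed
  have "{(x, u). x \<in> A \<and> u \<in> A \<and> close A m x u} = (\<Union>u\<in>A. (\<lambda>x. (x, u)) ` {x\<in>A. close A m x u})"
    by auto
  also have "card \<dots> \<le> (\<Sum>u\<in>A. card ((\<lambda>x. (x, u)) ` {x\<in>A. close A m x u}))"
    by (rule card_UN_le[OF A])
  also have "\<dots> \<le> (\<Sum>u\<in>A. card T * m)"
    by (intro sum_mono order_trans[OF card_image_le bound]) (use A in auto)
  finally show ?thesis by simp
qed

section \<open>Heavy discs and bounded overlap\<close>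

lemma heavy_count:
  assumes A: "finite A" and I: "finite I"
    and ov: "\<And>p. p \<in> A \<Longrightarrow> card {i\<in>I. p \<in> D i} \<le> K"
  shows "m * card {i\<in>I. card (A \<inter> D i) > m} \<le> K * card A"
proof -
  have "m * card {i\<in>I. card (A \<inter> D i) > m} = (\<Sum>i\<in>{i\<in>I. card (A \<inter> D i) > m}. m)" by simp
  also have "\<dots> \<le> (\<Sum>i\<in>{i\<in>I. card (A \<inter> D i) > m}. card (A \<inter> D i))"
    by (intro sum_mono) auto
  also have "\<dots> \<le> (\<Sum>i\<in>I. card (A \<inter> D i))"
    by (intro sum_mono2) (use I in auto)
  also have "\<dots> = (\<Sum>i\<in>I. card {p\<in>A. p \<in> D i})" by (simp add: Int_def)
  also have "\<dots> = (\<Sum>p\<in>A. card {i\<in>I. p \<in> D i})"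
    by (rule sum_multicount_gen[symmetric]) (use A I in auto)
  also have "\<dots> \<le> (\<Sum>p\<in>A. K)" by (intro sum_mono ov)
  finally show ?thesis by (simp add: mult.commute)
qed

text \<open>An index is good only if its disc and its image disc are both light; the indices lost to
  either family are bounded by double counting.\<close>

lemma two_family_count:
  assumes A: "finite A" "finite A'" and I: "finite I"
    and ov: "\<And>p. p \<in> A \<Longrightarrow> card {i\<in>I. p \<in> D i} \<le> K"
    and ov': "\<And>p. p \<in> A' \<Longrightarrow> card {i\<in>I. p \<in> D' i} \<le> K"
  shows "m * card I \<le> m * card {i\<in>I. card (A \<inter> D i) \<le> m \<and> card (A' \<inter> D' i) \<le> m}
      + K * (card A + card A')"
proof -
  have "I \<subseteq> {i\<in>I. card (A \<inter> D i) \<le> m \<and> card (A' \<inter> D' i) \<le> m}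
     \<union> ({i\<in>I. card (A \<inter> D i) > m} \<union> {i\<in>I. card (A' \<inter> D' i) > m})" by auto
  then have "card I \<le> card {i\<in>I. card (A \<inter> D i) \<le> m \<and> card (A' \<inter> D' i) \<le> m}
     + (card {i\<in>I. card (A \<inter> D i) > m} + card {i\<in>I. card (A' \<inter> D' i) > m})"
    using I by (intro order_trans[OF card_mono order_trans[OF card_Un_le add_left_mono[OF card_Un_le]]]) auto
  then have "m * card I \<le> m * (card {i\<in>I. card (A \<inter> D i) \<le> m \<and> card (A' \<inter> D' i) \<le> m}
     + (card {i\<in>I. card (A \<inter> D i) > m} + card {i\<in>I. card (A' \<inter> D' i) > m}))" by simp
  also have "\<dots> \<le> m * card {i\<in>I. card (A \<inter> D i) \<le> m \<and> card (A' \<inter> D' i) \<le> m} + K * (card A + card A')"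
    using heavy_count[OF A(1) I ov, where m=m] heavy_count[OF A(2) I ov', where m=m]
    by (simp add: distrib_left)
  finally show ?thesis .
qed

text \<open>Two points in one cone seen from \<open>p\<close> are nearer to each other than the
  farther one is to \<open>p\<close>, so the disc of the farther one cannot reach \<open>p\<close>.
  This leaves one point per cone; the additional 1 stands for \<open>p\<close> itself, which has no
  direction.\<close>

lemma nn_overlap:
  fixes X :: "complex set"
  assumes T: "direction_net T" and X: "finite X"
    and r: "\<And>x y. x \<in> X \<Longrightarrow> y \<in> X \<Longrightarrow> x \<noteq> y \<Longrightarrow> r x \<le> dist x y"
  shows "card {x\<in>X. p \<in> cball x (r x)} \<le> card T + 1"
proof -
  define S where "S = {x\<in>X - {p}. p \<in> cball x (r x)}"
  have "card S \<le> card T * 1"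
  proof (rule card_le_by_cones[OF T, where f = "\<lambda>x. x - p"])
    show "finite S" "\<And>x. x \<in> S \<Longrightarrow> x - p \<noteq> 0" using X by (auto simp: S_def)
    fix t
    have key: False if h: "x \<in> S" "y \<in> S" "x - p \<in> cone_at t" "y - p \<in> cone_at t" "x \<noteq> y"
      "norm (y - p) \<le> norm (x - p)" for x y
    proof -
      define a b where "a = x - p" and "b = y - p"
      have nz: "norm a > 0" "norm b > 0" using h(3,4) by (auto simp: a_def b_def cone_at_def)
      have "norm a \<le> r x" using h(1) by (simp add: S_def a_def dist_norm)
      also have "r x \<le> dist x y" using h r by (auto simp: S_def)
      also have "\<dots> = norm (a - b)" by (simp add: a_def b_def dist_norm)
      finally have "(norm a)\<^sup>2 \<le> (norm (a - b))\<^sup>2" by (intro power_mono) auto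
      also have "\<dots> = (norm a)\<^sup>2 + (norm b)\<^sup>2 - 2 * inner a b"
        by (simp add: power2_norm_eq_inner inner_diff inner_commute)
      finally have "2 * inner a b \<le> norm b * norm b" by (simp add: power2_eq_square)
      moreover have "inner a b \<ge> 7/8 * (norm a * norm b)"
        unfolding a_def b_def by (rule cone_at_inner[OF h(3,4)])
      moreover have "norm b * norm b \<le> norm a * norm b"
        using h(6) by (intro mult_right_mono) (auto simp: a_def b_def)
      moreover have "norm a * norm b > 0" using nz by simp
      ultimately show False by linarith
    qed
    have "\<forall>x\<in>{x\<in>S. x - p \<in> cone_at t}. \<forall>y\<in>{x\<in>S. x - p \<in> cone_at t}. x = y"
      by (metis (mono_tags, lifting) key linear mem_Collect_eq)
    then show "card {x\<in>S. x - p \<in> cone_at t} \<le> 1"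
      by (auto simp: S_def X card_le_Suc0_iff_eq)
  qed
  moreover have "{x\<in>X. p \<in> cball x (r x)} \<subseteq> insert p S" by (auto simp: S_def)
  moreover have "card (insert p S) \<le> Suc (card S)" by (simp add: card_insert_le_m1 S_def X card_insert_if)
  ultimately show ?thesis
    using card_mono[of "insert p S" "{x\<in>X. p \<in> cball x (r x)}"] X by (simp add: S_def)
qed


section \<open>Close pairs preserved by an involution\<close>

definition close_pairs :: "complex set \<Rightarrow> complex set \<Rightarrow> nat \<Rightarrow> (complex \<Rightarrow> complex) \<Rightarrow> complex set \<Rightarrow> (complex \<times> complex) set" where
  "close_pairs A A' m f X = {(x, y). x \<in> X \<and> y \<in> X \<and> close A m x y \<and>
     (close A' m (f x) (f y) \<or> close A' m (f y) (f x))}"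

lemma finite_close_pairs: "finite X \<Longrightarrow> finite (close_pairs A A' m f X)"
  by (rule finite_subset[of _ "X \<times> X"]) (auto simp: close_pairs_def)

definition nearest_in :: "complex set \<Rightarrow> (complex \<Rightarrow> complex) \<Rightarrow> bool" where
  "nearest_in X nn \<longleftrightarrow> (\<forall>x\<in>X. nn x \<in> X - {x} \<and> (\<forall>y\<in>X - {x}. dist x (nn x) \<le> dist x y))"

lemma nearest_in_exists:
  assumes "finite X" "card X \<ge> 2"
  shows "\<exists>nn. nearest_in X nn"
proof -
  have "\<exists>y. y \<in> X - {x} \<and> (\<forall>z\<in>X - {x}. dist x y \<le> dist x z)" if "x \<in> X" for x
  proof -
    have "X - {x} \<noteq> {}" using assms that
      by (metis Suc_1 card.empty card_Diff_singleton_if card_gt_0_iff diff_Suc_1' less_eq_Suc_le less_irrefl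
        zero_less_diff)
    then show ?thesis using arg_min_if_finite[of "X - {x}" "dist x"] assms(1)
      by (metis finite_Diff linorder_not_less)
  qed
  then show ?thesis unfolding nearest_in_def by metis
qed

text \<open>Every \<open>x\<close> in \<open>G\<close> is paired with its nearest neighbour in
  \<open>X\<close>. Single discs may contain many points of \<open>A\<close>, but the discs overlap
  boundedly, and so do the image discs, because \<open>h\<close> pulls them back into the former;
  few can therefore be heavy.\<close>

lemma nearest_pairs_count:
  assumes T: "direction_net T" and fin: "finite A" "finite A'" "finite X"
    and nn: "nearest_in X nn" and G: "G \<subseteq> X"
    and tgt: "\<And>x. x \<in> G \<Longrightarrow> f x \<noteq> f (nn x) \<and> dist (f x) (z' x) \<le> dist (f x) (f (nn x)) / 5 \<and>
        f (nn x) \<in> cball (z' x) (r' x)"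
    and pre: "\<And>x p. x \<in> G \<Longrightarrow> p \<in> cball (z' x) (r' x) \<Longrightarrow> h p \<in> cball x (dist x (nn x))"
  shows "m * card G \<le> m * card (close_pairs A A' m f X) + (card T + 1) * (card A + card A')"
proof -
  define D where "D x = cball x (dist x (nn x))" for x
  have fG: "finite G" using G fin(3) finite_subset by blast
  have ov: "card {x\<in>G. p \<in> D x} \<le> card T + 1" for p
    unfolding D_def
    by (rule nn_overlap[OF T fG]) (use nn G in \<open>auto simp: nearest_in_def\<close>)
  have ov': "card {x\<in>G. p \<in> cball (z' x) (r' x)} \<le> card T + 1" for p
    by (rule order_trans[OF card_mono ov[of "h p"]]) (use fG pre in \<open>auto simp: D_def\<close>)
  define R where "R = {x\<in>G. card (A \<inter> D x) \<le> m \<and> card (A' \<inter> cball (z' x) (r' x)) \<le> m}"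
  have "(\<lambda>x. (x, nn x)) ` R \<subseteq> close_pairs A A' m f X"
  proof
    fix q assume "q \<in> (\<lambda>x. (x, nn x)) ` R"
    then obtain x where q: "q = (x, nn x)" and xR: "x \<in> R" by auto
    have xG: "x \<in> G" using xR by (simp add: R_def)
    have X: "x \<in> X" "nn x \<in> X" "nn x \<noteq> x" using xG G nn by (auto simp: nearest_in_def)
    have "close A m x (nn x)" unfolding close_def
      by (intro conjI exI[of _ x] exI[of _ "dist x (nn x)"]) (use X xR in \<open>auto simp: R_def D_def\<close>)
    moreover have "close A' m (f x) (f (nn x))" unfolding close_def
      by (intro conjI exI[of _ "z' x"] exI[of _ "r' x"]) (use tgt[OF xG] xR in \<open>auto simp: R_def\<close>)
    ultimately show "q \<in> close_pairs A A' m f X" using X q by (simp add: close_pairs_def)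
  qed
  then have "card ((\<lambda>x. (x, nn x)) ` R) \<le> card (close_pairs A A' m f X)"
    by (intro card_mono finite_close_pairs fin)
  moreover have "card ((\<lambda>x. (x, nn x)) ` R) = card R" by (intro card_image) (auto simp: inj_on_def)
  ultimately have "m * card R \<le> m * card (close_pairs A A' m f X)" by simp
  then show ?thesis
    using two_family_count[OF fin(1,2) fG ov ov', where m=m] unfolding R_def by linarith
qed

text \<open>A point reflection is an isometry and keeps the discs exactly centred. The last summand
  \<open>m\<close> pays for sets with fewer than two points, where no neighbour exists.\<close>

lemma reflection_pairs_count:
  assumes T: "direction_net T" and fin: "finite A" "finite A'" "finite X" and f: "\<And>z. f z = k - z"
  shows "m * card X \<le> m * card (close_pairs A A' m f X) + (card T + 1) * (card A + card A') + m"
proof (cases "card X \<ge> 2")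
  case True
  obtain nn where nn: "nearest_in X nn" using nearest_in_exists[OF fin(3) True] by blast
  have "m * card X \<le> m * card (close_pairs A A' m f X) + (card T + 1) * (card A + card A')"
  proof (rule nearest_pairs_count[OF T fin nn, where z' = f and r' = "\<lambda>x. dist x (nn x)" and h = "\<lambda>p. k - p"])
    fix x assume "x \<in> X"
    then have "nn x \<noteq> x" using nn by (auto simp: nearest_in_def)
    then show "f x \<noteq> f (nn x) \<and> dist (f x) (f x) \<le> dist (f x) (f (nn x)) / 5 \<and>
        f (nn x) \<in> cball (f x) (dist x (nn x))"
      by (auto simp: f dist_norm norm_minus_commute)
    fix p assume "p \<in> cball (f x) (dist x (nn x))"
    then have "norm (p - (k - x)) \<le> dist x (nn x)" by (simp add: f dist_norm norm_minus_commute)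
    moreover have "x - (k - p) = p - (k - x)" by simp
    ultimately show "k - p \<in> cball x (dist x (nn x))" by (simp only: mem_cball dist_norm)
  qed simp
  then show ?thesis by linarith
next
  case False
  then have "m * card X \<le> m * 1" by (intro mult_le_mono2) auto
  then show ?thesis by linarith
qed

section \<open>Inversions away from their pole\<close>

lemma inversion_disc_identity:
  fixes x w k :: complex and r d :: real
  assumes d: "d = (norm x)\<^sup>2 - r\<^sup>2"
  shows "(norm (d *\<^sub>R w - k * cnj x))\<^sup>2 - (r * norm k)\<^sup>2 = d * ((norm (k - x * w))\<^sup>2 - (r * norm w)\<^sup>2)"
  unfolding d power_mult_distrib cmod_power2 by (simp add: power2_eq_square algebra_simps)

text \<open>For \<open>w \<noteq> 0\<close> the right-hand side says that \<open>k / w\<close> lies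
  in the disc of radius \<open>r\<close> about \<open>x\<close>. So the left-hand disc is the image
  of that disc under the inversion, and \<open>d\<close> is the power of the pole 0 with respect to
  the original circle.\<close>

lemma inversion_disc_iff:
  fixes x w k :: complex and r d :: real
  assumes d: "d = (norm x)\<^sup>2 - r\<^sup>2" "d > 0" "r \<ge> 0"
  shows "w \<in> cball (k * cnj x /\<^sub>R d) (r * norm k / d) \<longleftrightarrow> norm (k - x * w) \<le> r * norm w"
proof -
  have "norm (w - k * cnj x /\<^sub>R d) = norm ((d *\<^sub>R w - k * cnj x) /\<^sub>R d)"
    using d(2) by (simp add: scaleR_right_diff_distrib)
  also have "\<dots> = norm (d *\<^sub>R w - k * cnj x) / d" using d(2) by (simp add: divide_inverse mult.commute)
  finally have "w \<in> cball (k * cnj x /\<^sub>R d) (r * norm k / d) \<longleftrightarrow> norm (d *\<^sub>R w - k * cnj x) \<le> r * norm k"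
    using d(2) by (simp add: dist_norm norm_minus_commute divide_le_cancel)
  also have "\<dots> \<longleftrightarrow> (norm (d *\<^sub>R w - k * cnj x))\<^sup>2 - (r * norm k)\<^sup>2 \<le> 0"
    using d(3) by (auto simp: abs_le_square_iff[symmetric])
  also have "\<dots> \<longleftrightarrow> (norm (k - x * w))\<^sup>2 - (r * norm w)\<^sup>2 \<le> 0"
    unfolding inversion_disc_identity[OF d(1)] using d(2) by (simp add: mult_le_0_iff)
  also have "\<dots> \<longleftrightarrow> norm (k - x * w) \<le> r * norm w"
    using d(3) by (auto simp: abs_le_square_iff[symmetric])
  finally show ?thesis .
qed

text \<open>The new centre misses \<open>k / x\<close> by the fraction \<open>r * norm y / d\<close>
  of \<open>dist (k / x) (k / y)\<close>. As \<open>norm y \<le> norm x + r\<close>, this is at most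
  \<open>r / (norm x - r)\<close>, and \<open>6 * r \<le> norm x\<close> brings it down to the 1/5
  that \<open>close\<close> tolerates.\<close>

lemma inversion_disc:
  fixes x y k :: complex
  assumes r: "r = dist x y" "r > 0" and far: "6 * r \<le> norm x" and k: "k \<noteq> 0"
    and d: "d = (norm x)\<^sup>2 - r\<^sup>2"
  shows "dist (k / x) (k * cnj x /\<^sub>R d) \<le> dist (k / x) (k / y) / 5"
    and "k / y \<in> cball (k * cnj x /\<^sub>R d) (r * norm k / d)"
    and "p \<in> cball (k * cnj x /\<^sub>R d) (r * norm k / d) \<Longrightarrow> k / p \<in> cball x r"
proof -
  have x0: "x \<noteq> 0" using r far by auto
  have ny: "norm y \<le> norm x + r" using r norm_triangle_ineq2[of y x] by (simp add: dist_norm norm_minus_commute)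
  have "norm x - norm y \<le> r" using r norm_triangle_ineq2[of x y] by (simp add: dist_norm)
  then have "norm y > 0" using far r by linarith
  then have y0: "y \<noteq> 0" by auto
  have dfac: "d = (norm x - r) * (norm x + r)" by (simp add: d power2_eq_square algebra_simps)
  have d0: "d > 0" unfolding dfac using far r(2) by (intro mult_pos_pos) linarith+
  note iff = inversion_disc_iff[OF d d0 less_imp_le[OF r(2)], of _ k]
  have "k - x * (k / y) = (k / y) * (y - x)" using y0 by (simp add: field_simps)
  then have "norm (k - x * (k / y)) = norm (k / y) * r" using r by (simp only: norm_mult dist_norm norm_minus_commute)
  then show "k / y \<in> cball (k * cnj x /\<^sub>R d) (r * norm k / d)" unfolding iff by simp
  show "k / p \<in> cball x r" if "p \<in> cball (k * cnj x /\<^sub>R d) (r * norm k / d)"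
  proof -
    have le: "norm (k - x * p) \<le> r * norm p" using that unfolding iff .
    then have p0: "p \<noteq> 0" using k by auto
    have "k / p - x = (k - x * p) / p" using p0 by (simp add: field_simps)
    then have "norm (k / p - x) = norm (k - x * p) / norm p" by (simp only: norm_divide)
    also have "\<dots> \<le> r" using le p0 by (simp add: divide_le_eq)
    finally show ?thesis by (simp add: dist_norm norm_minus_commute)
  qed
  have "k / x = (1 / (norm x)\<^sup>2) *\<^sub>R (k * cnj x)"
    using x0 by (simp add: scaleR_conv_of_real complex_norm_square del: of_real_power)
  then have "dist (k / x) (k * cnj x /\<^sub>R d) = norm ((1 / (norm x)\<^sup>2 - 1 / d) *\<^sub>R (k * cnj x))"
    by (simp add: dist_norm scaleR_left_diff_distrib divide_inverse)
  also have "\<dots> = \<bar>1 / (norm x)\<^sup>2 - 1 / d\<bar> * (norm k * norm x)" by (simp add: norm_mult)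
  also have "1 / (norm x)\<^sup>2 - 1 / d = - (r\<^sup>2 / ((norm x)\<^sup>2 * d))"
    using x0 d0 by (simp add: field_simps d)
  also have "\<bar>- (r\<^sup>2 / ((norm x)\<^sup>2 * d))\<bar> * (norm k * norm x) = norm k * r\<^sup>2 / (norm x * d)"
    using d0 x0 by (simp add: power2_eq_square field_simps)
  finally have lhs: "dist (k / x) (k * cnj x /\<^sub>R d) = norm k * r\<^sup>2 / (norm x * d)" .
  have "k / x - k / y = k * (y - x) / (x * y)" using x0 y0 by (simp add: field_simps)
  then have rhs: "dist (k / x) (k / y) = norm k * r / (norm x * norm y)"
    using r by (simp add: dist_norm norm_mult norm_divide norm_minus_commute)
  have "5 * (r * norm y) \<le> d"
  proof -
    have "5 * (r * norm y) \<le> 5 * (r * (norm x + r))" using ny r by simp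
    also have "\<dots> = (5 * r) * (norm x + r)" by simp
    also have "\<dots> \<le> d" unfolding dfac using far r by (intro mult_right_mono) auto
    finally show ?thesis .
  qed
  then have "norm k * r * (5 * (r * norm y)) \<le> norm k * r * d" using r by (intro mult_left_mono) auto
  then show "dist (k / x) (k * cnj x /\<^sub>R d) \<le> dist (k / x) (k / y) / 5"
    unfolding lhs rhs using d0 x0 y0 by (simp add: field_simps power2_eq_square)
qed

text \<open>The disc has radius \<open>norm b\<close> and touches the circle through
  \<open>a\<close> about 0 from outside at \<open>a\<close>, so it lies in an annulus. Its centre
  misses \<open>b\<close> by at most \<open>norm b / 20 + norm a\<close>, less than a fifth of the
  distance because \<open>a\<close> is at least a hundred times shorter than
  \<open>b\<close>.\<close>

lemma far_pair_disc:
  fixes a b :: complex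
  assumes "a \<noteq> 0" "b \<noteq> 0" "norm (sgn a - sgn b) \<le> 1/20" "100 * norm a \<le> norm b"
  defines "z \<equiv> a + norm b *\<^sub>R sgn a"
  shows "dist b z \<le> dist b a / 5" and "a \<in> cball z (norm b)"
    and "p \<in> cball z (norm b) \<Longrightarrow> norm a \<le> norm p \<and> norm p \<le> 3 * norm b"
proof -
  have "b - z = norm b *\<^sub>R (sgn b - sgn a) - a"
    using assms(2) by (simp add: z_def scaleR_right_diff_distrib sgn_div_norm)
  then have "norm (b - z) \<le> norm b * norm (sgn b - sgn a) + norm a"
    by (metis abs_norm_cancel norm_scaleR norm_triangle_ineq4)
  also have "\<dots> \<le> norm b * (1/20) + norm a"
    using assms(3) by (intro add_right_mono mult_left_mono) (auto simp: norm_minus_commute)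
  finally have 1: "norm (b - z) \<le> norm b / 20 + norm a" by simp
  have "norm b - norm a \<le> norm (b - a)" by (rule norm_triangle_ineq2)
  then show "dist b z \<le> dist b a / 5" unfolding dist_norm using 1 assms(4) norm_ge_zero[of b] by linarith
  show "a \<in> cball z (norm b)" using assms(1) by (simp add: z_def dist_norm norm_sgn)
  have "z = (norm a + norm b) *\<^sub>R sgn a"
    using assms(1) by (simp add: z_def sgn_div_norm distrib_right scaleR_left_distrib)
  then have nz: "norm z = norm a + norm b" using assms(1) by (simp add: norm_sgn)
  assume "p \<in> cball z (norm b)"
  then have "norm (z - p) \<le> norm b" by (simp add: dist_norm)
  then show "norm a \<le> norm p \<and> norm p \<le> 3 * norm b"
    using norm_triangle_ineq2[of z p] norm_triangle_ineq2[of p z] nz assms(4)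
    by (simp add: norm_minus_commute)
qed


text \<open>
  Points whose nearest neighbour is far compared with their distance to the centre of the inversion are
  lacunary in every direction. Their nearest-neighbour discs are mapped to discs that are not
  nearly centred; instead, points 44 places apart in the sequence are paired
  (\<open>0.9\<^bsup>44\<^esup> < 1/100\<close>), by discs lying in the annulus between them.
\<close>

lemma norm_enumeration:
  fixes S :: "complex set"
  assumes S: "finite S" and inj: "inj_on norm S"
  shows "\<exists>b. bij_betw b {..<card S} S \<and> (\<forall>i j. i < j \<longrightarrow> j < card S \<longrightarrow> norm (b i) < norm (b j))"
proof -
  define L where "L = sorted_list_of_set (norm ` S)"
  have len: "length L = card S" using inj by (simp add: L_def card_image)
  have setL: "set L = norm ` S" using S by (simp add: L_def)
  define b where "b i = inv_into S norm (L ! i)" for i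
  have mem: "L ! i \<in> norm ` S" if "i < card S" for i using that len setL nth_mem by metis
  have nb: "norm (b i) = L ! i" if "i < card S" for i
    unfolding b_def by (rule f_inv_into_f[OF mem[OF that]])
  have mono: "norm (b i) < norm (b j)" if "i < j" "j < card S" for i j
  proof -
    have "sorted_wrt (<) L" by (simp add: L_def)
    then have "L ! i < L ! j" using that len by (simp add: sorted_wrt_iff_nth_less)
    then show ?thesis using that nb by simp
  qed
  have injb: "inj_on b {..<card S}"
    by (rule inj_onI) (metis lessThan_iff linorder_neqE_nat mono order_less_irrefl)
  have sub: "b ` {..<card S} \<subseteq> S" using mem by (auto simp: b_def inv_into_into)
  have "b ` {..<card S} = S"
    by (rule card_subset_eq[OF S sub]) (simp add: card_image[OF injb])
  then show ?thesis using injb mono by (auto simp: bij_betw_def)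
qed

lemma lacunary_power:
  fixes b :: "nat \<Rightarrow> complex"
  assumes "\<And>i j. i < j \<Longrightarrow> j < n \<Longrightarrow> norm (b i) \<le> 9/10 * norm (b j)" "i + k < n"
  shows "norm (b i) \<le> (9/10) ^ k * norm (b (i + k))"
  using assms(2)
proof (induction k)
  case (Suc k)
  have "norm (b i) \<le> (9/10) ^ k * norm (b (i + k))" using Suc by simp
  also have "\<dots> \<le> (9/10) ^ k * (9/10 * norm (b (i + Suc k)))"
    using Suc.prems by (intro mult_left_mono assms(1)) auto
  finally show ?case by (simp add: mult.assoc mult.left_commute)
qed simp

text \<open>The bound is 44 + 21: two indices of the set at least 65 apart would make
  \<open>norm (b (i + 44))\<close> at most \<open>(9/10) ^ 21 * 9\<close> times itself, and that
  factor is below 1. A factor 3 is granted on both sides so that one count serves the discs, with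
  \<open>q = norm p\<close>, and the image discs, with \<open>q = norm (k / p)\<close>.\<close>

lemma lacunary_overlap:
  fixes b :: "nat \<Rightarrow> complex"
  assumes lac: "\<And>i j. i < j \<Longrightarrow> j < n \<Longrightarrow> norm (b i) \<le> 9/10 * norm (b j)"
    and nz: "\<And>i. i < n \<Longrightarrow> b i \<noteq> 0"
  shows "card {i \<in> {..<n - 44}. norm (b i) \<le> 3 * q \<and> q \<le> 3 * norm (b (i + 44))} \<le> 65"
proof (cases "{i \<in> {..<n - 44}. norm (b i) \<le> 3 * q \<and> q \<le> 3 * norm (b (i + 44))} = {}")
  case False
  define S where "S = {i \<in> {..<n - 44}. norm (b i) \<le> 3 * q \<and> q \<le> 3 * norm (b (i + 44))}"
  have fS: "finite S" by (simp add: S_def)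
  define i where "i = Min S"
  have iS: "i \<in> S" unfolding i_def by (rule Min_in[OF fS]) (use False in \<open>simp only: S_def not_False_eq_True\<close>)
  have "S \<subseteq> {i..<i+65}"
  proof
    fix j assume jS: "j \<in> S"
    have ij: "i \<le> j" using fS jS by (simp add: i_def)
    have "j < i + 65"
    proof (rule ccontr)
      assume "\<not> j < i + 65"
      then have "j \<ge> (i + 44) + 21" by simp
      then obtain e where e: "j = (i + 44) + (21 + e)" using le_Suc_ex by (metis add.assoc)
      have jn: "(i + 44) + (21 + e) < n" using jS e by (auto simp: S_def)
      have "norm (b (i + 44)) \<le> (9/10) ^ (21 + e) * norm (b j)"
        unfolding e by (rule lacunary_power[OF lac jn])
      also have "\<dots> \<le> (9/10) ^ 21 * norm (b j)"
        by (intro mult_right_mono power_decreasing) auto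
      also have "norm (b j) \<le> 9 * norm (b (i + 44))" using jS iS by (auto simp: S_def)
      finally have "norm (b (i + 44)) \<le> (9/10) ^ 21 * 9 * norm (b (i + 44))" by simp
      moreover have "norm (b (i + 44)) > 0" using nz[of "i + 44"] jn by simp
      ultimately have "1 \<le> (9/10 :: real) ^ 21 * 9" by simp
      then show False by (simp add: power_divide)
    qed
    then show "j \<in> {i..<i+65}" using ij by simp
  qed
  then have "card S \<le> card {i..<i+65}" by (intro card_mono) auto
  then show ?thesis by (simp add: S_def)
next
  case True
  then show ?thesis by (simp only: card.empty zero_le)
qed

text \<open>An inversion keeps angles at 0, inverts ratios of norms and reverses the order by norm.
  So the annulus construction applies on both sides, with outer point \<open>b (i + 44)\<close>
  before and \<open>k / b i\<close> after the map. The last 44 indices have no mate and cost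
  \<open>44 * m\<close>.\<close>

lemma lacunary_pairs_count:
  fixes S X :: "complex set"
  assumes fin: "finite A" "finite A'" "finite X" and S: "S \<subseteq> X" and k: "k \<noteq> 0"
    and dir: "\<And>x y. x \<in> S \<Longrightarrow> y \<in> S \<Longrightarrow> norm (sgn x - sgn y) \<le> 1/20"
    and nz: "0 \<notin> S"
    and lac: "\<And>x y. x \<in> S \<Longrightarrow> y \<in> S \<Longrightarrow> x \<noteq> y \<Longrightarrow> norm y \<le> norm x \<Longrightarrow> norm y \<le> 9/10 * norm x"
  shows "m * card S \<le> m * card (close_pairs A A' m (\<lambda>z. k / z) X) + 65 * (card A + card A') + 44 * m"
proof -
  have fS: "finite S" using S fin(3) finite_subset by blast
  have "inj_on norm S"
  proof (rule inj_onI)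
    fix x y assume xy: "x \<in> S" "y \<in> S" "norm x = norm y"
    show "x = y"
    proof (rule ccontr)
      assume "x \<noteq> y"
      then have "norm x \<le> 0" using lac[of x y] xy by simp
      then show False using xy nz by simp
    qed
  qed
  then obtain b where b: "bij_betw b {..<card S} S"
    and mono: "\<And>i j. i < j \<Longrightarrow> j < card S \<Longrightarrow> norm (b i) < norm (b j)"
    using norm_enumeration[OF fS] by blast
  define n where "n = card S"
  have bS: "b i \<in> S" if "i < n" for i using b that by (auto simp: bij_betw_def n_def)
  have bnz: "b i \<noteq> 0" if "i < n" for i using bS[OF that] nz by auto
  have blac: "norm (b i) \<le> 9/10 * norm (b j)" if "i < j" "j < n" for i j
    using lac[of "b j" "b i"] mono[of i j] bS that by (force simp: n_def)
  have small: "100 * norm (b i) \<le> norm (b (i + 44))" if "i < n - 44" for i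
  proof -
    have "norm (b i) \<le> (9/10) ^ 44 * norm (b (i + 44))"
      by (rule lacunary_power[OF blac]) (use that in auto)
    also have "\<dots> \<le> 1/100 * norm (b (i + 44))"
      by (intro mult_right_mono) (simp_all add: power_divide)
    finally show ?thesis by simp
  qed
  define I where "I = {..<n - 44}"
  define D where "D i = cball (b i + norm (b (i + 44)) *\<^sub>R sgn (b i)) (norm (b (i + 44)))" for i
  define D' where "D' i = cball (k / b (i + 44) + norm (k / b i) *\<^sub>R sgn (k / b (i + 44))) (norm (k / b i))" for i
  have I: "i < n" "i + 44 < n" if "i \<in> I" for i using that by (auto simp: I_def)
  have dirI: "norm (sgn (b i) - sgn (b (i + 44))) \<le> 1/20" if "i \<in> I" for i
    using I[OF that] bS dir by blast
  have dirI': "norm (sgn (k / b (i + 44)) - sgn (k / b i)) \<le> 1/20" if "i \<in> I" for i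
  proof -
    have s: "sgn (k / x) = sgn k / sgn x" for x by (simp add: sgn_eq norm_divide)
    have n: "b i \<noteq> 0" "b (i + 44) \<noteq> 0" using bnz I that by blast+
    have "sgn (k / b (i + 44)) - sgn (k / b i) = sgn k * (sgn (b i) - sgn (b (i + 44))) / (sgn (b i) * sgn (b (i + 44)))"
      unfolding s using n by (simp add: divide_simps sgn_zero_iff) (simp add: algebra_simps)
    then have "norm (sgn (k / b (i + 44)) - sgn (k / b i)) = norm (sgn (b i) - sgn (b (i + 44)))"
      using k n by (simp only: norm_mult norm_divide norm_sgn) simp
    then show ?thesis using dirI[OF that] by (simp add: norm_minus_commute)
  qed
  have small': "100 * norm (k / b (i + 44)) \<le> norm (k / b i)" if "i \<in> I" for i
  proof -
    have "norm k * (100 * norm (b i)) \<le> norm k * norm (b (i + 44))"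
      using small that by (intro mult_left_mono) (auto simp: I_def)
    then show ?thesis using bnz I[OF that] by (simp add: norm_divide field_simps)
  qed
  note fp = far_pair_disc[OF bnz bnz dirI small]
  have kb: "k / b i \<noteq> 0" if "i < n" for i using bnz[OF that] k by simp
  note fp' = far_pair_disc[OF kb kb dirI' small']
  have fI: "finite I" by (simp add: I_def)
  have ov: "card {i\<in>I. p \<in> D i} \<le> 65" for p
  proof -
    have "{i\<in>I. p \<in> D i} \<subseteq> {i \<in> {..<n - 44}. norm (b i) \<le> 3 * norm p \<and> norm p \<le> 3 * norm (b (i + 44))}"
    proof
      fix i assume i: "i \<in> {i\<in>I. p \<in> D i}"
      have "norm (b i) \<le> norm p \<and> norm p \<le> 3 * norm (b (i + 44))"
        by (rule fp(3)) (use i I in \<open>auto simp: D_def I_def\<close>)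
      then show "i \<in> {i \<in> {..<n - 44}. norm (b i) \<le> 3 * norm p \<and> norm p \<le> 3 * norm (b (i + 44))}"
        using i norm_ge_zero[of p] unfolding I_def mem_Collect_eq by linarith
    qed
    then have "card {i\<in>I. p \<in> D i} \<le> card {i \<in> {..<n - 44}. norm (b i) \<le> 3 * norm p \<and> norm p \<le> 3 * norm (b (i + 44))}"
      by (rule card_mono[rotated]) simp
    also have "\<dots> \<le> 65" by (rule lacunary_overlap[OF blac bnz])
    finally show ?thesis .
  qed
  have ov': "card {i\<in>I. p \<in> D' i} \<le> 65" for p
  proof -
    define q where "q = norm (k / p)"
    have "{i\<in>I. p \<in> D' i} \<subseteq> {i \<in> {..<n - 44}. norm (b i) \<le> 3 * q \<and> q \<le> 3 * norm (b (i + 44))}"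
    proof
      fix i assume i: "i \<in> {i\<in>I. p \<in> D' i}"
      have n: "b i \<noteq> 0" "b (i + 44) \<noteq> 0" using bnz I i by blast+
      have *: "norm (k / b (i + 44)) \<le> norm p \<and> norm p \<le> 3 * norm (k / b i)"
        by (rule fp'(3)) (use i I in \<open>auto simp: D'_def\<close>)
      moreover have "norm (k / b (i + 44)) > 0" using k n by simp
      ultimately have p0: "norm p > 0" by linarith
      then have "q \<le> norm (b (i + 44))" "norm (b i) \<le> 3 * q"
        using * n by (auto simp: q_def norm_divide field_simps)
      then show "i \<in> {i \<in> {..<n - 44}. norm (b i) \<le> 3 * q \<and> q \<le> 3 * norm (b (i + 44))}"
        using i norm_ge_zero[of "b (i + 44)"] unfolding I_def mem_Collect_eq by linarith
    qed
    then have "card {i\<in>I. p \<in> D' i} \<le> card {i \<in> {..<n - 44}. norm (b i) \<le> 3 * q \<and> q \<le> 3 * norm (b (i + 44))}"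
      by (rule card_mono[rotated]) simp
    also have "\<dots> \<le> 65" by (rule lacunary_overlap[OF blac bnz])
    finally show ?thesis .
  qed
  define R where "R = {i\<in>I. card (A \<inter> D i) \<le> m \<and> card (A' \<inter> D' i) \<le> m}"
  have "(\<lambda>i. (b (i + 44), b i)) ` R \<subseteq> close_pairs A A' m (\<lambda>z. k / z) X"
  proof
    fix q assume "q \<in> (\<lambda>i. (b (i + 44), b i)) ` R"
    then obtain i where q: "q = (b (i + 44), b i)" and iR: "i \<in> R" by auto
    have i: "i \<in> I" using iR by (simp add: R_def)
    have ne: "b (i + 44) \<noteq> b i" using mono[of i "i + 44"] I[OF i] by (auto simp: n_def)
    have "close A m (b (i + 44)) (b i)" unfolding close_def
      by (intro conjI exI[of _ "b i + norm (b (i + 44)) *\<^sub>R sgn (b i)"] exI[of _ "norm (b (i + 44))"])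
        (use ne fp(1)[of i] fp(2)[of i] I[OF i] i iR in \<open>auto simp: R_def D_def I_def\<close>)
    moreover have "close A' m (k / b i) (k / b (i + 44))" unfolding close_def
      by (intro conjI exI[of _ "k / b (i + 44) + norm (k / b i) *\<^sub>R sgn (k / b (i + 44))"] exI[of _ "norm (k / b i)"])
        (use ne k bnz fp'(1)[of i] fp'(2)[of i] I[OF i] i iR in \<open>auto simp: R_def D'_def\<close>)
    ultimately show "q \<in> close_pairs A A' m (\<lambda>z. k / z) X"
      using q bS I[OF i] S by (auto simp: close_pairs_def)
  qed
  then have "card ((\<lambda>i. (b (i + 44), b i)) ` R) \<le> card (close_pairs A A' m (\<lambda>z. k / z) X)"
    by (intro card_mono finite_close_pairs fin)
  moreover have "card ((\<lambda>i. (b (i + 44), b i)) ` R) = card R"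
  proof (intro card_image inj_onI)
    fix i j assume "i \<in> R" "j \<in> R" "(b (i + 44), b i) = (b (j + 44), b j)"
    then show "i = j" using b I unfolding R_def bij_betw_def n_def inj_on_def by blast
  qed
  ultimately have "m * card R \<le> m * card (close_pairs A A' m (\<lambda>z. k / z) X)" by simp
  moreover have "m * card I \<le> m * card R + 65 * (card A + card A')"
    unfolding R_def by (rule two_family_count[OF fin(1,2) fI ov ov'])
  moreover have "m * card S \<le> m * card I + 44 * m"
  proof -
    have "card S \<le> card I + 44" by (simp add: I_def n_def)
    then have "m * card S \<le> m * (card I + 44)" by (rule mult_le_mono2)
    then show ?thesis by (simp add: algebra_simps)
  qed
  ultimately show ?thesis by linarith
qed

text \<open>Points whose neighbour is near compared with the pole use the images of their
  nearest-neighbour discs; the remaining points of each cone are lacunary. The overlaps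
  \<open>card T + 1\<close> and \<open>65 * card T\<close> are together at most
  \<open>66 * (card T + 1)\<close>.\<close>

lemma inversion_pairs_count:
  assumes T: "direction_net T" and fin: "finite A" "finite A'" "finite X" and k: "k \<noteq> 0" and X0: "0 \<notin> X"
  shows "m * card X \<le> (card T + 1) * (m * card (close_pairs A A' m (\<lambda>z. k / z) X) + 66 * (card A + card A') + 44 * m)"
    (is "_ \<le> (card T + 1) * (m * ?P + 66 * ?S + 44 * m)")
proof (cases "card X \<ge> 2")
  case True
  obtain nn where nn: "nearest_in X nn" using nearest_in_exists[OF fin(3) True] by blast
  define r where "r x = dist x (nn x)" for x
  define G where "G = {x\<in>X. 6 * r x \<le> norm x}"
  define B where "B = {x\<in>X. 6 * r x > norm x}"
  have "m * card G \<le> m * ?P + (card T + 1) * ?S"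
  proof (rule nearest_pairs_count[OF T fin nn, where z' = "\<lambda>x. k * cnj x /\<^sub>R ((norm x)\<^sup>2 - (r x)\<^sup>2)"
        and r' = "\<lambda>x. r x * norm k / ((norm x)\<^sup>2 - (r x)\<^sup>2)" and h = "\<lambda>p. k / p"])
    show "G \<subseteq> X" by (auto simp: G_def)
    fix x assume x: "x \<in> G"
    then have ne: "nn x \<noteq> x" "nn x \<in> X" "x \<in> X" using nn by (auto simp: nearest_in_def G_def)
    then have r0: "r x > 0" by (simp add: r_def)
    have far: "6 * r x \<le> norm x" using x by (simp add: G_def)
    note inv = inversion_disc[OF r_def r0 far k refl]
    have "k / x \<noteq> k / nn x" using k ne X0 by (auto simp: field_simps)
    then show "k / x \<noteq> k / nn x \<and>
         dist (k / x) (k * cnj x /\<^sub>R ((norm x)\<^sup>2 - (r x)\<^sup>2)) \<le> dist (k / x) (k / nn x) / 5 \<and>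
         k / nn x \<in> cball (k * cnj x /\<^sub>R ((norm x)\<^sup>2 - (r x)\<^sup>2)) (r x * norm k / ((norm x)\<^sup>2 - (r x)\<^sup>2))"
      using inv(1,2) by blast
    fix p assume "p \<in> cball (k * cnj x /\<^sub>R ((norm x)\<^sup>2 - (r x)\<^sup>2)) (r x * norm k / ((norm x)\<^sup>2 - (r x)\<^sup>2))"
    then show "k / p \<in> cball x (dist x (nn x))" using inv(3) by (simp add: r_def)
  qed
  moreover have "m * card B \<le> card T * (m * ?P + 65 * ?S + 44 * m)"
  proof (rule weighted_card_le_by_cones[OF T, where f = "\<lambda>x. x"])
    show "finite B" using fin by (simp add: B_def)
    show "\<And>x. x \<in> B \<Longrightarrow> x \<noteq> 0" using X0 by (auto simp: B_def)
    fix t assume "t \<in> T"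
    show "m * card {x\<in>B. x \<in> cone_at t} \<le> m * ?P + 65 * ?S + 44 * m"
    proof (rule lacunary_pairs_count[OF fin _ k])
      show "{x\<in>B. x \<in> cone_at t} \<subseteq> X" by (auto simp: B_def)
      show "0 \<notin> {x\<in>B. x \<in> cone_at t}" by (simp add: cone_at_def)
      fix x y assume x: "x \<in> {x\<in>B. x \<in> cone_at t}" and y: "y \<in> {x\<in>B. x \<in> cone_at t}"
      then show sg: "norm (sgn x - sgn y) \<le> 1/20" using cone_at_sgn_diff by blast
      assume ne: "x \<noteq> y" and le: "norm y \<le> norm x"
      have xX: "x \<in> X" "y \<in> X" and bad: "norm x < 6 * r x" using x y by (auto simp: B_def)
      have "r x \<le> dist x y" using nn xX ne by (auto simp: nearest_in_def r_def)
      have nz: "x \<noteq> 0" "y \<noteq> 0" using X0 xX by auto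
      have "x - y = (norm x - norm y) *\<^sub>R sgn x + norm y *\<^sub>R (sgn x - sgn y)"
        using nz by (simp add: scaleR_right_diff_distrib sgn_div_norm left_diff_distrib scaleR_left_diff_distrib)
      then have "norm (x - y) \<le> norm ((norm x - norm y) *\<^sub>R sgn x) + norm (norm y *\<^sub>R (sgn x - sgn y))"
        by (metis norm_triangle_ineq)
      also have "\<dots> = (norm x - norm y) + norm y * norm (sgn x - sgn y)"
        using le nz by (simp add: norm_sgn)
      also have "\<dots> \<le> (norm x - norm y) + norm y * (1/20)"
        using sg by (intro add_left_mono mult_left_mono) auto
      finally have "dist x y \<le> norm x - norm y + norm y / 20" by (simp add: dist_norm)
      \<comment> \<open>From \<open>norm x < 6 * r x\<close> and
        \<open>r x \<le> norm x - 19/20 * norm y\<close> follows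
        \<open>norm y < 50/57 * norm x\<close>, which is where the ratio 9/10 comes from.\<close>
      then show "norm y \<le> 9/10 * norm x" using bad \<open>r x \<le> dist x y\<close> norm_ge_zero[of x] by linarith
    qed
  qed
  moreover have "card X \<le> card G + card B"
  proof -
    have "X = G \<union> B" by (auto simp: G_def B_def)
    then show ?thesis by (metis card_Un_le)
  qed
  then have "m * card X \<le> m * card G + m * card B" by (metis distrib_left mult_le_mono2)
  ultimately have "m * card X \<le> m * ?P + (card T + 1) * ?S + card T * (m * ?P + 65 * ?S + 44 * m)"
    by linarith
  also have "\<dots> \<le> (card T + 1) * (m * ?P + 66 * ?S + 44 * m)" by (simp add: algebra_simps)
  finally show ?thesis .
next
  case False
  then have "m * card X \<le> m * 1" by (intro mult_le_mono2) auto
  also have "\<dots> \<le> (card T + 1) * (m * ?P + 66 * ?S + 44 * m)" by (simp add: algebra_simps)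
  finally show ?thesis .
qed


section \<open>From the inversion at 0 to all involutions\<close>

lemma close_translate: "close ((\<lambda>z. z - c) ` A) m (x - c) (u - c) \<longleftrightarrow> close A m x u"
proof -
  have c: "card ((\<lambda>z. z - c) ` A \<inter> cball (z - c) r) = card (A \<inter> cball z r)" for z r
  proof -
    have "(\<lambda>z. z - c) ` A \<inter> cball (z - c) r = (\<lambda>z. z - c) ` (A \<inter> cball z r)" by (auto simp: dist_norm)
    then show ?thesis by (simp add: card_image inj_on_def)
  qed
  have "(\<exists>z r. P z r) \<longleftrightarrow> (\<exists>z r. P (z - c) r)" for P :: "complex \<Rightarrow> real \<Rightarrow> bool"
    by (metis diff_add_cancel add_diff_cancel)
  from this[of "\<lambda>z r. dist (x - c) z \<le> dist (x - c) (u - c) / 5 \<and> u - c \<in> cball z r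
      \<and> card ((\<lambda>z. z - c) ` A \<inter> cball z r) \<le> m"]
  show ?thesis unfolding close_def c by (simp add: dist_norm)
qed

text \<open>The solution \<open>t\<close> of the symmetric relation
  \<open>c + b * (z + t) + a * z * t = 0\<close>, which is degenerate when
  \<open>b\<^sup>2 = a * c\<close>.\<close>

definition involution :: "complex \<Rightarrow> complex \<Rightarrow> complex \<Rightarrow> complex \<Rightarrow> complex" where
  "involution a b c z = - (b * z + c) / (a * z + b)"

lemma involution_unique:
  assumes "b\<^sup>2 \<noteq> a * c" "c + b * (z + t) + a * z * t = 0"
  shows "a * z + b \<noteq> 0" "t = involution a b c z"
proof -
  have e: "(a * z + b) * t = - (b * z + c)" using assms(2) by algebra
  show n: "a * z + b \<noteq> 0"
  proof
    assume "a * z + b = 0"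
    then have "b = - (a * z)" "b * z + c = 0" using e by (auto simp: add_eq_0_iff)
    then have "b\<^sup>2 = a * c" by algebra
    then show False using assms(1) by simp
  qed
  show "t = involution a b c z" using e n by (simp add: involution_def field_simps)
qed

text \<open>For \<open>a = 0\<close> the map is a point reflection. Otherwise its pole is
  \<open>s = - b / a\<close>, and translating the pole to 0 turns the map into \<open>k / z\<close>.
  The number 132 is twice 66, since \<open>A\<close> is both source and target.\<close>

lemma involution_pairs_count:
  assumes T: "direction_net T" and A: "finite A" and nd: "b\<^sup>2 \<noteq> a * c"
    and X: "finite X" "\<And>z. z \<in> X \<Longrightarrow> a * z + b \<noteq> 0"
  shows "m * card X \<le> (card T + 1) * (m * card (close_pairs A A m (involution a b c) X) + 132 * card A + 44 * m)"
proof (cases "a = 0")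
  case True
  then have "b \<noteq> 0" using nd by auto
  then have "involution a b c z = (- c / b) - z" for z
    using True by (simp add: involution_def field_simps)
  then have "m * card X \<le> m * card (close_pairs A A m (involution a b c) X) + (card T + 1) * (card A + card A) + m"
    by (rule reflection_pairs_count[OF T A A X(1)])
  also have "\<dots> \<le> (card T + 1) * (m * card (close_pairs A A m (involution a b c) X) + 132 * card A + 44 * m)"
    by (simp add: algebra_simps)
  finally show ?thesis .
next
  case False
  define s where "s = - b / a"
  define k where "k = (b\<^sup>2 - a * c) / a\<^sup>2"
  have k0: "k \<noteq> 0" using nd False by (simp add: k_def)
  define tr where "tr = (\<lambda>z. z - s)"
  have inj: "inj_on tr Y" for Y by (simp add: tr_def inj_on_def)
  have Xs: "z \<noteq> s" if "z \<in> X" for z using X(2)[OF that] False by (auto simp: s_def field_simps)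
  have inv: "k / tr z = tr (involution a b c z)" if "z \<in> X" for z
  proof -
    have "a * z + b \<noteq> 0" using X(2)[OF that] .
    moreover have "tr z = (a * z + b) / a" using False by (simp add: tr_def s_def field_simps)
    ultimately show ?thesis
      using False by (simp add: k_def tr_def s_def involution_def divide_simps power2_eq_square)
        (simp add: algebra_simps)
  qed
  have "m * card (tr ` X) \<le> (card T + 1) * (m * card (close_pairs (tr ` A) (tr ` A) m (\<lambda>z. k / z) (tr ` X))
      + 66 * (card (tr ` A) + card (tr ` A)) + 44 * m)"
    by (rule inversion_pairs_count[OF T _ _ _ k0]) (use A X Xs in \<open>auto simp: tr_def\<close>)
  moreover have "close_pairs (tr ` A) (tr ` A) m (\<lambda>z. k / z) (tr ` X)
      \<subseteq> (\<lambda>(x, y). (tr x, tr y)) ` close_pairs A A m (involution a b c) X"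
  proof
    fix q assume "q \<in> close_pairs (tr ` A) (tr ` A) m (\<lambda>z. k / z) (tr ` X)"
    then obtain x y where q: "q = (tr x, tr y)" and xy: "x \<in> X" "y \<in> X"
      and cl: "close (tr ` A) m (tr x) (tr y)"
        "close (tr ` A) m (k / tr x) (k / tr y) \<or> close (tr ` A) m (k / tr y) (k / tr x)"
      by (auto simp: close_pairs_def)
    have "(x, y) \<in> close_pairs A A m (involution a b c) X"
      using cl xy unfolding inv[OF xy(1)] inv[OF xy(2)] unfolding tr_def close_translate
      by (simp add: close_pairs_def)
    then show "q \<in> (\<lambda>(x, y). (tr x, tr y)) ` close_pairs A A m (involution a b c) X" using q by force
  qed
  then have "card (close_pairs (tr ` A) (tr ` A) m (\<lambda>z. k / z) (tr ` X))
      \<le> card (close_pairs A A m (involution a b c) X)"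
    by (meson X(1) card_image_le card_mono finite_close_pairs finite_imageI le_trans)
  ultimately show ?thesis unfolding card_image[OF inj]
    by (elim order_trans) (intro mult_le_mono2 add_mono mult_le_mono2; simp)
qed

section \<open>Incidences\<close>

definition apolar :: "(nat \<Rightarrow> complex) \<Rightarrow> complex \<Rightarrow> complex \<Rightarrow> complex \<Rightarrow> complex \<Rightarrow> complex" where
  "apolar g x y z t = g 4 - g 3 * (x + y + z + t) + g 2 * (x*y + x*z + x*t + y*z + y*t + z*t)
     - g 1 * (x*y*z + x*y*t + x*z*t + y*z*t) + g 0 * (x*y*z*t)"

definition hankel_regular :: "(nat \<Rightarrow> complex) \<Rightarrow> bool" where
  "hankel_regular g \<longleftrightarrow> (\<forall>u v w. g 0 * u + g 1 * v + g 2 * w = 0 \<longrightarrow> g 1 * u + g 2 * v + g 3 * w = 0 \<longrightarrow>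
     g 2 * u + g 3 * v + g 4 * w = 0 \<longrightarrow> u = 0 \<and> v = 0 \<and> w = 0)"

text \<open>Up to the sign of the middle one, the three coefficients are the Hankel matrix applied
  to the vector \<open>(x * y, - (x + y), 1)\<close>. This is how regularity makes the unordered
  pair recoverable from its involution.\<close>

definition lead_co :: "(nat \<Rightarrow> complex) \<Rightarrow> complex \<Rightarrow> complex \<Rightarrow> complex" where
  "lead_co g x y = g 0 * (x * y) - g 1 * (x + y) + g 2"
definition mid_co :: "(nat \<Rightarrow> complex) \<Rightarrow> complex \<Rightarrow> complex \<Rightarrow> complex" where
  "mid_co g x y = - (g 1 * (x * y) - g 2 * (x + y) + g 3)"
definition const_co :: "(nat \<Rightarrow> complex) \<Rightarrow> complex \<Rightarrow> complex \<Rightarrow> complex" where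
  "const_co g x y = g 2 * (x * y) - g 3 * (x + y) + g 4"

lemmas co_defs = lead_co_def mid_co_def const_co_def

lemma apolar_bilinear: "apolar g x y z t = const_co g x y + mid_co g x y * (z + t) + lead_co g x y * z * t"
  unfolding apolar_def co_defs by algebra

lemma apolar_swap: "apolar g y x z t = apolar g x y z t" "apolar g x y t z = apolar g x y z t"
  by (simp_all add: apolar_def algebra_simps)

lemma pair_from_sum_prod:
  fixes x y :: complex
  assumes "x + y = x' + y'" "x * y = x' * y'"
  shows "(x = x' \<and> y = y') \<or> (x = y' \<and> y = x')"
proof -
  have "(x - x') * (x - y') = 0" using assms by algebra
  then show ?thesis using assms by auto
qed

lemma co_nonzero:
  assumes "hankel_regular g"
  shows "\<not> (lead_co g x y = 0 \<and> mid_co g x y = 0 \<and> const_co g x y = 0)"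
proof
  assume "lead_co g x y = 0 \<and> mid_co g x y = 0 \<and> const_co g x y = 0"
  then have "g 0 * (x * y) + g 1 * (- (x + y)) + g 2 * 1 = 0" "g 1 * (x * y) + g 2 * (- (x + y)) + g 3 * 1 = 0"
    "g 2 * (x * y) + g 3 * (- (x + y)) + g 4 * 1 = 0"
    unfolding co_defs by algebra+
  then have "(1::complex) = 0" using assms unfolding hankel_regular_def by blast
  then show False by simp
qed

text \<open>The matrix kills the vector of \<open>x', y'\<close> minus \<open>\<mu>\<close> times
  the vector of \<open>x, y\<close>. By regularity the difference is 0, and its last entry
  \<open>1 - \<mu>\<close> gives \<open>\<mu> = 1\<close>.\<close>

lemma co_proportional:
  assumes H: "hankel_regular g"
    and "lead_co g x' y' = \<mu> * lead_co g x y" "mid_co g x' y' = \<mu> * mid_co g x y"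
      "const_co g x' y' = \<mu> * const_co g x y"
  shows "x' + y' = x + y" "x' * y' = x * y"
proof -
  let ?u = "x' * y' - \<mu> * (x * y)" and ?v = "- (x' + y') + \<mu> * (x + y)" and ?w = "1 - \<mu>"
  have "g 0 * ?u + g 1 * ?v + g 2 * ?w = 0" "g 1 * ?u + g 2 * ?v + g 3 * ?w = 0" "g 2 * ?u + g 3 * ?v + g 4 * ?w = 0"
    using assms(2-4) unfolding co_defs by algebra+
  then have "?u = 0 \<and> ?v = 0 \<and> ?w = 0" using H unfolding hankel_regular_def by blast
  then show "x' + y' = x + y" "x' * y' = x * y" by algebra+
qed

text \<open>The relation is linear in its coefficients and sees an orbit only through
  \<open>z + t\<close> and \<open>z * t\<close>, so two different orbits fix the coefficients up to
  a factor. Non-degeneracy for \<open>x, y\<close> prevents \<open>\<alpha> = \<beta> = 0\<close>,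
  so the factor can be read off from these two.\<close>

lemma two_incidences_determine:
  assumes H: "hankel_regular g"
    and nd: "(mid_co g x y)\<^sup>2 \<noteq> lead_co g x y * const_co g x y"
    and a: "apolar g x y z t = 0" "apolar g x y z' t' = 0" "apolar g x' y' z t = 0" "apolar g x' y' z' t' = 0"
    and ne: "z + t \<noteq> z' + t' \<or> z * t \<noteq> z' * t'"
  shows "x' + y' = x + y" "x' * y' = x * y"
proof -
  define \<alpha> \<beta> \<gamma> \<alpha>' \<beta>' \<gamma>' where "\<alpha> = lead_co g x y" and "\<beta> = mid_co g x y" and "\<gamma> = const_co g x y"
    and "\<alpha>' = lead_co g x' y'" and "\<beta>' = mid_co g x' y'" and "\<gamma>' = const_co g x' y'"
  have e: "\<gamma> + \<beta> * (z + t) + \<alpha> * z * t = 0" "\<gamma> + \<beta> * (z' + t') + \<alpha> * z' * t' = 0"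
    "\<gamma>' + \<beta>' * (z + t) + \<alpha>' * z * t = 0" "\<gamma>' + \<beta>' * (z' + t') + \<alpha>' * z' * t' = 0"
    using a unfolding apolar_bilinear \<alpha>_def \<beta>_def \<gamma>_def \<alpha>'_def \<beta>'_def \<gamma>'_def by auto
  have "(\<alpha> * \<beta>' - \<alpha>' * \<beta>) * (z * t - z' * t') = 0" "(\<alpha> * \<beta>' - \<alpha>' * \<beta>) * (z + t - (z' + t')) = 0"
    using e by algebra+
  then have det: "\<alpha> * \<beta>' = \<alpha>' * \<beta>" using ne by auto
  have "\<exists>\<mu>. \<alpha>' = \<mu> * \<alpha> \<and> \<beta>' = \<mu> * \<beta>"
  proof (cases "\<alpha> = 0")
    case True
    then have "\<beta> \<noteq> 0" using nd by (auto simp: \<alpha>_def \<beta>_def)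
    then show ?thesis using det True by (intro exI[of _ "\<beta>' / \<beta>"]) auto
  next
    case False
    then show ?thesis using det by (intro exI[of _ "\<alpha>' / \<alpha>"]) (auto simp: field_simps)
  qed
  then obtain \<mu> where mu: "\<alpha>' = \<mu> * \<alpha>" "\<beta>' = \<mu> * \<beta>" by blast
  moreover have "\<gamma>' = \<mu> * \<gamma>" using e(1,3) mu by algebra
  ultimately show "x' + y' = x + y" "x' * y' = x * y"
    using co_proportional[OF H] unfolding \<alpha>_def \<beta>_def \<gamma>_def \<alpha>'_def \<beta>'_def \<gamma>'_def by blast+
qed

text \<open>\<open>absorbing g x y z\<close> means that \<open>apolar g x y z t = 0\<close> for all \<open>t\<close>.\<close>

definition absorbing :: "(nat \<Rightarrow> complex) \<Rightarrow> complex \<Rightarrow> complex \<Rightarrow> complex \<Rightarrow> bool" where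
  "absorbing g x y z \<longleftrightarrow> lead_co g x y * z + mid_co g x y = 0 \<and> mid_co g x y * z + const_co g x y = 0"

text \<open>With vanishing discriminant the relation, multiplied by \<open>\<alpha>\<close>, splits
  as \<open>(\<alpha> * z + \<beta>) * (\<alpha> * t + \<beta>) = 0\<close>; and
  \<open>\<alpha>\<close> is nonzero, as otherwise all three coefficients would vanish.\<close>

lemma degenerate_absorbing:
  assumes H: "hankel_regular g" and d: "(mid_co g x y)\<^sup>2 = lead_co g x y * const_co g x y"
    and a: "apolar g x y z t = 0"
  shows "absorbing g x y z \<or> absorbing g x y t"
proof -
  define \<alpha> \<beta> \<gamma> where "\<alpha> = lead_co g x y" and "\<beta> = mid_co g x y" and "\<gamma> = const_co g x y"
  have e: "\<gamma> + \<beta> * (z + t) + \<alpha> * z * t = 0" and d': "\<beta>\<^sup>2 = \<alpha> * \<gamma>"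
    using a d unfolding apolar_bilinear \<alpha>_def \<beta>_def \<gamma>_def by auto
  have a0: "\<alpha> \<noteq> 0"
  proof
    assume "\<alpha> = 0"
    then have "\<beta> = 0" "\<gamma> = 0" using d' e by auto
    then show False using \<open>\<alpha> = 0\<close> co_nonzero[OF H, of x y] by (simp add: \<alpha>_def \<beta>_def \<gamma>_def)
  qed
  have "(\<alpha> * z + \<beta>) * (\<alpha> * t + \<beta>) = 0" using e d' by algebra
  moreover have "\<beta> * w + \<gamma> = 0" if "\<alpha> * w + \<beta> = 0" for w
  proof -
    have "\<alpha> * (\<beta> * w + \<gamma>) = 0" using that d' by algebra
    then show ?thesis using a0 by simp
  qed
  ultimately show ?thesis unfolding absorbing_def \<alpha>_def \<beta>_def \<gamma>_def by auto
qed

text \<open>By symmetry of the form, the Hankel matrix sends \<open>(y * z, - (y + z), 1)\<close> to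
  a multiple of \<open>(1, x, x\<^sup>2)\<close>. A regular matrix determines the preimage up to
  scale, and the last entry 1 fixes the scale.\<close>

lemma absorbing_unique:
  assumes H: "hankel_regular g" and "absorbing g x y z" "absorbing g x y' z'"
  shows "y + z = y' + z'" "y * z = y' * z'"
proof -
  define k k' where "k = lead_co g y z" and "k' = lead_co g y' z'"
  have e: "- mid_co g y z = k * x" "const_co g y z = k * x\<^sup>2"
    "- mid_co g y' z' = k' * x" "const_co g y' z' = k' * x\<^sup>2"
    using assms(2,3) unfolding absorbing_def k_def k'_def co_defs by algebra+
  let ?u = "k' * (y * z) - k * (y' * z')" and ?v = "- k' * (y + z) + k * (y' + z')" and ?w = "k' - k"
  have "g 0 * ?u + g 1 * ?v + g 2 * ?w = 0" "g 1 * ?u + g 2 * ?v + g 3 * ?w = 0" "g 2 * ?u + g 3 * ?v + g 4 * ?w = 0"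
    using e k_def k'_def unfolding co_defs by algebra+
  then have "?u = 0 \<and> ?v = 0 \<and> ?w = 0" using H unfolding hankel_regular_def by blast
  moreover have "k \<noteq> 0"
    using co_nonzero[OF H, of y z] e by (auto simp: k_def)
  ultimately show "y + z = y' + z'" "y * z = y' * z'" by auto
qed

lemma card_absorbing_le:
  assumes H: "hankel_regular g" and A: "finite A"
  shows "card {(x, y, z). x \<in> A \<and> y \<in> A \<and> z \<in> A \<and> absorbing g x y z} \<le> 2 * card A"
proof -
  have b: "card {(y, z). y \<in> A \<and> z \<in> A \<and> absorbing g x y z} \<le> 2" for x
  proof (cases "\<exists>y z. absorbing g x y z")
    case True
    then obtain y z where yz: "absorbing g x y z" by blast
    have "{(y, z). y \<in> A \<and> z \<in> A \<and> absorbing g x y z} \<subseteq> {(y, z), (z, y)}"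
      using pair_from_sum_prod absorbing_unique[OF H _ yz] by blast
    then have "card {(y, z). y \<in> A \<and> z \<in> A \<and> absorbing g x y z} \<le> card {(y, z), (z, y)}"
      by (rule card_mono[rotated]) simp
    also have "\<dots> \<le> 2" using card_length[of "[(y, z), (z, y)]"] by simp
    finally show ?thesis .
  qed simp
  have fin: "finite {(y, z). y \<in> A \<and> z \<in> A \<and> absorbing g x y z}" for x
    by (rule finite_subset[of _ "A \<times> A"]) (use A in auto)
  have "{(x, y, z). x \<in> A \<and> y \<in> A \<and> z \<in> A \<and> absorbing g x y z}
      = (SIGMA x:A. {(y, z). y \<in> A \<and> z \<in> A \<and> absorbing g x y z})" by auto
  also have "card \<dots> = (\<Sum>x\<in>A. card {(y, z). y \<in> A \<and> z \<in> A \<and> absorbing g x y z})"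
    using A fin by (intro card_SigmaI) auto
  also have "\<dots> \<le> (\<Sum>x\<in>A. 2)" by (intro sum_mono b)
  finally show ?thesis by simp
qed


text \<open>The injective ranking \<open>f\<close> selects one ordering of each unordered pair.\<close>

definition rich_set :: "(nat \<Rightarrow> complex) \<Rightarrow> complex set \<Rightarrow> (complex \<Rightarrow> nat) \<Rightarrow> complex \<Rightarrow> complex \<Rightarrow> complex set" where
  "rich_set g A f x y = {z\<in>A. \<exists>t\<in>A. f z < f t \<and> apolar g x y z t = 0}"

definition partner :: "(nat \<Rightarrow> complex) \<Rightarrow> complex \<Rightarrow> complex \<Rightarrow> complex \<Rightarrow> complex" where
  "partner g x y = involution (lead_co g x y) (mid_co g x y) (const_co g x y)"

definition regular_pairs :: "(nat \<Rightarrow> complex) \<Rightarrow> complex set \<Rightarrow> (complex \<Rightarrow> nat) \<Rightarrow> (complex \<times> complex) set" where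
  "regular_pairs g A f = {(x, y). x \<in> A \<and> y \<in> A \<and> f x < f y \<and> (mid_co g x y)\<^sup>2 \<noteq> lead_co g x y * const_co g x y}"

lemma partner_eq:
  assumes "(mid_co g x y)\<^sup>2 \<noteq> lead_co g x y * const_co g x y" "apolar g x y z t = 0"
  shows "lead_co g x y * z + mid_co g x y \<noteq> 0" "partner g x y z = t"
  using involution_unique[OF assms(1)] assms(2) unfolding apolar_bilinear partner_def by metis+

lemma rich_set_partner:
  assumes "(x, y) \<in> regular_pairs g A f" "z \<in> rich_set g A f x y"
  shows "z \<in> A" "partner g x y z \<in> A" "f z < f (partner g x y z)" "apolar g x y z (partner g x y z) = 0"
    "lead_co g x y * z + mid_co g x y \<noteq> 0"
proof -
  obtain t where t: "t \<in> A" "f z < f t" "apolar g x y z t = 0" and z: "z \<in> A"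
    using assms(2) by (auto simp: rich_set_def)
  have nd: "(mid_co g x y)\<^sup>2 \<noteq> lead_co g x y * const_co g x y" using assms(1) by (simp add: regular_pairs_def)
  have p: "partner g x y z = t" by (rule partner_eq(2)[OF nd t(3)])
  show "z \<in> A" "partner g x y z \<in> A" "f z < f (partner g x y z)" "apolar g x y z (partner g x y z) = 0"
    unfolding p by fact+
  show "lead_co g x y * z + mid_co g x y \<noteq> 0" by (rule partner_eq(1)[OF nd t(3)])
qed

text \<open>A close pair carried along by the involution of \<open>x, y\<close> is recorded together
  with the pair of partners. Two orbits determine \<open>x, y\<close>, so the record is injective
  and the sum is at most the number of pairs of close pairs; the factor 2 is for the order of the
  partners.\<close>

lemma sum_close_pairs_le:
  assumes T: "direction_net T" and A: "finite A" and H: "hankel_regular g" and f: "inj_on f A"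
  shows "(\<Sum>(x, y)\<in>regular_pairs g A f. card (close_pairs A A m (partner g x y) (rich_set g A f x y)))
    \<le> 2 * (card A * (card T * m))\<^sup>2"
proof -
  define R where "R = regular_pairs g A f"
  define P where "P = (\<lambda>(x, y). close_pairs A A m (partner g x y) (rich_set g A f x y))"
  define K where "K = {(x, u). x \<in> A \<and> u \<in> A \<and> close A m x u}"
  have fK: "finite K" by (rule finite_subset[of _ "A \<times> A"]) (use A in \<open>auto simp: K_def\<close>)
  have fR: "finite R" by (rule finite_subset[of _ "A \<times> A"]) (use A in \<open>auto simp: R_def regular_pairs_def\<close>)
  have fP: "finite (P e)" for e
    using A by (cases e) (auto simp: P_def rich_set_def intro!: finite_close_pairs)
  define h where "h = (\<lambda>((x, y), (z, z')). ((z, z'), (partner g x y z, partner g x y z')))"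
  have sub: "h ` (SIGMA e:R. P e) \<subseteq> K \<times> (K \<union> prod.swap ` K)"
  proof
    fix q assume "q \<in> h ` (SIGMA e:R. P e)"
    then obtain x y z z' where q: "q = ((z, z'), (partner g x y z, partner g x y z'))"
      and e: "(x, y) \<in> R" and zz: "(z, z') \<in> P (x, y)" by (auto simp: h_def)
    have r: "z \<in> rich_set g A f x y" "z' \<in> rich_set g A f x y" using zz by (auto simp: P_def close_pairs_def)
    note p = rich_set_partner[OF e[unfolded R_def] r(1)] rich_set_partner[OF e[unfolded R_def] r(2)]
    show "q \<in> K \<times> (K \<union> prod.swap ` K)"
      using zz p q by (auto simp: P_def close_pairs_def K_def)
  qed
  have inj: "inj_on h (SIGMA e:R. P e)"
  proof (rule inj_onI)
    fix p q assume p: "p \<in> (SIGMA e:R. P e)" and q: "q \<in> (SIGMA e:R. P e)" and eq: "h p = h q"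
    obtain x y z z' where p': "p = ((x, y), (z, z'))" by (metis surj_pair)
    obtain x' y' where q': "q = ((x', y'), (z, z'))"
      and pe: "partner g x' y' z = partner g x y z" "partner g x' y' z' = partner g x y z'"
      using eq p' by (cases q) (auto simp: h_def)
    have R: "(x, y) \<in> R" "(x', y') \<in> R" using p q p' q' by auto
    have ne: "z \<noteq> z'" and r: "z \<in> rich_set g A f x y" "z' \<in> rich_set g A f x y"
      "z \<in> rich_set g A f x' y'" "z' \<in> rich_set g A f x' y'"
      using p q p' q' by (auto simp: P_def close_pairs_def close_def)
    define t t' where "t = partner g x y z" and "t' = partner g x y z'"
    note P1 = rich_set_partner[OF R(1)[unfolded R_def] r(1), folded t_def]
    note P2 = rich_set_partner[OF R(1)[unfolded R_def] r(2), folded t'_def]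
    note P3 = rich_set_partner[OF R(2)[unfolded R_def] r(3), unfolded pe, folded t_def]
    note P4 = rich_set_partner[OF R(2)[unfolded R_def] r(4), unfolded pe, folded t'_def]
    \<comment> \<open>Equal orbits with \<open>z \<noteq> z'\<close> would make \<open>z\<close> and
      \<open>z'\<close> partners of each other, which the ranking \<open>f\<close> forbids.\<close>
    have "z + t \<noteq> z' + t' \<or> z * t \<noteq> z' * t'"
      using pair_from_sum_prod[of z t z' t'] ne P1(3) P2(3) by auto
    then have "x' + y' = x + y" "x' * y' = x * y"
      using two_incidences_determine[OF H _ P1(4) P2(4) P3(4) P4(4)] R(1) by (auto simp: R_def regular_pairs_def)
    then have "x' = x \<and> y' = y" using pair_from_sum_prod[of x' y' x y] R by (auto simp: R_def regular_pairs_def)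
    then show "p = q" using p' q' by simp
  qed
  have "(\<Sum>e\<in>R. card (P e)) = card (SIGMA e:R. P e)" using fR fP by (simp add: card_SigmaI)
  also have "\<dots> = card (h ` (SIGMA e:R. P e))" by (rule card_image[OF inj, symmetric])
  also have "\<dots> \<le> card (K \<times> (K \<union> prod.swap ` K))" by (rule card_mono[OF _ sub]) (use fK in auto)
  also have "\<dots> \<le> card K * (card K + card K)"
    unfolding card_cartesian_product
    by (intro mult_le_mono2 order_trans[OF card_Un_le] add_mono card_image_le[OF fK]) auto
  also have "\<dots> = 2 * (card K)\<^sup>2" by (simp add: power2_eq_square)
  also have "\<dots> \<le> 2 * (card A * (card T * m))\<^sup>2"
    using card_close_le[OF T A, of m] unfolding K_def by (intro mult_le_mono2 power_mono) auto
  finally show ?thesis unfolding R_def P_def by (simp add: case_prod_unfold)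
qed

text \<open>A tuple with degenerate \<open>x, y\<close> consists of an absorbing triple and a free
  fourth point, in two possible positions; this is the quadratic summand. Every other tuple is given
  by a regular pair and a point of its rich set.\<close>

lemma apolar_tuples_count:
  fixes f :: "complex \<Rightarrow> nat"
  assumes T: "direction_net T" and A: "finite A" and H: "hankel_regular g" and f: "inj_on f A"
  defines "S \<equiv> {(x, y, z, t). x \<in> A \<and> y \<in> A \<and> z \<in> A \<and> t \<in> A \<and> f x < f y \<and> f z < f t \<and> apolar g x y z t = 0}"
  shows "m * card S \<le> 4 * m * (card A)\<^sup>2 + (card T + 1) *
     (m * (2 * (card A * (card T * m))\<^sup>2) + (card A)\<^sup>2 * (132 * card A + 44 * m))"
proof -
  define n where "n = card A"
  define R where "R = regular_pairs g A f"
  have fR: "finite R" by (rule finite_subset[of _ "A \<times> A"]) (use A in \<open>auto simp: R_def regular_pairs_def\<close>)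
  have cR: "card R \<le> n\<^sup>2"
  proof -
    have "card R \<le> card (A \<times> A)" by (rule card_mono) (use A in \<open>auto simp: R_def regular_pairs_def\<close>)
    then show ?thesis by (simp add: n_def card_cartesian_product power2_eq_square)
  qed
  define D where "D = {(x, y, z). x \<in> A \<and> y \<in> A \<and> z \<in> A \<and> absorbing g x y z}"
  have fD: "finite D" by (rule finite_subset[of _ "A \<times> A \<times> A"]) (use A in \<open>auto simp: D_def\<close>)
  have cD: "card D \<le> 2 * n" unfolding D_def n_def by (rule card_absorbing_le[OF H A])
  define E1 where "E1 = (\<lambda>((x, y, z), t). (x, y, z, t)) ` (D \<times> A)"
  define E2 where "E2 = (\<lambda>((x, y, z), t). (x, y, t, z)) ` (D \<times> A)"
  define E3 where "E3 = (\<lambda>((x, y), z). (x, y, z, partner g x y z)) ` (SIGMA e:R. rich_set g A f (fst e) (snd e))"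
  have sub: "S \<subseteq> E1 \<union> (E2 \<union> E3)"
  proof
    fix q assume "q \<in> S"
    then obtain x y z t where q: "q = (x, y, z, t)" and xs: "x \<in> A" "y \<in> A" "z \<in> A" "t \<in> A"
      "f x < f y" "f z < f t" and ap: "apolar g x y z t = 0" by (auto simp: S_def)
    show "q \<in> E1 \<union> (E2 \<union> E3)"
    proof (cases "(mid_co g x y)\<^sup>2 = lead_co g x y * const_co g x y")
      case True
      from degenerate_absorbing[OF H True ap] show ?thesis
      proof
        assume "absorbing g x y z"
        then have "q \<in> E1" unfolding E1_def using xs q by (intro image_eqI[of _ _ "((x, y, z), t)"]) (auto simp: D_def)
        then show ?thesis by simp
      next
        assume "absorbing g x y t"
        then have "q \<in> E2" unfolding E2_def using xs q by (intro image_eqI[of _ _ "((x, y, t), z)"]) (auto simp: D_def)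
        then show ?thesis by simp
      qed
    next
      case False
      have "partner g x y z = t" by (rule partner_eq(2)[OF False ap])
      then have "q \<in> E3" unfolding E3_def using xs q ap False
        by (intro image_eqI[of _ _ "((x, y), z)"]) (auto simp: R_def regular_pairs_def rich_set_def)
      then show ?thesis by simp
    qed
  qed
  have frich: "finite (rich_set g A f x y)" for x y using A by (simp add: rich_set_def)
  have fE: "finite (SIGMA e:R. rich_set g A f (fst e) (snd e))" using fR frich by auto
  have "card S \<le> card E1 + (card E2 + card E3)"
    by (rule order_trans[OF card_mono[OF _ sub] order_trans[OF card_Un_le add_left_mono[OF card_Un_le]]])
      (use fD A fE in \<open>auto simp: E1_def E2_def E3_def\<close>)
  also have "card E1 \<le> 2 * n\<^sup>2"
  proof -
    have "card E1 \<le> card (D \<times> A)" unfolding E1_def using fD A by (intro card_image_le) auto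
    also have "\<dots> \<le> (2 * n) * n" unfolding card_cartesian_product n_def[symmetric] using cD by simp
    finally show ?thesis by (simp add: power2_eq_square)
  qed
  also have "card E2 \<le> 2 * n\<^sup>2"
  proof -
    have "card E2 \<le> card (D \<times> A)" unfolding E2_def using fD A by (intro card_image_le) auto
    also have "\<dots> \<le> (2 * n) * n" unfolding card_cartesian_product n_def[symmetric] using cD by simp
    finally show ?thesis by (simp add: power2_eq_square)
  qed
  also have "card E3 \<le> (\<Sum>e\<in>R. card (rich_set g A f (fst e) (snd e)))"
    using card_image_le[OF fE] fR frich unfolding E3_def by (simp add: card_SigmaI)
  finally have S: "card S \<le> 4 * n\<^sup>2 + (\<Sum>e\<in>R. card (rich_set g A f (fst e) (snd e)))" by simp
  have each: "m * card (rich_set g A f (fst e) (snd e)) \<le> (card T + 1) *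
      (m * card (close_pairs A A m (partner g (fst e) (snd e)) (rich_set g A f (fst e) (snd e))) + 132 * n + 44 * m)"
    if "e \<in> R" for e
    unfolding n_def partner_def
  proof (rule involution_pairs_count[OF T A _ frich])
    have e: "(fst e, snd e) \<in> regular_pairs g A f" using that by (simp add: R_def)
    then show "(mid_co g (fst e) (snd e))\<^sup>2 \<noteq> lead_co g (fst e) (snd e) * const_co g (fst e) (snd e)"
      by (auto simp: regular_pairs_def)
    show "\<And>z. z \<in> rich_set g A f (fst e) (snd e) \<Longrightarrow> lead_co g (fst e) (snd e) * z + mid_co g (fst e) (snd e) \<noteq> 0"
      by (rule rich_set_partner(5)[OF e])
  qed
  have "m * (\<Sum>e\<in>R. card (rich_set g A f (fst e) (snd e))) = (\<Sum>e\<in>R. m * card (rich_set g A f (fst e) (snd e)))"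
    by (simp add: sum_distrib_left)
  also have "\<dots> \<le> (\<Sum>e\<in>R. (card T + 1) *
      (m * card (close_pairs A A m (partner g (fst e) (snd e)) (rich_set g A f (fst e) (snd e))) + (132 * n + 44 * m)))"
    using each by (intro sum_mono) (simp add: add.assoc)
  also have "\<dots> = (card T + 1) *
      (m * (\<Sum>e\<in>R. card (close_pairs A A m (partner g (fst e) (snd e)) (rich_set g A f (fst e) (snd e)))) + card R * (132 * n + 44 * m))"
    by (simp only: sum_distrib_left[symmetric] sum.distrib sum_constant) (simp add: algebra_simps)
  also have "\<dots> \<le> (card T + 1) * (m * (2 * (n * (card T * m))\<^sup>2) + n\<^sup>2 * (132 * n + 44 * m))"
    using sum_close_pairs_le[OF T A H f, of m] cR unfolding R_def n_def case_prod_unfold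
    by (intro mult_le_mono2 add_mono mult_le_mono1) auto
  finally have "m * (\<Sum>e\<in>R. card (rich_set g A f (fst e) (snd e)))
     \<le> (card T + 1) * (m * (2 * (n * (card T * m))\<^sup>2) + n\<^sup>2 * (132 * n + 44 * m))" .
  moreover have "m * card S \<le> m * (4 * n\<^sup>2 + (\<Sum>e\<in>R. card (rich_set g A f (fst e) (snd e))))"
    using S by (rule mult_le_mono2)
  ultimately show ?thesis unfolding n_def[symmetric] by (simp only: distrib_left mult.assoc mult.left_commute[of m 4])
qed

section \<open>Unordered quadruples and the exponent 8/3\<close>

definition apolar_quadruples :: "(nat \<Rightarrow> complex) \<Rightarrow> complex set \<Rightarrow> complex set set" where
  "apolar_quadruples g A = {Q. Q \<subseteq> A \<and> (\<exists>x y z t. Q = {x, y, z, t} \<and> distinct [x, y, z, t] \<and> apolar g x y z t = 0)}"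

lemma card_apolar_quadruples_le:
  assumes A: "finite A" and f: "inj_on f A"
  shows "card (apolar_quadruples g A) \<le>
    card {(x, y, z, t). x \<in> A \<and> y \<in> A \<and> z \<in> A \<and> t \<in> A \<and> (f x :: nat) < f y \<and> f z < f t \<and> apolar g x y z t = 0}"
    (is "_ \<le> card ?S")
proof -
  have fS: "finite ?S" by (rule finite_subset[of _ "A \<times> A \<times> A \<times> A"]) (use A in auto)
  have "apolar_quadruples g A \<subseteq> (\<lambda>(x, y, z, t). {x, y, z, t}) ` ?S"
  proof
    fix Q assume "Q \<in> apolar_quadruples g A"
    then obtain x y z t where Q: "Q = {x, y, z, t}" "Q \<subseteq> A" and d: "distinct [x, y, z, t]"
      and a: "apolar g x y z t = 0" by (auto simp: apolar_quadruples_def)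
    have *: "\<exists>a b. {a, b} = {u, v} \<and> f a < f b \<and> (a = u \<and> b = v \<or> a = v \<and> b = u)" if "u \<in> A" "v \<in> A" "u \<noteq> v" for u v
      using f that by (metis inj_on_eq_iff insert_commute linorder_neqE_nat)
    obtain x' y' where xy: "{x', y'} = {x, y}" "f x' < f y'" "x' = x \<and> y' = y \<or> x' = y \<and> y' = x"
      using *[of x y] Q d by auto
    obtain z' t' where zt: "{z', t'} = {z, t}" "f z' < f t'" "z' = z \<and> t' = t \<or> z' = t \<and> t' = z"
      using *[of z t] Q d by auto
    have "apolar g x' y' z' t' = 0" using xy(3) zt(3) a apolar_swap by metis
    moreover have "Q = {x', y', z', t'}" using Q xy(1) zt(1) by auto
    ultimately show "Q \<in> (\<lambda>(x, y, z, t). {x, y, z, t}) ` ?S"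
      using xy(2) zt(2) Q(2) by (intro image_eqI[of _ _ "(x', y', z', t')"]) auto
  qed
  then show ?thesis by (rule surj_card_le[OF fS])
qed

text \<open>The constant comes before \<open>g\<close> because \<open>g\<close> will be chosen
  depending on the point set.\<close>

theorem apolar_quadruples_bound:
  "\<exists>C::real. \<forall>g A. hankel_regular g \<longrightarrow> finite A \<longrightarrow>
     real (card (apolar_quadruples g A)) \<le> C * real (card A) powr (8/3)"
proof -
  obtain T where T: "direction_net T" using direction_net_exists by blast
  define K where "K = real (card T)"
  \<comment> \<open>The 4 stands for degenerate tuples, \<open>8 * K\<^sup>2\<close> is
    \<open>2 * K\<^sup>2\<close> times the 4 from \<open>m \<le> 2 * s\<close>, and 176 is 44 +
    132.\<close>
  define C where "C = 4 + (K + 1) * (8 * K\<^sup>2 + 176)"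
  have K0: "K \<ge> 0" by (simp add: K_def)
  have "real (card (apolar_quadruples g A)) \<le> C * real (card A) powr (8/3)"
    if H: "hankel_regular g" and A: "finite A" for g A
  proof (cases "A = {}")
    case True
    then have "apolar_quadruples g A = {}" by (auto simp: apolar_quadruples_def)
    then show ?thesis using True by simp
  next
    case False
    define n where "n = card A"
    have n1: "n \<ge> 1" using False A by (simp add: n_def Suc_leI card_gt_0_iff)
    obtain f :: "complex \<Rightarrow> nat" where f: "inj_on f A"
      using finite_imp_inj_to_nat_seg[OF A] by blast
    define s where "s = real n powr (1/3)"
    have s1: "s \<ge> 1" unfolding s_def using n1 by (intro ge_one_powr_ge_zero) auto
    have s3: "s ^ 3 = n" unfolding s_def using n1 by (simp add: powr_power)
    have s8: "real n powr (8/3) = s ^ 8" unfolding s_def using n1 by (simp add: powr_power)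
    define m where "m = nat \<lceil>s\<rceil>"
    have ms: "s \<le> real m" "real m \<le> 2 * s" using s1 unfolding m_def by linarith+
    have m0: "real m > 0" using ms s1 by linarith
    define q where "q = card (apolar_quadruples g A)"
    have "m * q \<le> 4 * m * n\<^sup>2 + (card T + 1) * (m * (2 * (n * (card T * m))\<^sup>2) + n\<^sup>2 * (132 * n + 44 * m))"
      unfolding q_def n_def
      by (rule order_trans[OF mult_le_mono2[OF card_apolar_quadruples_le[OF A f]] apolar_tuples_count[OF T A H f]])
    then have "real (m * q) \<le> real (4 * m * n\<^sup>2 + (card T + 1) * (m * (2 * (n * (card T * m))\<^sup>2) + n\<^sup>2 * (132 * n + 44 * m)))"
      by (simp only: of_nat_le_iff)
    also have "\<dots> = m * (4 * s ^ 6 + (K + 1) * (2 * K\<^sup>2 * (s ^ 6 * (real m)\<^sup>2) + 44 * s ^ 6)) + (K + 1) * 132 * s ^ 9"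
      by (simp add: K_def s3[symmetric]) (simp add: algebra_simps power2_eq_square eval_nat_numeral)
    also have "\<dots> \<le> m * (4 * s ^ 8 + (K + 1) * (2 * K\<^sup>2 * (s ^ 6 * (2 * s)\<^sup>2) + 44 * s ^ 8)) + (K + 1) * 132 * (m * s ^ 8)"
    proof -
      have "s ^ 6 \<le> s ^ 8" using s1 by (intro power_increasing) auto
      moreover have "(real m)\<^sup>2 \<le> (2 * s)\<^sup>2" using ms m0 by (intro power_mono) auto
      moreover have "s ^ 9 \<le> m * s ^ 8"
        using ms(1) s1 mult_right_mono[of s "real m" "s ^ 8"] by (simp add: eval_nat_numeral)
      ultimately show ?thesis using K0 s1 m0
        by (intro add_mono mult_left_mono mult_mono) (auto intro!: mult_nonneg_nonneg add_nonneg_nonneg)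
    qed
    also have "\<dots> = m * (C * s ^ 8)"
      by (simp add: C_def algebra_simps power2_eq_square eval_nat_numeral)
    finally have "real q \<le> C * s ^ 8" using m0 by simp
    then show ?thesis using s8 by (simp add: q_def n_def)
  qed
  then show ?thesis by blast
qed


section \<open>Quartic parametrizations\<close>

lemma sum_atMost_4: "(\<Sum>k\<le>4. F k) = F 0 + F 1 + F 2 + F 3 + F (4::nat)"
  by (simp add: eval_nat_numeral)

lemma lin_add: "lin a (v + w) = lin a v + lin a w"
  by (simp add: lin_def distrib_left sum.distrib)

lemma lin_scale: "lin a (k *s v) = k * lin a v"
  by (simp add: lin_def sum_distrib_left mult.left_commute mult.assoc)

lemma lin_add_left: "lin (a + b) v = lin a v + lin b v"
  by (simp add: lin_def distrib_right sum.distrib)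

lemma lin_scale_left: "lin (k *s a) v = k * lin a v"
  by (simp add: lin_def sum_distrib_left mult.assoc)

lemma lin_zero [simp]: "lin a 0 = 0" "lin 0 v = 0"
  by (simp_all add: lin_def)

lemma bq_expand: "bq c s t = (t ^ 4) *s c 0 + (s * t ^ 3) *s c 1 + (s\<^sup>2 * t\<^sup>2) *s c 2 + (s ^ 3 * t) *s c 3 + (s ^ 4) *s c 4"
proof -
  have 1: "bq c s t = (s ^ 0 * t ^ (4 - 0)) *s c 0 + (s ^ 1 * t ^ (4 - 1)) *s c 1 + (s ^ 2 * t ^ (4 - 2)) *s c 2
    + (s ^ 3 * t ^ (4 - 3)) *s c 3 + (s ^ 4 * t ^ (4 - 4)) *s c 4"
    by (simp only: bq_def sum_atMost_4)
  have 2: "4 - 0 = (4::nat)" "4 - 1 = (3::nat)" "4 - 2 = (2::nat)" "4 - 3 = (1::nat)" "4 - 4 = (0::nat)" by auto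
  show ?thesis unfolding 1 2 by (simp only: power_0 power_one_right mult_1_left mult_1_right)
qed

lemma lin_bq: "lin a (bq c s t) = lin a (c 0) * t ^ 4 + lin a (c 1) * (s * t ^ 3) + lin a (c 2) * (s\<^sup>2 * t\<^sup>2)
    + lin a (c 3) * (s ^ 3 * t) + lin a (c 4) * s ^ 4"
  by (simp only: bq_expand lin_add lin_scale) (simp only: mult.commute)

lemma bq_homogeneous: "bq c (k * s) (k * t) = (k ^ 4) *s bq c s t"
  by (simp add: bq_expand vec_eq_iff algebra_simps power_mult_distrib eval_nat_numeral)

lemma pt_scale: assumes "k \<noteq> 0" shows "pt (k *s v) = pt v"
proof -
  have "c *s v \<in> range (\<lambda>c. c *s (k *s v))" for c
    using assms by (intro image_eqI[of _ _ "c / k"]) auto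
  moreover have "c *s (k *s v) \<in> range (\<lambda>c. c *s v)" for c
    by (intro image_eqI[of _ _ "c * k"]) auto
  ultimately show ?thesis unfolding pt_def by blast
qed

lemma pt_eqD: assumes "pt v = pt w" shows "\<exists>k. v = k *s w"
proof -
  have "v \<in> pt v" unfolding pt_def by (rule image_eqI[of _ _ 1]) simp_all
  then show ?thesis using assms by (auto simp: pt_def)
qed

section \<open>The linear relation and plane sections\<close>

definition parametrizes :: "(nat \<Rightarrow> cvec) \<Rightarrow> ppoint set \<Rightarrow> bool" where
  "parametrizes c \<delta> \<longleftrightarrow> (\<forall>s t. (s, t) \<noteq> (0, 0) \<longrightarrow> bq c s t \<noteq> 0)
        \<and> \<not> (\<exists>a. a \<noteq> 0 \<and> (\<forall>s t. lin a (bq c s t) = 0))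
        \<and> \<delta> = {pt (bq c s t) | s t. (s, t) \<noteq> (0, 0)}"

lemma parametrizes_nonplanar:
  assumes "parametrizes c \<delta>" "\<And>k. k \<le> 4 \<Longrightarrow> lin a (c k) = 0"
  shows "a = 0"
  using assms unfolding parametrizes_def lin_bq by force

lemma parametrizes_ends:
  assumes "parametrizes c \<delta>" shows "c 0 \<noteq> 0" "c 4 \<noteq> 0"
proof -
  have "bq c 0 1 = c 0" "bq c 1 0 = c 4" by (simp_all add: bq_expand)
  then show "c 0 \<noteq> 0" "c 4 \<noteq> 0" using assms unfolding parametrizes_def by (metis prod.inject zero_neq_one)+
qed

definition annihilates :: "(nat \<Rightarrow> complex) \<Rightarrow> (nat \<Rightarrow> cvec) \<Rightarrow> bool" where
  "annihilates g c \<longleftrightarrow> (\<exists>k\<le>4. g k \<noteq> 0) \<and> g 0 *s c 0 + g 1 *s c 1 + g 2 *s c 2 + g 3 *s c 3 + g 4 *s c 4 = 0"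

lemma annihilates_exists: "\<exists>g. annihilates g c"
\<comment> \<open>Linear independence is a property of sets, so a repeated coefficient vector needs
  its own relation.\<close>
proof (cases "inj_on c {..4}")
  case False
  then obtain i j where ij: "i \<le> 4" "j \<le> 4" "i \<noteq> j" "c i = c j" by (auto simp: inj_on_def)
  define g where "g k = (if k = i then 1 else if k = j then - 1 else 0 :: complex)" for k
  have "(\<Sum>k\<le>4. g k *s c k) = (\<Sum>k\<in>{i, j}. g k *s c k)"
    by (rule sum.mono_neutral_right) (use ij in \<open>auto simp: g_def\<close>)
  also have "\<dots> = 0" using ij by (simp add: g_def vec_eq_iff)
  finally have "(\<Sum>k\<le>4. g k *s c k) = 0" .
  then show ?thesis using ij unfolding annihilates_def sum_atMost_4
    by (intro exI[of _ g]) (auto simp: g_def intro!: exI[of _ i])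
next
  case True
  have "\<not> vec.independent (c ` {..4})"
  proof
    assume "vec.independent (c ` {..4})"
    then have "card (c ` {..4}) \<le> vec.dim (UNIV :: cvec set)"
      by (intro vec.independent_card_le_dim) auto
    then show False using card_image[OF True] by (simp add: card_cart_basis)
  qed
  then obtain u where u: "\<exists>v\<in>c ` {..4}. u v \<noteq> 0" "(\<Sum>v\<in>c ` {..4}. u v *s v) = 0"
    using vec.dependent_finite[of "c ` {..4}"] by auto
  have "(\<Sum>k\<le>4. u (c k) *s c k) = 0" using u(2) by (simp add: sum.reindex[OF True])
  then show ?thesis using u(1) unfolding annihilates_def sum_atMost_4
    by (intro exI[of _ "u \<circ> c"]) auto
qed

lemma annihilates_lin:
  assumes "annihilates g c"
  shows "g 0 * lin a (c 0) + g 1 * lin a (c 1) + g 2 * lin a (c 2) + g 3 * lin a (c 3) + g 4 * lin a (c 4) = 0"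
proof -
  have "lin a (g 0 *s c 0 + g 1 *s c 1 + g 2 *s c 2 + g 3 *s c 3 + g 4 *s c 4) = 0"
    using assms by (simp add: annihilates_def)
  then show ?thesis by (simp add: lin_add lin_scale)
qed

text \<open>The linear forms on space restrict to the curve as exactly the binary quartics apolar to \<open>g\<close>.\<close>

lemma section_exists:
  assumes c: "parametrizes c \<delta>" and g: "annihilates g c"
    and f: "g 0 * f0 + g 1 * f1 + g 2 * f2 + g 3 * f3 + g 4 * f4 = 0"
  shows "\<exists>a. lin a (c 0) = f0 \<and> lin a (c 1) = f1 \<and> lin a (c 2) = f2 \<and> lin a (c 3) = f3 \<and> lin a (c 4) = f4"
proof -
  define F where "F k = (if k = 0 then f0 else if k = 1 then f1 else if k = 2 then f2 else if k = 3 then f3 else f4)" for k :: nat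
  obtain p where p: "p \<le> 4" "g p \<noteq> 0" using g by (auto simp: annihilates_def)
  have sumc: "(\<Sum>k\<le>4. g k * lin a (c k)) = 0" for a using annihilates_lin[OF g] unfolding sum_atMost_4 .
  have sumF: "(\<Sum>k\<le>4. g k * F k) = 0" using f unfolding sum_atMost_4 by (simp add: F_def)
  have rest: "lin a (c p) = F p" if sF: "(\<Sum>k\<le>4. g k * F k) = 0"
    and "\<And>k. k \<in> {..4} - {p} \<Longrightarrow> lin a (c k) = F k" for a F
  proof -
    have "(\<Sum>k\<le>4. g k * (lin a (c k) - F k)) = 0"
      using sumc[of a] sF by (simp add: right_diff_distrib sum_subtractf)
    moreover have "(\<Sum>k\<le>4. g k * (lin a (c k) - F k)) = (\<Sum>k\<in>{p}. g k * (lin a (c k) - F k))"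
      by (rule sum.mono_neutral_right) (use p that in auto)
    ultimately show ?thesis using p by simp
  qed
  have "card (UNIV :: 4 set) = card ({..4} - {p})" using p by simp
  then obtain \<sigma> :: "4 \<Rightarrow> nat" where \<sigma>: "bij_betw \<sigma> UNIV ({..4} - {p})"
    using finite_same_card_bij[of "UNIV :: 4 set" "{..4} - {p}"] by auto
  \<comment> \<open>The four vectors other than \<open>c p\<close> separate linear forms, so their
    values can be prescribed at will; the value at \<open>c p\<close> then follows from the
    relation, as \<open>g p \<noteq> 0\<close>.\<close>
  define L where "L a = (\<chi> i. lin a (c (\<sigma> i)))" for a
  have lL: "Vector_Spaces.linear (*s) (*s) L"
    by unfold_locales (simp_all add: L_def vec_eq_iff lin_add_left lin_scale_left)
  have "inj L"
  proof (subst vec.linear_inj_iff_eq_0[OF lL], intro allI impI)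
    fix a assume "L a = 0"
    then have z: "lin a (c (\<sigma> i)) = 0" for i by (simp add: L_def vec_eq_iff)
    have 0: "lin a (c k) = 0" if "k \<in> {..4} - {p}" for k
      using z that \<sigma> unfolding bij_betw_def by (metis imageE)
    moreover have "lin a (c p) = 0" using rest[of "\<lambda>_. 0" a] 0 by simp
    ultimately show "a = 0" using parametrizes_nonplanar[OF c] by (metis Diff_iff atMost_iff singletonD)
  qed
  then have "surj L" by (rule vec.linear_injective_imp_surjective[OF lL _ refl])
  then obtain a where "L a = (\<chi> i. F (\<sigma> i))" by (metis surjD)
  then have "lin a (c (\<sigma> i)) = F (\<sigma> i)" for i by (simp add: L_def vec_eq_iff)
  then have 1: "lin a (c k) = F k" if "k \<in> {..4} - {p}" for k
    using that \<sigma> unfolding bij_betw_def by (metis imageE)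
  then have "lin a (c k) = F k" if "k \<le> 4" for k using rest[OF sumF 1] that by (cases "k = p") auto
  then have "lin a (c 0) = F 0" "lin a (c 1) = F 1" "lin a (c 2) = F 2" "lin a (c 3) = F 3" "lin a (c 4) = F 4"
    by auto
  then show ?thesis by (intro exI[of _ a]) (simp add: F_def)
qed

lemma cubic_zero:
  fixes a b c d :: complex
  assumes "distinct [x, y, z, t]" "\<And>w. w \<in> {x, y, z, t} \<Longrightarrow> a + b * w + c * w\<^sup>2 + d * w ^ 3 = 0"
  shows "a = 0" "b = 0" "c = 0" "d = 0"
proof -
  have q: "d = 0" using assms
  proof -
    have e: "b + c * (u + v) + d * (u\<^sup>2 + u * v + v\<^sup>2) = 0" if "u \<in> {x, y, z, t}" "v \<in> {x, y, z, t}" "u \<noteq> v" for u v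
    proof -
      have "(u - v) * (b + c * (u + v) + d * (u\<^sup>2 + u * v + v\<^sup>2)) = 0"
        using assms(2)[OF that(1)] assms(2)[OF that(2)] by algebra
      then show ?thesis using that(3) by simp
    qed
    have e2: "c + d * (u + v + w) = 0"
      if "u \<in> {x, y, z, t}" "v \<in> {x, y, z, t}" "w \<in> {x, y, z, t}" "u \<noteq> v" "u \<noteq> w" "v \<noteq> w" for u v w
    proof -
      have "(v - w) * (c + d * (u + v + w)) = 0"
        using e[OF that(1,2,4)] e[OF that(1,3,5)] by algebra
      then show ?thesis using that(6) by simp
    qed
    have "c + d * (x + y + z) = 0" "c + d * (x + y + t) = 0" using e2 assms(1) by auto
    then have "(z - t) * d = 0" by algebra
    then show ?thesis using assms(1) by simp
  qed
  have l: "b + c * (u + v) = 0" if "u \<in> {x, y, z}" "v \<in> {x, y, z}" "u \<noteq> v" for u v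
  proof -
    have "(u - v) * (b + c * (u + v)) = 0"
    proof -
      have "a + b * u + c * u\<^sup>2 + d * u ^ 3 = 0" "a + b * v + c * v\<^sup>2 + d * v ^ 3 = 0"
        using assms(2) that by auto
      then show ?thesis using q by algebra
    qed
    then show ?thesis using that(3) by simp
  qed
  have "b + c * (x + y) = 0" "b + c * (x + z) = 0" using l assms(1) by auto
  then have "(y - z) * c = 0" by algebra
  then show c0: "c = 0" using assms(1) by simp
  then show b0: "b = 0" using l[of x y] assms(1) by simp
  show "a = 0" using assms(2)[of x] q c0 b0 by simp
  show "d = 0" by fact
qed

text \<open>Subtracting \<open>f4\<close> times the product of the four linear factors leaves a
  cubic with four zeros. Stated with \<open>f4\<close> as a factor, Vieta's formulas include the
  case \<open>f4 = 0\<close>.\<close>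

lemma quartic_coefficients:
  fixes f0 :: complex
  assumes "distinct [x, y, z, t]" "\<And>w. w \<in> {x, y, z, t} \<Longrightarrow> f0 + f1 * w + f2 * w\<^sup>2 + f3 * w ^ 3 + f4 * w ^ 4 = 0"
  shows "f0 = f4 * (x*y*z*t)" "f1 = - f4 * (x*y*z + x*y*t + x*z*t + y*z*t)"
    "f2 = f4 * (x*y + x*z + x*t + y*z + y*t + z*t)" "f3 = - f4 * (x + y + z + t)"
proof -
  have v: "(f0 - f4 * (x*y*z*t)) + (f1 + f4 * (x*y*z + x*y*t + x*z*t + y*z*t)) * w
    + (f2 - f4 * (x*y + x*z + x*t + y*z + y*t + z*t)) * w\<^sup>2 + (f3 + f4 * (x + y + z + t)) * w ^ 3 = 0"
    if "w \<in> {x, y, z, t}" for w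
  proof -
    have 0: "(w - x) * (w - y) * (w - z) * (w - t) = 0" using that by auto
    have "(f0 - f4 * (x*y*z*t)) + (f1 + f4 * (x*y*z + x*y*t + x*z*t + y*z*t)) * w
      + (f2 - f4 * (x*y + x*z + x*t + y*z + y*t + z*t)) * w\<^sup>2 + (f3 + f4 * (x + y + z + t)) * w ^ 3
      = (f0 + f1 * w + f2 * w\<^sup>2 + f3 * w ^ 3 + f4 * w ^ 4) - f4 * ((w - x) * (w - y) * (w - z) * (w - t))"
      by (simp add: algebra_simps eval_nat_numeral)
    then show ?thesis using assms(2)[OF that] 0 by (simp only:) simp
  qed
  from cubic_zero[OF assms(1) v]
  show "f0 = f4 * (x*y*z*t)" "f1 = - f4 * (x*y*z + x*y*t + x*z*t + y*z*t)"
    "f2 = f4 * (x*y + x*z + x*t + y*z + y*t + z*t)" "f3 = - f4 * (x + y + z + t)"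
    by (simp_all add: eq_neg_iff_add_eq_0)
qed

lemma plane_contains_iff:
  assumes "\<And>w. w \<in> W \<Longrightarrow> v w \<noteq> 0"
  shows "(\<exists>H. plane H \<and> (\<lambda>w. pt (v w)) ` W \<subseteq> H) \<longleftrightarrow> (\<exists>a. a \<noteq> 0 \<and> (\<forall>w\<in>W. lin a (v w) = 0))"
proof
  assume "\<exists>H. plane H \<and> (\<lambda>w. pt (v w)) ` W \<subseteq> H"
  then obtain a where a: "a \<noteq> 0" "(\<lambda>w. pt (v w)) ` W \<subseteq> {pt u | u. u \<noteq> 0 \<and> lin a u = 0}"
    unfolding plane_def by blast
  have "lin a (v w) = 0" if "w \<in> W" for w
  proof -
    have "pt (v w) \<in> {pt u | u. u \<noteq> 0 \<and> lin a u = 0}" by (rule subsetD[OF a(2) imageI[OF that]])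
    then obtain u where u: "pt (v w) = pt u" "lin a u = 0" by auto
    then show ?thesis using pt_eqD[OF u(1)] by (auto simp: lin_scale)
  qed
  then show "\<exists>a. a \<noteq> 0 \<and> (\<forall>w\<in>W. lin a (v w) = 0)" using a(1) by blast
next
  assume "\<exists>a. a \<noteq> 0 \<and> (\<forall>w\<in>W. lin a (v w) = 0)"
  then obtain a where "a \<noteq> 0" "\<forall>w\<in>W. lin a (v w) = 0" by blast
  then show "\<exists>H. plane H \<and> (\<lambda>w. pt (v w)) ` W \<subseteq> H"
    unfolding plane_def using assms by (intro exI[of _ "{pt u | u. u \<noteq> 0 \<and> lin a u = 0}"]) blast
qed

text \<open>A plane through the four points restricts to a multiple of the quartic with these
  parameters as roots. That quartic is a plane section exactly if \<open>g\<close> annihilates its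
  coefficients, which are the signed elementary symmetric functions.\<close>

lemma coplanar_iff_apolar:
  assumes c: "parametrizes c \<delta>" and g: "annihilates g c" and d: "distinct [x, y, z, t]"
  shows "(\<exists>H. plane H \<and> (\<lambda>w. pt (bq c w 1)) ` {x, y, z, t} \<subseteq> H) \<longleftrightarrow> apolar g x y z t = 0"
proof -
  have "bq c w 1 \<noteq> 0" for w using c by (simp add: parametrizes_def)
  then have "(\<exists>H. plane H \<and> (\<lambda>w. pt (bq c w 1)) ` {x, y, z, t} \<subseteq> H)
      \<longleftrightarrow> (\<exists>a. a \<noteq> 0 \<and> (\<forall>w\<in>{x, y, z, t}. lin a (bq c w 1) = 0))" by (rule plane_contains_iff)
  also have "\<dots> \<longleftrightarrow> apolar g x y z t = 0"
  proof
    assume "\<exists>a. a \<noteq> 0 \<and> (\<forall>w\<in>{x, y, z, t}. lin a (bq c w 1) = 0)"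
    then obtain a where a: "a \<noteq> 0" "\<And>w. w \<in> {x, y, z, t} \<Longrightarrow> lin a (bq c w 1) = 0" by blast
    have "lin a (c 0) + lin a (c 1) * w + lin a (c 2) * w\<^sup>2 + lin a (c 3) * w ^ 3 + lin a (c 4) * w ^ 4 = 0"
      if "w \<in> {x, y, z, t}" for w
      using a(2)[OF that] by (simp add: lin_bq)
    note q = quartic_coefficients[OF d this]
    \<comment> \<open>Otherwise the whole section vanishes and the curve lies in the plane.\<close>
    have "lin a (c 4) \<noteq> 0"
    proof
      assume z: "lin a (c 4) = 0"
      have "lin a (c k) = 0" if "k \<le> 4" for k
      proof -
        have "k = 0 \<or> k = 1 \<or> k = 2 \<or> k = 3 \<or> k = 4" using that by auto
        then show ?thesis using q z by auto
      qed
      then show False using parametrizes_nonplanar[OF c] a(1) by blast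
    qed
    moreover have "lin a (c 4) * apolar g x y z t = 0"
      using annihilates_lin[OF g, of a] q unfolding apolar_def by algebra
    ultimately show "apolar g x y z t = 0" by simp
  next
    assume ap: "apolar g x y z t = 0"
    have "\<exists>a. lin a (c 0) = x*y*z*t \<and> lin a (c 1) = - (x*y*z + x*y*t + x*z*t + y*z*t) \<and>
      lin a (c 2) = x*y + x*z + x*t + y*z + y*t + z*t \<and> lin a (c 3) = - (x + y + z + t) \<and> lin a (c 4) = 1"
      by (rule section_exists[OF c g]) (use ap in \<open>simp add: apolar_def algebra_simps\<close>)
    then obtain a where a: "lin a (c 0) = x*y*z*t" "lin a (c 1) = - (x*y*z + x*y*t + x*z*t + y*z*t)"
      "lin a (c 2) = x*y + x*z + x*t + y*z + y*t + z*t" "lin a (c 3) = - (x + y + z + t)" "lin a (c 4) = 1" by blast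
    have "lin a (bq c w 1) = (w - x) * (w - y) * (w - z) * (w - t)" for w
      unfolding lin_bq a by (simp add: algebra_simps eval_nat_numeral)
    moreover have "a \<noteq> 0" using a(5) by auto
    ultimately show "\<exists>a. a \<noteq> 0 \<and> (\<forall>w\<in>{x, y, z, t}. lin a (bq c w 1) = 0)" by (intro exI[of _ a]) auto
  qed
  finally show ?thesis .
qed


section \<open>Change of parameter on the projective line\<close>

definition binary_form :: "nat \<Rightarrow> (complex \<Rightarrow> complex \<Rightarrow> complex) \<Rightarrow> bool" where
  "binary_form n f \<longleftrightarrow> (\<exists>m. \<forall>s t. f s t = (\<Sum>j\<le>n. m j * (s ^ j * t ^ (n - j))))"

lemma binary_form_mult_linear:
  assumes "binary_form n f"
  shows "binary_form (Suc n) (\<lambda>s t. (p * s + q * t) * f s t)"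
proof -
  obtain m where m: "\<And>s t. f s t = (\<Sum>j\<le>n. m j * (s ^ j * t ^ (n - j)))"
    using assms by (auto simp: binary_form_def)
  define m1 where "m1 j = (if j = 0 then 0 else p * m (j - 1))" for j
  define m2 where "m2 j = (if j = Suc n then 0 else q * m j)" for j
  have "(p * s + q * t) * f s t = (\<Sum>j\<le>Suc n. (m1 j + m2 j) * (s ^ j * t ^ (Suc n - j)))" for s t
  proof -
    have 1: "(\<Sum>j\<le>Suc n. m1 j * (s ^ j * t ^ (Suc n - j))) = p * s * f s t"
      unfolding sum.atMost_Suc_shift m by (simp add: m1_def sum_distrib_left mult_ac)
    have "(\<Sum>j\<le>Suc n. m2 j * (s ^ j * t ^ (Suc n - j))) = (\<Sum>j\<le>n. m2 j * (s ^ j * t ^ (Suc n - j)))"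
      by (simp add: m2_def)
    also have "\<dots> = (\<Sum>j\<le>n. q * t * (m j * (s ^ j * t ^ (n - j))))"
      by (rule sum.cong) (auto simp: m2_def Suc_diff_le)
    also have "\<dots> = q * t * f s t" unfolding m by (simp only: sum_distrib_left)
    finally show ?thesis using 1 by (simp only: distrib_right sum.distrib)
  qed
  then show ?thesis unfolding binary_form_def by (intro exI[of _ "\<lambda>j. m1 j + m2 j"]) simp
qed

lemma binary_form_linear_powers:
  "binary_form (i + j) (\<lambda>s t. (p * s + q * t) ^ i * (r * s + u * t) ^ j)"
proof (induction i)
  case 0
  show ?case
  proof (induction j)
    case 0
    show ?case unfolding binary_form_def by (intro exI[of _ "\<lambda>_. 1"]) simp
  next
    case (Suc j)
    from binary_form_mult_linear[OF Suc, of r u] show ?case by simp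
  qed
next
  case (Suc i)
  from binary_form_mult_linear[OF Suc, of p q] show ?case by (simp add: mult.assoc)
qed

lemma bq_substitute:
  "\<exists>c'. \<forall>s t. bq c' s t = bq c (p * s + q * t) (r * s + u * t)"
proof -
  have "\<forall>k. \<exists>m. k \<le> 4 \<longrightarrow> (\<forall>s t. (p * s + q * t) ^ k * (r * s + u * t) ^ (4 - k) = (\<Sum>j\<le>4. m j * (s ^ j * t ^ (4 - j))))"
  proof
    fix k
    show "\<exists>m. k \<le> 4 \<longrightarrow> (\<forall>s t. (p * s + q * t) ^ k * (r * s + u * t) ^ (4 - k) = (\<Sum>j\<le>4. m j * (s ^ j * t ^ (4 - j))))"
      using binary_form_linear_powers[of k "4 - k" p q r u] by (cases "k \<le> 4") (simp_all add: binary_form_def)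
  qed
  from choice[OF this] obtain m where m: "\<And>k s t. k \<le> 4 \<Longrightarrow>
      (p * s + q * t) ^ k * (r * s + u * t) ^ (4 - k) = (\<Sum>j\<le>4. m k j * (s ^ j * t ^ (4 - j)))"
    by blast
  define c' where "c' j = (\<Sum>k\<le>4. m k j *s c k)" for j
  have "bq c' s t = bq c (p * s + q * t) (r * s + u * t)" for s t
  proof -
    have "bq c (p * s + q * t) (r * s + u * t) = (\<Sum>k\<le>4. (\<Sum>j\<le>4. m k j * (s ^ j * t ^ (4 - j))) *s c k)"
      unfolding bq_def by (intro sum.cong refl) (simp only: m atMost_iff)
    also have "\<dots> = (\<Sum>k\<le>4. \<Sum>j\<le>4. (m k j * (s ^ j * t ^ (4 - j))) *s c k)"
      by (simp only: vec.scale_sum_left)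
    also have "\<dots> = (\<Sum>j\<le>4. \<Sum>k\<le>4. (m k j * (s ^ j * t ^ (4 - j))) *s c k)" by (rule sum.swap)
    also have "\<dots> = bq c' s t"
      unfolding bq_def c'_def vec.scale_sum_right by (intro sum.cong refl) (simp add: mult_ac)
    finally show ?thesis by simp
  qed
  then show ?thesis by blast
qed

lemma linear_inverse:
  fixes p q r u :: complex
  assumes D: "p * u - q * r \<noteq> 0" "D = p * u - q * r"
  shows "p * ((u / D) * s + (- q / D) * t) + q * ((- r / D) * s + (p / D) * t) = s"
    and "r * ((u / D) * s + (- q / D) * t) + u * ((- r / D) * s + (p / D) * t) = t"
    and "(u / D) * (p * s + q * t) + (- q / D) * (r * s + u * t) = s"
    and "(- r / D) * (p * s + q * t) + (p / D) * (r * s + u * t) = t"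
    and "(u / D) * (p / D) - (- q / D) * (- r / D) \<noteq> 0"
proof -
  define e where "e = 1 / D"
  have e: "e * (p * u - q * r) = 1" using D by (simp add: e_def)
  have d: "x / D = x * e" for x by (simp add: e_def)
  show "p * ((u / D) * s + (- q / D) * t) + q * ((- r / D) * s + (p / D) * t) = s"
    "r * ((u / D) * s + (- q / D) * t) + u * ((- r / D) * s + (p / D) * t) = t"
    "(u / D) * (p * s + q * t) + (- q / D) * (r * s + u * t) = s"
    "(- r / D) * (p * s + q * t) + (p / D) * (r * s + u * t) = t"
    unfolding d using e by algebra+
  have "(u / D) * (p / D) - (- q / D) * (- r / D) = e"
    unfolding d using e by algebra
  then show "(u / D) * (p / D) - (- q / D) * (- r / D) \<noteq> 0" using D by (simp add: e_def)
qed

lemma parametrizes_substitute: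
  assumes c: "parametrizes c \<delta>" and det: "p * u - q * r \<noteq> 0"
    and c': "\<And>s t. bq c' s t = bq c (p * s + q * t) (r * s + u * t)"
  shows "parametrizes c' \<delta>"
proof -
  define D where "D = p * u - q * r"
  note inv = linear_inverse(1,2)[OF det D_def]
  have surj: "\<exists>s' t'. bq c s t = bq c' s' t' \<and> ((s, t) \<noteq> (0, 0) \<longrightarrow> (s', t') \<noteq> (0, 0))" for s t
  proof (intro exI conjI impI)
    show "bq c s t = bq c' ((u / D) * s + (- q / D) * t) ((- r / D) * s + (p / D) * t)"
      unfolding c' inv ..
    assume "(s, t) \<noteq> (0, 0)"
    then show "((u / D) * s + (- q / D) * t, (- r / D) * s + (p / D) * t) \<noteq> (0, 0)"
      using inv[of s t] by (metis add.right_neutral mult_zero_right prod.inject)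
  qed
  have nz: "(p * s + q * t, r * s + u * t) \<noteq> (0, 0)" if "(s, t) \<noteq> (0, 0)" for s t
  proof
    assume "(p * s + q * t, r * s + u * t) = (0, 0)"
    then have e: "p * s + q * t = 0" "r * s + u * t = 0" by auto
    have "(p * u - q * r) * s = 0" "(p * u - q * r) * t = 0" using e by algebra+
    then show False using det that by simp
  qed
  have 1: "{pt (bq c' s t) | s t. (s, t) \<noteq> (0, 0)} = {pt (bq c s t) | s t. (s, t) \<noteq> (0, 0)}"
  proof (intro equalityI subsetI)
    fix x assume "x \<in> {pt (bq c' s t) | s t. (s, t) \<noteq> (0, 0)}"
    then obtain s t where x: "x = pt (bq c' s t)" "(s, t) \<noteq> (0, 0)" by blast
    show "x \<in> {pt (bq c s t) | s t. (s, t) \<noteq> (0, 0)}" unfolding mem_Collect_eq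
      by (rule exI[of _ "p * s + q * t"], rule exI[of _ "r * s + u * t"]) (intro conjI nz x(2), simp only: x(1) c')
  next
    fix x assume "x \<in> {pt (bq c s t) | s t. (s, t) \<noteq> (0, 0)}"
    then obtain s t where x: "x = pt (bq c s t)" "(s, t) \<noteq> (0, 0)" by blast
    obtain s' t' where s': "bq c s t = bq c' s' t'" "(s', t') \<noteq> (0, 0)" using surj[of s t] x(2) by blast
    show "x \<in> {pt (bq c' s t) | s t. (s, t) \<noteq> (0, 0)}" unfolding mem_Collect_eq
      by (rule exI[of _ s'], rule exI[of _ t']) (intro conjI s'(2), simp only: x(1) s'(1))
  qed
  have 2: "bq c' s t \<noteq> 0" if "(s, t) \<noteq> (0, 0)" for s t
    using nz[OF that] c unfolding c' parametrizes_def by blast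
  have 3: "a = 0" if "\<forall>s t. lin a (bq c' s t) = 0" for a
  proof -
    have "lin a (bq c s t) = 0" for s t using that surj[of s t] by metis
    then show ?thesis using c unfolding parametrizes_def by blast
  qed
  have 4: "\<delta> = {pt (bq c s t) | s t. (s, t) \<noteq> (0, 0)}" using c by (simp only: parametrizes_def)
  show ?thesis unfolding parametrizes_def using 2 3 by (intro conjI) (auto simp only: 1 4)
qed

section \<open>Quadratic forms dividing plane sections\<close>

definition quad_form :: "(complex \<Rightarrow> complex \<Rightarrow> complex) \<Rightarrow> bool" where
  "quad_form h \<longleftrightarrow> (\<exists>h0 h1 h2. \<forall>s t. h s t = h0 * s\<^sup>2 + h1 * (s * t) + h2 * t\<^sup>2)"

lemma quad_form_substitute:
  assumes "quad_form h" shows "quad_form (\<lambda>s t. h (p * s + q * t) (r * s + u * t))"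
proof -
  obtain h0 h1 h2 where h: "\<And>s t. h s t = h0 * s\<^sup>2 + h1 * (s * t) + h2 * t\<^sup>2" using assms by (auto simp: quad_form_def)
  show ?thesis unfolding quad_form_def h
    by (intro exI[of _ "h0 * p\<^sup>2 + h1 * (p * r) + h2 * r\<^sup>2"] exI[of _ "2 * h0 * p * q + h1 * (p * u + q * r) + 2 * h2 * r * u"]
        exI[of _ "h0 * q\<^sup>2 + h1 * (q * u) + h2 * u\<^sup>2"]) (simp add: algebra_simps power2_eq_square)
qed

text \<open>For a parametrized curve this says that the coefficients of \<open>h\<close> lie in the
  kernel of the Hankel matrix, but without mention of the relation, so that it transforms by
  substitution.\<close>

definition divides_sections :: "(complex \<Rightarrow> complex \<Rightarrow> complex) \<Rightarrow> (nat \<Rightarrow> cvec) \<Rightarrow> bool" where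
  "divides_sections h c \<longleftrightarrow> (\<forall>q. quad_form q \<longrightarrow> (\<exists>a. \<forall>s t. lin a (bq c s t) = h s t * q s t))"

lemma divides_sections_substitute:
  assumes h: "divides_sections h c" and det: "p * u - q * r \<noteq> 0"
    and c': "\<And>s t. bq c' s t = bq c (p * s + q * t) (r * s + u * t)"
  shows "divides_sections (\<lambda>s t. h (p * s + q * t) (r * s + u * t)) c'"
  unfolding divides_sections_def
proof (intro allI impI)
  fix k assume k: "quad_form k"
  define D where "D = p * u - q * r"
  have "quad_form (\<lambda>s t. k ((u / D) * s + (- q / D) * t) ((- r / D) * s + (p / D) * t))"
    by (rule quad_form_substitute[OF k])
  then obtain a where a: "\<And>s t. lin a (bq c s t) = h s t * k ((u / D) * s + (- q / D) * t) ((- r / D) * s + (p / D) * t)"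
    using h unfolding divides_sections_def by blast
  note 1 = linear_inverse(3,4)[OF det D_def]
  have "lin a (bq c' s t) = h (p * s + q * t) (r * s + u * t) * k s t" for s t
    unfolding c' a 1 ..
  then show "\<exists>a. \<forall>s t. lin a (bq c' s t) = h (p * s + q * t) (r * s + u * t) * k s t" by blast
qed

definition special :: "(nat \<Rightarrow> cvec) \<Rightarrow> bool" where
  "special c \<longleftrightarrow> (\<exists>h. quad_form h \<and> (\<exists>s t. h s t \<noteq> 0) \<and> divides_sections h c)"

lemma special_substitute:
  assumes sp: "special c'" and det: "p * u - q * r \<noteq> 0"
    and c': "\<And>s t. bq c' s t = bq c (p * s + q * t) (r * s + u * t)"
  shows "special c"
proof -
  obtain h s0 t0 where h: "quad_form h" "h s0 t0 \<noteq> 0" "divides_sections h c'" using sp by (auto simp: special_def)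
  define D where "D = p * u - q * r"
  note inv = linear_inverse[OF det D_def]
  have bq_c: "bq c s t = bq c' ((u / D) * s + (- q / D) * t) ((- r / D) * s + (p / D) * t)" for s t
    unfolding c' inv(1,2) ..
  let ?h = "\<lambda>s t. h ((u / D) * s + (- q / D) * t) ((- r / D) * s + (p / D) * t)"
  have "divides_sections ?h c" by (rule divides_sections_substitute[OF h(3) inv(5) bq_c])
  moreover have "quad_form ?h" by (rule quad_form_substitute[OF h(1)])
  moreover have "?h (p * s0 + q * t0) (r * s0 + u * t0) \<noteq> 0" unfolding inv(3,4) by (rule h(2))
  ultimately show ?thesis unfolding special_def by blast
qed

text \<open>A kernel vector \<open>(u, v, w)\<close> is read as a quadratic form \<open>h\<close>.
  The three kernel equations say that \<open>g\<close> annihilates \<open>h\<close> times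
  \<open>t\<^sup>2\<close>, \<open>s * t\<close> and \<open>s\<^sup>2\<close>, so all quadratic
  multiples of \<open>h\<close> are plane sections.\<close>

lemma hankel_regular_if_not_special:
  assumes c: "parametrizes c \<delta>" and g: "annihilates g c" and ns: "\<not> special c"
  shows "hankel_regular g"
  unfolding hankel_regular_def
proof (intro allI impI, rule ccontr)
  fix u v w assume e: "g 0 * u + g 1 * v + g 2 * w = 0" "g 1 * u + g 2 * v + g 3 * w = 0"
    "g 2 * u + g 3 * v + g 4 * w = 0" and nz: "\<not> (u = 0 \<and> v = 0 \<and> w = 0)"
  define h where "h s t = w * s\<^sup>2 + v * (s * t) + u * t\<^sup>2" for s t
  have "divides_sections h c" unfolding divides_sections_def
  proof (intro allI impI)
    fix q assume "quad_form q"
    then obtain q0 q1 q2 where q: "\<And>s t. q s t = q0 * s\<^sup>2 + q1 * (s * t) + q2 * t\<^sup>2" by (auto simp: quad_form_def)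
    have "g 0 * (u * q2) + g 1 * (u * q1 + v * q2) + g 2 * (u * q0 + v * q1 + w * q2)
      + g 3 * (v * q0 + w * q1) + g 4 * (w * q0) = 0" using e by algebra
    from section_exists[OF c g this] obtain a where a: "lin a (c 0) = u * q2" "lin a (c 1) = u * q1 + v * q2"
      "lin a (c 2) = u * q0 + v * q1 + w * q2" "lin a (c 3) = v * q0 + w * q1" "lin a (c 4) = w * q0" by blast
    have "lin a (bq c s t) = h s t * q s t" for s t
      unfolding lin_bq a h_def q by (simp add: algebra_simps eval_nat_numeral)
    then show "\<exists>a. \<forall>s t. lin a (bq c s t) = h s t * q s t" by blast
  qed
  moreover have "quad_form h" by (auto simp: quad_form_def h_def)
  moreover have "\<exists>s t. h s t \<noteq> 0"
  proof (rule ccontr)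
    assume "\<not> (\<exists>s t. h s t \<noteq> 0)"
    then have "h 1 0 = 0" "h 0 1 = 0" "h 1 1 = 0" by auto
    then show False using nz by (simp add: h_def)
  qed
  ultimately show False using ns unfolding special_def by blast
qed

lemma section_coefficients:
  assumes "\<And>s t. lin a (bq c s t) = f0 * t ^ 4 + f1 * (s * t ^ 3) + f2 * (s\<^sup>2 * t\<^sup>2) + f3 * (s ^ 3 * t) + f4 * s ^ 4"
  shows "lin a (c 0) = f0" "lin a (c 1) = f1" "lin a (c 2) = f2" "lin a (c 3) = f3" "lin a (c 4) = f4"
proof -
  have 4: "lin a (c 4) = f4" using assms[of 1 0] by (simp add: lin_bq)
  then show "lin a (c 4) = f4" .
  have 0: "(lin a (c 0) - f0) + (lin a (c 1) - f1) * w + (lin a (c 2) - f2) * w\<^sup>2 + (lin a (c 3) - f3) * w ^ 3 = 0" for w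
    using assms[of w 1] 4 by (simp add: lin_bq algebra_simps)
  have "distinct [0, 1, 2, 3 :: complex]" by simp
  from cubic_zero[OF this 0] have "lin a (c 0) - f0 = 0 \<and> lin a (c 1) - f1 = 0 \<and> lin a (c 2) - f2 = 0 \<and> lin a (c 3) - f3 = 0"
    by blast
  then show "lin a (c 0) = f0" "lin a (c 1) = f1" "lin a (c 2) = f2" "lin a (c 3) = f3" by auto
qed

lemma section_annihilated:
  assumes g: "annihilates g c"
    and "\<And>s t. lin a (bq c s t) = f0 * t ^ 4 + f1 * (s * t ^ 3) + f2 * (s\<^sup>2 * t\<^sup>2) + f3 * (s ^ 3 * t) + f4 * s ^ 4"
  shows "g 0 * f0 + g 1 * f1 + g 2 * f2 + g 3 * f3 + g 4 * f4 = 0"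
  using annihilates_lin[OF g, of a] section_coefficients[OF assms(2)] by simp

lemma quad_form_factors:
  assumes "quad_form h"
  shows "\<exists>p q r u. \<forall>s t. h s t = (p * s + q * t) * (r * s + u * t)"
proof -
  obtain h0 h1 h2 where h: "\<And>s t. h s t = h0 * s\<^sup>2 + h1 * (s * t) + h2 * t\<^sup>2" using assms by (auto simp: quad_form_def)
  show ?thesis
  proof (cases "h0 = 0")
    case True
    then show ?thesis unfolding h
      by (intro exI[of _ 0] exI[of _ 1] exI[of _ h1] exI[of _ h2]) (simp add: algebra_simps power2_eq_square)
  next
    case False
    define d where "d = csqrt (h1\<^sup>2 - 4 * h0 * h2)"
    have d: "d\<^sup>2 = h1\<^sup>2 - 4 * h0 * h2" by (simp add: d_def)
    have "h s t = (h0 * s + (h1 - d) / 2 * t) * (1 * s + (h1 + d) / (2 * h0) * t)" for s t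
    proof -
      have "(h0 * s + (h1 - d) / 2 * t) * (1 * s + (h1 + d) / (2 * h0) * t)
        = h0 * s\<^sup>2 + h1 * (s * t) + (h1\<^sup>2 - d\<^sup>2) / (4 * h0) * t\<^sup>2"
        using False by (simp add: field_simps power2_eq_square)
      also have "(h1\<^sup>2 - d\<^sup>2) / (4 * h0) = h2" using False by (simp add: d)
      finally show ?thesis by (simp add: h)
    qed
    then show ?thesis by blast
  qed
qed

text \<open>The form \<open>h\<close> is a product of two linear forms. Independent factors become
  the new coordinates; proportional factors make \<open>h\<close> a multiple of the square of one
  new coordinate.\<close>

lemma special_normal_form:
  assumes c: "parametrizes c \<delta>" and sp: "special c"
  shows "\<exists>c'. parametrizes c' \<delta> \<and>
    (divides_sections (\<lambda>s t. s * t) c' \<or> divides_sections (\<lambda>s t. t * t) c')"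
proof -
  obtain h s0 t0 where h: "quad_form h" "h s0 t0 \<noteq> 0" "divides_sections h c" using sp by (auto simp: special_def)
  obtain p q r u where f: "\<And>s t. h s t = (p * s + q * t) * (r * s + u * t)" using quad_form_factors[OF h(1)] by blast
  show ?thesis
  proof (cases "p * u - q * r = 0")
    case False
    define D where "D = p * u - q * r"
    note inv = linear_inverse[OF False D_def]
    obtain c' where c': "\<And>s t. bq c' s t = bq c ((u / D) * s + (- q / D) * t) ((- r / D) * s + (p / D) * t)"
      using bq_substitute by blast
    have "divides_sections (\<lambda>s t. s * t) c'"
      using divides_sections_substitute[OF h(3) inv(5) c'] unfolding f inv(1,2) .
    then show ?thesis using parametrizes_substitute[OF c inv(5) c'] by blast
  next
    case True
    have pq: "p \<noteq> 0 \<or> q \<noteq> 0" using h(2) unfolding f by auto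
    have "\<exists>k. r = k * p \<and> u = k * q"
    proof (cases "p = 0")
      case True
      then show ?thesis using pq \<open>p * u - q * r = 0\<close> by (intro exI[of _ "u / q"]) auto
    next
      case False
      then show ?thesis using \<open>p * u - q * r = 0\<close> by (intro exI[of _ "r / p"]) (auto simp: field_simps)
    qed
    then obtain k where k: "r = k * p" "u = k * q" by blast
    have k0: "k \<noteq> 0" using h(2) unfolding f k by auto
    have "\<exists>r' u'. r' * q - u' * p \<noteq> 0"
    proof (cases "p = 0")
      case True
      then show ?thesis using pq by (intro exI[of _ 1] exI[of _ 0]) auto
    next
      case False
      then show ?thesis by (intro exI[of _ 0] exI[of _ 1]) auto
    qed
    then obtain r' u' where d: "r' * q - u' * p \<noteq> 0" by blast
    define D where "D = r' * q - u' * p"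
    note inv = linear_inverse[OF d D_def]
    obtain c' where c': "\<And>s t. bq c' s t = bq c ((q / D) * s + (- u' / D) * t) ((- p / D) * s + (r' / D) * t)"
      using bq_substitute by blast
    have hk: "h s t = k * (p * s + q * t) * (p * s + q * t)" for s t unfolding f k by algebra
    have dv: "divides_sections (\<lambda>s t. k * t * t) c'"
      using divides_sections_substitute[OF h(3) inv(5) c'] unfolding hk inv(2) .
    have "divides_sections (\<lambda>s t. t * t) c'" unfolding divides_sections_def
    proof (intro allI impI)
      fix e assume "quad_form e"
      then obtain e0 e1 e2 where e: "\<And>s t. e s t = e0 * s\<^sup>2 + e1 * (s * t) + e2 * t\<^sup>2" by (auto simp: quad_form_def)
      have "quad_form (\<lambda>s t. e s t / k)" unfolding quad_form_def e
        by (intro exI[of _ "e0 / k"] exI[of _ "e1 / k"] exI[of _ "e2 / k"]) (simp add: add_divide_distrib)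
      then obtain a where "\<And>s t. lin a (bq c' s t) = k * t * t * (e s t / k)"
        using dv unfolding divides_sections_def by blast
      then have "lin a (bq c' s t) = t * t * e s t" for s t using k0 by simp
      then show "\<exists>a. \<forall>s t. lin a (bq c' s t) = t * t * e s t" by blast
    qed
    then show ?thesis using parametrizes_substitute[OF c inv(5) c'] by blast
  qed
qed

lemma quad_form_monomials: "quad_form (\<lambda>s t. s\<^sup>2)" "quad_form (\<lambda>s t. s * t)" "quad_form (\<lambda>s t. t\<^sup>2)"
proof -
  have q: "quad_form (\<lambda>s t. a * s\<^sup>2 + b * (s * t) + c * t\<^sup>2)" for a b c by (auto simp: quad_form_def)
  show "quad_form (\<lambda>s t. s\<^sup>2)" "quad_form (\<lambda>s t. s * t)" "quad_form (\<lambda>s t. t\<^sup>2)"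
    using q[of 1 0 0] q[of 0 1 0] q[of 0 0 1] by simp_all
qed

lemma divides_sections_monomials:
  assumes "divides_sections h c"
  obtains a1 a2 a3 where "\<And>s t. lin a1 (bq c s t) = h s t * s\<^sup>2" "\<And>s t. lin a2 (bq c s t) = h s t * (s * t)"
    "\<And>s t. lin a3 (bq c s t) = h s t * t\<^sup>2"
proof -
  have "\<exists>a. \<forall>s t. lin a (bq c s t) = h s t * s\<^sup>2" "\<exists>a. \<forall>s t. lin a (bq c s t) = h s t * (s * t)"
    "\<exists>a. \<forall>s t. lin a (bq c s t) = h s t * t\<^sup>2"
    by (rule assms[unfolded divides_sections_def, rule_format, OF quad_form_monomials(1)]
        assms[unfolded divides_sections_def, rule_format, OF quad_form_monomials(2)]
        assms[unfolded divides_sections_def, rule_format, OF quad_form_monomials(3)])+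
  then show ?thesis using that by blast
qed

text \<open>The three inner monomials of degree four are plane sections. The relation is left with
  \<open>c 0\<close> and \<open>c 4\<close> only: on a parametrized curve the parameters 0 and
  infinity give the same point.\<close>

lemma annihilator_multiplicative:
  assumes "divides_sections (\<lambda>s t. s * t) c" "annihilates g c"
  shows "g 1 = 0" "g 2 = 0" "g 3 = 0"
proof -
  obtain a1 a2 a3 where a: "\<And>s t. lin a1 (bq c s t) = s * t * s\<^sup>2" "\<And>s t. lin a2 (bq c s t) = s * t * (s * t)"
    "\<And>s t. lin a3 (bq c s t) = s * t * t\<^sup>2"
    using divides_sections_monomials[OF assms(1)] by blast
  show "g 3 = 0" using section_annihilated[OF assms(2), of a1 0 0 0 1 0] a(1) by (simp add: eval_nat_numeral)
  show "g 2 = 0" using section_annihilated[OF assms(2), of a2 0 0 1 0 0] a(2) by (simp add: power2_eq_square)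
  show "g 1 = 0" using section_annihilated[OF assms(2), of a3 0 1 0 0 0] a(3) by (simp add: eval_nat_numeral)
qed

text \<open>Here the relation is left with \<open>c 3\<close> and \<open>c 4\<close> only: on a
  parametrized curve \<open>c 3\<close> is a multiple of \<open>c 4\<close>, so there is a cusp at
  the infinite parameter.\<close>

lemma annihilator_additive:
  assumes "divides_sections (\<lambda>s t. t * t) c" "annihilates g c"
  shows "g 0 = 0" "g 1 = 0" "g 2 = 0"
proof -
  obtain a1 a2 a3 where a: "\<And>s t. lin a1 (bq c s t) = t * t * s\<^sup>2" "\<And>s t. lin a2 (bq c s t) = t * t * (s * t)"
    "\<And>s t. lin a3 (bq c s t) = t * t * t\<^sup>2"
    using divides_sections_monomials[OF assms(1)] by blast
  show "g 2 = 0" using section_annihilated[OF assms(2), of a1 0 0 1 0 0] a(1) by (simp add: power2_eq_square)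
  show "g 1 = 0" using section_annihilated[OF assms(2), of a2 0 1 0 0 0] a(2) by (simp add: eval_nat_numeral)
  show "g 0 = 0" using section_annihilated[OF assms(2), of a3 1 0 0 0 0] a(3) by (simp add: eval_nat_numeral)
qed

section \<open>Planes meeting the curve in a fourth power\<close>

lemma quartic_root:
  fixes a0 :: complex
  assumes "\<not> (a1 = 0 \<and> a2 = 0 \<and> a3 = 0 \<and> a4 = 0)"
  shows "\<exists>x. a0 + a1 * x + a2 * x\<^sup>2 + a3 * x ^ 3 + a4 * x ^ 4 = 0"
proof -
  have "\<exists>z. poly [:a0, a1, a2, a3, a4:] z = 0"
    using assms by (intro fundamental_theorem_of_algebra_alt) (auto simp: pCons_eq_0_iff)
  then show ?thesis by (auto simp: algebra_simps eval_nat_numeral)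
qed

text \<open>The form \<open>(s - x * t) ^ 4\<close> is a plane section if \<open>x\<close> solves
  the quartic equation \<open>apolar g x x x x = 0\<close>. Two such parameters are moved to 0 and
  infinity; then \<open>s ^ 4\<close> and \<open>t ^ 4\<close> are plane sections, which forces
  \<open>g 4\<close> and \<open>g 0\<close> to vanish.\<close>

lemma fourth_powers_normal_form:
  assumes c: "parametrizes c \<delta>" and ns: "\<not> special c"
  shows "\<exists>c'. parametrizes c' \<delta> \<and> \<not> special c' \<and> (\<forall>g. annihilates g c' \<longrightarrow> g 0 = 0 \<and> g 4 = 0)"
proof -
  obtain g where g: "annihilates g c" using annihilates_exists by blast
  have "\<not> (- 4 * g 3 = 0 \<and> 6 * g 2 = 0 \<and> - 4 * g 1 = 0 \<and> g 0 = 0)"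
  proof
    assume "- 4 * g 3 = 0 \<and> 6 * g 2 = 0 \<and> - 4 * g 1 = 0 \<and> g 0 = 0"
    then have z: "g 0 = 0" "g 1 = 0" "g 2 = 0" "g 3 = 0" by auto
    then have "g 4 *s c 4 = 0" using g by (simp add: annihilates_def)
    then have "g 4 = 0" using parametrizes_ends[OF c] by (simp add: vector_mul_eq_0)
    then have "g k = 0" if "k \<le> 4" for k using z that by (auto simp: le_Suc_eq eval_nat_numeral)
    then show False using g by (auto simp: annihilates_def)
  qed
  from quartic_root[OF this] obtain x where
    x: "g 4 + - 4 * g 3 * x + 6 * g 2 * x\<^sup>2 + - 4 * g 1 * x ^ 3 + g 0 * x ^ 4 = 0" by blast
  have "g 0 * x ^ 4 + g 1 * (- 4 * x ^ 3) + g 2 * (6 * x\<^sup>2) + g 3 * (- 4 * x) + g 4 * 1 = 0" using x by algebra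
  from section_exists[OF c g this] obtain a where a: "lin a (c 0) = x ^ 4" "lin a (c 1) = - 4 * x ^ 3"
    "lin a (c 2) = 6 * x\<^sup>2" "lin a (c 3) = - 4 * x" "lin a (c 4) = 1" by blast
  have a4: "lin a (bq c s t) = (s - x * t) ^ 4" for s t
    unfolding lin_bq a by (simp add: algebra_simps eval_nat_numeral)
  obtain c1 where c1: "\<And>s t. bq c1 s t = bq c (1 * s + x * t) (0 * s + 1 * t)" using bq_substitute by blast
  have p1: "parametrizes c1 \<delta>" by (rule parametrizes_substitute[OF c _ c1]) simp
  have a1: "lin a (bq c1 s t) = s ^ 4" for s t unfolding c1 a4 by simp
  obtain g where g: "annihilates g c1" using annihilates_exists by blast
  have g4: "g 4 = 0" using section_annihilated[OF g, of a 0 0 0 0 1] a1 by simp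
  \<comment> \<open>The leading coefficient is \<open>g 4\<close>, now 0. The remaining polynomial
    is constant only if \<open>g 0\<close> is the sole nonzero coefficient, which would give
    \<open>c1 0 = 0\<close>. A root \<open>y\<close> yields a second fourth power, since
    \<open>t - y * s\<close> is never a multiple of \<open>s\<close>.\<close>
  have "\<not> (- 4 * g 1 = 0 \<and> 6 * g 2 = 0 \<and> - 4 * g 3 = 0 \<and> (0::complex) = 0)"
  proof
    assume "- 4 * g 1 = 0 \<and> 6 * g 2 = 0 \<and> - 4 * g 3 = 0 \<and> (0::complex) = 0"
    then have z: "g 1 = 0" "g 2 = 0" "g 3 = 0" by auto
    then have "g 0 *s c1 0 = 0" using g g4 by (simp add: annihilates_def)
    then have "g 0 = 0" using parametrizes_ends[OF p1] by (simp add: vector_mul_eq_0)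
    then have "g k = 0" if "k \<le> 4" for k using z g4 that by (auto simp: le_Suc_eq eval_nat_numeral)
    then show False using g by (auto simp: annihilates_def)
  qed
  from quartic_root[OF this] obtain y where
    y: "g 0 + - 4 * g 1 * y + 6 * g 2 * y\<^sup>2 + - 4 * g 3 * y ^ 3 + 0 * y ^ 4 = 0" by blast
  have "g 0 * 1 + g 1 * (- 4 * y) + g 2 * (6 * y\<^sup>2) + g 3 * (- 4 * y ^ 3) + g 4 * y ^ 4 = 0" using y g4 by algebra
  from section_exists[OF p1 g this] obtain b where b: "lin b (c1 0) = 1" "lin b (c1 1) = - 4 * y"
    "lin b (c1 2) = 6 * y\<^sup>2" "lin b (c1 3) = - 4 * y ^ 3" "lin b (c1 4) = y ^ 4" by blast
  have b4: "lin b (bq c1 s t) = (t - y * s) ^ 4" for s t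
    unfolding lin_bq b by (simp add: algebra_simps eval_nat_numeral)
  obtain c2 where c2: "\<And>s t. bq c2 s t = bq c1 (1 * s + 0 * t) (y * s + 1 * t)" using bq_substitute by blast
  have p2: "parametrizes c2 \<delta>" by (rule parametrizes_substitute[OF p1 _ c2]) simp
  have a2: "lin a (bq c2 s t) = s ^ 4" "lin b (bq c2 s t) = t ^ 4" for s t unfolding c2 a1 b4 by simp_all
  have "\<not> special c1" using special_substitute[OF _ _ c1] ns by auto
  then have "\<not> special c2" using special_substitute[OF _ _ c2] by auto
  moreover have "g 0 = 0 \<and> g 4 = 0" if g: "annihilates g c2" for g
    using section_annihilated[OF g, of a 0 0 0 0 1] section_annihilated[OF g, of b 1 0 0 0 0] a2 by simp
  ultimately show ?thesis using p2 by blast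
qed


section \<open>Quadrics through the curve\<close>

definition bil :: "complex ^ 4 ^ 4 \<Rightarrow> cvec \<Rightarrow> cvec \<Rightarrow> complex" where
  "bil A v w = (\<Sum>i\<in>UNIV. \<Sum>j\<in>UNIV. A $ i $ j * v $ i * w $ j)"

lemma qf_bil: "qf A v = bil A v v"
  by (simp add: qf_def bil_def)

lemma bil_linear:
  "bil A (v + v') w = bil A v w + bil A v' w" "bil A v (w + w') = bil A v w + bil A v w'"
  "bil A (k *s v) w = k * bil A v w" "bil A v (k *s w) = k * bil A v w"
  by (simp_all add: bil_def sum_distrib_left algebra_simps sum.distrib)

lemma qf_scale: "qf A (k *s v) = k\<^sup>2 * qf A v"
  by (simp only: qf_bil bil_linear power2_eq_square mult.assoc)

lemma pt_in_quadric_iff: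
  assumes "v \<noteq> 0"
  shows "pt v \<in> {pt w | w. w \<noteq> 0 \<and> qf A w = 0} \<longleftrightarrow> qf A v = 0"
proof
  assume "pt v \<in> {pt w | w. w \<noteq> 0 \<and> qf A w = 0}"
  then obtain w where w: "pt v = pt w" "qf A w = 0" by auto
  from pt_eqD[OF w(1)] obtain k where "v = k *s w" by blast
  then show "qf A v = 0" using w(2) by (simp add: qf_scale)
next
  assume "qf A v = 0"
  then show "pt v \<in> {pt w | w. w \<noteq> 0 \<and> qf A w = 0}" using assms by blast
qed

lemma curve_in_quadric_iff:
  assumes "parametrizes c \<delta>"
  shows "\<delta> \<subseteq> {pt w | w. w \<noteq> 0 \<and> qf A w = 0} \<longleftrightarrow> (\<forall>s t. qf A (bq c s t) = 0)"
proof
  assume s: "\<delta> \<subseteq> {pt w | w. w \<noteq> 0 \<and> qf A w = 0}"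
  show "\<forall>s t. qf A (bq c s t) = 0"
  proof (intro allI)
    fix s t
    show "qf A (bq c s t) = 0"
    proof (cases "(s, t) = (0, 0)")
      case True
      then show ?thesis by (simp add: bq_expand qf_def)
    next
      case False
      then have "bq c s t \<noteq> 0" "pt (bq c s t) \<in> \<delta>" using assms unfolding parametrizes_def by blast+
      then show ?thesis using s pt_in_quadric_iff by blast
    qed
  qed
next
  assume q: "\<forall>s t. qf A (bq c s t) = 0"
  show "\<delta> \<subseteq> {pt w | w. w \<noteq> 0 \<and> qf A w = 0}"
  proof
    fix x assume "x \<in> \<delta>"
    then obtain s t where "x = pt (bq c s t)" "bq c s t \<noteq> 0" using assms unfolding parametrizes_def by blast
    then show "x \<in> {pt w | w. w \<noteq> 0 \<and> qf A w = 0}" using q by blast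
  qed
qed

text \<open>Since \<open>g 2 \<noteq> 0\<close>, the relation adjusts the value on
  \<open>c 2\<close> to any values on the other four vectors; linear forms therefore detect every
  coefficient, and the four vectors form a basis.\<close>

lemma basis_without_middle:
  assumes c: "parametrizes c \<delta>" and g: "annihilates g c" and g2: "g 2 \<noteq> 0"
  shows "\<exists>v0 v1 v3 v4. v = v0 *s c 0 + v1 *s c 1 + v3 *s c 3 + v4 *s c 4"
proof -
  define L where "L x = x $ 1 *s c 0 + x $ 2 *s c 1 + x $ 3 *s c 3 + x $ 4 *s c 4" for x :: cvec
  have lL: "Vector_Spaces.linear (*s) (*s) L"
    by unfold_locales (simp_all add: L_def vec_eq_iff algebra_simps)
  have "inj L"
  proof (subst vec.linear_inj_iff_eq_0[OF lL], intro allI impI)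
    fix x assume x: "L x = 0"
    have l: "x $ 1 * lin a (c 0) + x $ 2 * lin a (c 1) + x $ 3 * lin a (c 3) + x $ 4 * lin a (c 4) = 0" for a
    proof -
      have "lin a (L x) = 0" using x by simp
      then show ?thesis by (simp add: L_def lin_add lin_scale)
    qed
    have e: "x $ 1 * f0 + x $ 2 * f1 + x $ 3 * f3 + x $ 4 * f4 = 0" for f0 f1 f3 f4
    proof -
      define f2 where "f2 = - (g 0 * f0 + g 1 * f1 + g 3 * f3 + g 4 * f4) / g 2"
      have "g 2 * f2 = - (g 0 * f0 + g 1 * f1 + g 3 * f3 + g 4 * f4)" using g2 by (simp add: f2_def)
      then have "g 0 * f0 + g 1 * f1 + g 2 * f2 + g 3 * f3 + g 4 * f4 = 0" by (simp add: algebra_simps)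
      from section_exists[OF c g this] l show ?thesis by metis
    qed
    show "x = 0" using e[of 1 0 0 0] e[of 0 1 0 0] e[of 0 0 1 0] e[of 0 0 0 1]
      by (simp add: vec_eq_iff forall_4)
  qed
  then have "surj L" by (rule vec.linear_injective_imp_surjective[OF lL _ refl])
  then obtain x where "v = L x" by (metis surjD)
  then show ?thesis unfolding L_def by blast
qed

text \<open>On the normal form \<open>g = (0, g1, g2, g3, 0)\<close> the nine coefficient equations of the octic
  \<open>qf A (bq c s 1)\<close> determine \<open>A\<close> from its entry mixing \<open>c 1\<close> and \<open>c 3\<close>.\<close>

lemma quadric_coefficients:
  fixes b00 b01 b03 b04 b11 b13 b14 b33 b34 b44 u w :: complex
  assumes "\<And>X. b00 + b01 * (X - u * X\<^sup>2) + b03 * (X ^ 3 - w * X\<^sup>2) + b04 * X ^ 4 + b11 * (X - u * X\<^sup>2)\<^sup>2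
     + b13 * ((X - u * X\<^sup>2) * (X ^ 3 - w * X\<^sup>2)) + b14 * ((X - u * X\<^sup>2) * X ^ 4) + b33 * (X ^ 3 - w * X\<^sup>2)\<^sup>2
     + b34 * ((X ^ 3 - w * X\<^sup>2) * X ^ 4) + b44 * X ^ 8 = 0"
  shows "b00 = 0" "b01 = 0" "b34 = 0" "b44 = 0" "b11 = w * b03" "b03 * (1 - 2 * u * w) = w * b13"
    "b33 = u * b14" "b14 * (1 - 2 * u * w) = u * b13" "b04 = - (u\<^sup>2 * b11 + (1 + u * w) * b13 + w\<^sup>2 * b33)"
proof -
  \<comment> \<open>The coefficients of the octic, from \<open>X ^ 0\<close> to
    \<open>X ^ 8\<close>.\<close>
  define k where "k = (!) [b00, b01, - u * b01 - w * b03 + b11, b03 - 2 * u * b11 - w * b13,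
     b04 + u\<^sup>2 * b11 + (1 + u * w) * b13 + w\<^sup>2 * b33, b14 - u * b13 - 2 * w * b33, b33 - u * b14 - w * b34, b34, b44]"
  have "(\<Sum>i\<le>8. k i * X ^ i) = 0" for X
  proof -
    have "(\<Sum>i\<le>8. k i * X ^ i) = b00 + b01 * (X - u * X\<^sup>2) + b03 * (X ^ 3 - w * X\<^sup>2) + b04 * X ^ 4 + b11 * (X - u * X\<^sup>2)\<^sup>2
     + b13 * ((X - u * X\<^sup>2) * (X ^ 3 - w * X\<^sup>2)) + b14 * ((X - u * X\<^sup>2) * X ^ 4) + b33 * (X ^ 3 - w * X\<^sup>2)\<^sup>2
     + b34 * ((X ^ 3 - w * X\<^sup>2) * X ^ 4) + b44 * X ^ 8"
      unfolding k_def by (simp add: eval_nat_numeral algebra_simps)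
    then show ?thesis using assms by simp
  qed
  then have z: "k i = 0" if "i \<le> 8" for i using that polyfun_eq_0[of k 8] by blast
  have "k 0 = 0" "k 1 = 0" "k 2 = 0" "k 3 = 0" "k 4 = 0" "k 5 = 0" "k 6 = 0" "k 7 = 0" "k 8 = 0"
    by (rule z, simp)+
  then have e: "b00 = 0" "b01 = 0" "- u * b01 - w * b03 + b11 = 0" "b03 - 2 * u * b11 - w * b13 = 0"
    "b04 + u\<^sup>2 * b11 + (1 + u * w) * b13 + w\<^sup>2 * b33 = 0" "b14 - u * b13 - 2 * w * b33 = 0"
    "b33 - u * b14 - w * b34 = 0" "b34 = 0" "b44 = 0"
    unfolding k_def by (simp_all add: eval_nat_numeral)
  show "b00 = 0" "b01 = 0" "b34 = 0" "b44 = 0" by fact+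
  show 1: "b11 = w * b03" and 2: "b33 = u * b14" using e by algebra+
  show "b03 * (1 - 2 * u * w) = w * b13" "b14 * (1 - 2 * u * w) = u * b13" using e 1 2 by algebra+
  show "b04 = - (u\<^sup>2 * b11 + (1 + u * w) * b13 + w\<^sup>2 * b33)" using e by algebra
qed

text \<open>In normal form the Hankel determinant is
  \<open>g 2 * (2 * g 1 * g 3 - (g 2)\<^sup>2)\<close>. Both factors are nonzero, which lets
  \<open>c' 2\<close> be eliminated and the octic equations be solved up to one scalar. So all
  quadratic forms that vanish on the curve are multiples of one form.\<close>

lemma not_special_unique_quadric:
  assumes c: "parametrizes c \<delta>" and ns: "\<not> special c"
  shows "\<not> first_species \<delta>"
proof -
  obtain c' where c': "parametrizes c' \<delta>" "\<not> special c'" and ends: "\<And>g. annihilates g c' \<Longrightarrow> g 0 = 0 \<and> g 4 = 0"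
    using fourth_powers_normal_form[OF c ns] by blast
  obtain g where g: "annihilates g c'" using annihilates_exists by blast
  have g04: "g 0 = 0" "g 4 = 0" using ends[OF g] by auto
  have H: "hankel_regular g" by (rule hankel_regular_if_not_special[OF c'(1) g c'(2)])
  have g2: "g 2 \<noteq> 0"
  proof
    assume z: "g 2 = 0"
    have "g 3 = 0 \<and> (0::complex) = 0 \<and> - g 1 = 0"
      using H[unfolded hankel_regular_def, rule_format, of "g 3" 0 "- g 1"] z g04 by simp
    then have "g k = 0" if "k \<le> 4" for k using z g04 that by (auto simp: le_Suc_eq eval_nat_numeral)
    then show False using g by (auto simp: annihilates_def)
  qed
  have disc: "(g 2)\<^sup>2 \<noteq> 2 * g 1 * g 3"
  proof
    assume z: "(g 2)\<^sup>2 = 2 * g 1 * g 3"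
    have "- g 3 = 0 \<and> g 2 = 0 \<and> - g 1 = 0"
      using H[unfolded hankel_regular_def, rule_format, of "- g 3" "g 2" "- g 1"] z g04
      by (simp add: power2_eq_square)
    then show False using g2 by simp
  qed
  define u w where "u = g 1 / g 2" and "w = g 3 / g 2"
  have D: "1 - 2 * u * w \<noteq> 0" using disc g2 by (simp add: u_def w_def field_simps power2_eq_square)
  have c2: "c' 2 = (- u) *s c' 1 + (- w) *s c' 3"
  proof -
    have "g 1 * c' 1 $ i + g 2 * c' 2 $ i + g 3 * c' 3 $ i = 0" for i
      using g g04 by (simp add: annihilates_def vec_eq_iff)
    then have "c' 2 $ i = - u * c' 1 $ i + - w * c' 3 $ i" for i
      using g2 by (simp add: u_def w_def field_simps add_eq_0_iff)
    then show ?thesis by (simp add: vec_eq_iff)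
  qed
  have curve: "bq c' X 1 = 1 *s c' 0 + (X - u * X\<^sup>2) *s c' 1 + (X ^ 3 - w * X\<^sup>2) *s c' 3 + (X ^ 4) *s c' 4" for X
    unfolding bq_expand c2 by (simp add: vec_eq_iff algebra_simps)
  define m where "m A = bil A (c' 1) (c' 3) + bil A (c' 3) (c' 1)" for A
  \<comment> \<open>The factor \<open>1 - 2 * u * w\<close> clears the denominators of the solution.
    On the right, only \<open>m A\<close> depends on \<open>A\<close>.\<close>
  have key: "(1 - 2 * u * w) * qf A (v0 *s c' 0 + v1 *s c' 1 + v3 *s c' 3 + v4 *s c' 4) =
      m A * ((1 - 2 * u * w) * (v1 * v3) + w * v0 * v3 + w\<^sup>2 * v1\<^sup>2 + u * v1 * v4 + u\<^sup>2 * v3\<^sup>2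
        - (2 * u\<^sup>2 * w\<^sup>2 + (1 - 2 * u * w) * (1 + u * w)) * (v0 * v4))"
    if A: "\<And>s t. qf A (bq c' s t) = 0" for A v0 v1 v3 v4
  proof -
    define b00 b01 b03 b04 b11 b14 b33 b34 b44 where "b00 = bil A (c' 0) (c' 0)"
      and "b01 = bil A (c' 0) (c' 1) + bil A (c' 1) (c' 0)" and "b03 = bil A (c' 0) (c' 3) + bil A (c' 3) (c' 0)"
      and "b04 = bil A (c' 0) (c' 4) + bil A (c' 4) (c' 0)" and "b11 = bil A (c' 1) (c' 1)"
      and "b14 = bil A (c' 1) (c' 4) + bil A (c' 4) (c' 1)" and "b33 = bil A (c' 3) (c' 3)"
      and "b34 = bil A (c' 3) (c' 4) + bil A (c' 4) (c' 3)" and "b44 = bil A (c' 4) (c' 4)"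
    have ex: "qf A (v0 *s c' 0 + v1 *s c' 1 + v3 *s c' 3 + v4 *s c' 4) =
      b00 * (v0 * v0) + b01 * (v0 * v1) + b03 * (v0 * v3) + b04 * (v0 * v4) + b11 * (v1 * v1) + m A * (v1 * v3)
      + b14 * (v1 * v4) + b33 * (v3 * v3) + b34 * (v3 * v4) + b44 * (v4 * v4)" for v0 v1 v3 v4
      unfolding qf_bil bil_linear b00_def b01_def b03_def b04_def b11_def m_def b14_def b33_def b34_def b44_def
      by (simp add: algebra_simps)
    have "b00 + b01 * (X - u * X\<^sup>2) + b03 * (X ^ 3 - w * X\<^sup>2) + b04 * X ^ 4 + b11 * (X - u * X\<^sup>2)\<^sup>2
     + m A * ((X - u * X\<^sup>2) * (X ^ 3 - w * X\<^sup>2)) + b14 * ((X - u * X\<^sup>2) * X ^ 4) + b33 * (X ^ 3 - w * X\<^sup>2)\<^sup>2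
     + b34 * ((X ^ 3 - w * X\<^sup>2) * X ^ 4) + b44 * X ^ 8 = 0" for X
    proof -
      have "X ^ 8 = X ^ 4 * X ^ 4" by (simp flip: power_add)
      then show ?thesis using A[of X 1] unfolding curve ex by (simp add: power2_eq_square)
    qed
    note q = quadric_coefficients[OF this]
    show ?thesis unfolding ex q(1-4) using q(5-9) by algebra
  qed
  have "S1 = S2" if S: "quadric S1" "quadric S2" "\<delta> \<subseteq> S1" "\<delta> \<subseteq> S2" for S1 S2
  proof -
    obtain A1 where A1: "\<exists>v. qf A1 v \<noteq> 0" "S1 = {pt v | v. v \<noteq> 0 \<and> qf A1 v = 0}" using S(1) by (auto simp: quadric_def)
    obtain A2 where A2: "\<exists>v. qf A2 v \<noteq> 0" "S2 = {pt v | v. v \<noteq> 0 \<and> qf A2 v = 0}" using S(2) by (auto simp: quadric_def)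
    note zero = curve_in_quadric_iff[OF c'(1), THEN iffD1, rule_format]
    have z1: "qf A1 (bq c' s t) = 0" and z2: "qf A2 (bq c' s t) = 0" for s t
      by (rule zero[OF S(3)[unfolded A1(2)]], rule zero[OF S(4)[unfolded A2(2)]])
    define Q where "Q v0 v1 v3 v4 = (1 - 2 * u * w) * (v1 * v3) + w * v0 * v3 + w\<^sup>2 * v1\<^sup>2 + u * v1 * v4 + u\<^sup>2 * v3\<^sup>2
        - (2 * u\<^sup>2 * w\<^sup>2 + (1 - 2 * u * w) * (1 + u * w)) * (v0 * v4)" for v0 v1 v3 v4
    have ne: "m A \<noteq> 0" if "\<exists>v. qf A v \<noteq> 0" "\<And>s t. qf A (bq c' s t) = 0" for A
    proof
      assume "m A = 0"
      then have "qf A v = 0" for v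
        using basis_without_middle[OF c'(1) g g2, of v] key[OF that(2)] D by auto
      then show False using that(1) by blast
    qed
    have iff: "qf A v = 0 \<longleftrightarrow> Q v0 v1 v3 v4 = 0" if "\<exists>v. qf A v \<noteq> 0" "\<And>s t. qf A (bq c' s t) = 0"
      "v = v0 *s c' 0 + v1 *s c' 1 + v3 *s c' 3 + v4 *s c' 4" for A v v0 v1 v3 v4
      using key[OF that(2), of v0 v1 v3 v4] ne[OF that(1,2)] D unfolding that(3) Q_def by (metis mult_eq_0_iff)
    have "qf A1 v = 0 \<longleftrightarrow> qf A2 v = 0" for v
      using basis_without_middle[OF c'(1) g g2, of v] iff[OF A1(1) z1] iff[OF A2(1) z2] by metis
    then show ?thesis unfolding A1(2) A2(2) by simp
  qed
  then show ?thesis unfolding first_species_def by blast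
qed

section \<open>Two quadrics through a special curve\<close>

definition outer :: "cvec \<Rightarrow> cvec \<Rightarrow> complex ^ 4 ^ 4" where
  "outer a b = (\<chi> i j. a $ i * b $ j)"

lemma qf_outer: "qf (outer a b) v = lin a v * lin b v"
  by (simp add: qf_def outer_def lin_def sum_product mult_ac)

lemma qf_diff: "qf (A - B) v = qf A v - qf B v"
  by (simp add: qf_def sum_subtractf left_diff_distrib)

text \<open>Quadrics are point sets, so different forms do not suffice: the vector \<open>v\<close>
  is a zero of one form and not of the other.\<close>

lemma not_second_species_if_separated:
  assumes c: "parametrizes c \<delta>" and z: "\<And>s t. qf A (bq c s t) = 0" "\<And>s t. qf B (bq c s t) = 0"
    and "qf A v0 \<noteq> 0" and v: "qf A v = 0" "qf B v \<noteq> 0"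
  shows "\<not> second_species \<delta>"
proof
  assume u: "second_species \<delta>"
  let ?S = "\<lambda>A. {pt w | w. w \<noteq> 0 \<and> qf A w = 0}"
  have "quadric (?S A)" "quadric (?S B)" unfolding quadric_def using assms(4) v(2) by blast+
  moreover have "\<delta> \<subseteq> ?S A" "\<delta> \<subseteq> ?S B" using z by (simp_all only: curve_in_quadric_iff[OF c] simp_thms)
  ultimately have e: "?S A = ?S B" using u unfolding second_species_def by blast
  have v0: "v \<noteq> 0" using v(2) by (auto simp: qf_def)
  show False using pt_in_quadric_iff[OF v0, of A] pt_in_quadric_iff[OF v0, of B] v unfolding e by simp
qed


section \<open>Coplanar quadruples\<close>

text \<open>Three indices are free in \<open>[0, m)\<close>, \<open>[m, 2m)\<close> and
  \<open>[2m, 3m)\<close>; the sum \<open>9 * m\<close> then places the fourth above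
  \<open>3 * m\<close> and at most at \<open>6 * m < n\<close>, so all four are distinct. From
  \<open>n \<ge> 12\<close> follows \<open>n / 12 \<le> m\<close>, and 1728 is 12 cubed. For the
  upper bound, three indices determine the fourth.\<close>

lemma arithmetic_quadruples:
  fixes p :: "nat \<Rightarrow> ppoint"
  assumes inj: "inj_on p {..<n}" and n: "n \<ge> 12" and m: "m = (n - 1) div 6"
    and cop: "\<And>i j k l. distinct [i, j, k, l] \<Longrightarrow> {i, j, k, l} \<subseteq> {..<n} \<Longrightarrow>
      (\<exists>H. plane H \<and> p ` {i, j, k, l} \<subseteq> H) \<longleftrightarrow> i + j + k + l = 9 * m"
  shows "real n ^ 3 / 1728 \<le> real (coplanar_quadruples (p ` {..<n}))"
    and "real (coplanar_quadruples (p ` {..<n})) \<le> real n ^ 3"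
proof -
  define S where "S = {Q. Q \<subseteq> p ` {..<n} \<and> card Q = 4 \<and> (\<exists>H. plane H \<and> Q \<subseteq> H)}"
  have fS: "finite S" by (rule finite_subset[of _ "Pow (p ` {..<n})"]) (auto simp: S_def)
  have "S \<subseteq> (\<lambda>(i, j, k). p ` {i, j, k, 9 * m - i - j - k}) ` ({..<n} \<times> {..<n} \<times> {..<n})"
  proof
    fix Q assume Q: "Q \<in> S"
    then obtain I where I: "I \<subseteq> {..<n}" "Q = p ` I" by (auto simp: S_def subset_image_iff)
    have "card I = 4" using Q card_image[OF inj_on_subset[OF inj I(1)]] I(2) by (simp add: S_def)
    then obtain i j k l where ijkl: "I = {i, j, k, l}" "distinct [i, j, k, l]"
      by (auto simp: card_Suc_eq numeral_eq_Suc)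
    have "i + j + k + l = 9 * m" using cop[OF ijkl(2)] Q I ijkl(1) by (simp add: S_def)
    then have "l = 9 * m - i - j - k" by simp
    then show "Q \<in> (\<lambda>(i, j, k). p ` {i, j, k, 9 * m - i - j - k}) ` ({..<n} \<times> {..<n} \<times> {..<n})"
      using I ijkl(1) by (intro image_eqI[of _ _ "(i, j, k)"]) auto
  qed
  then have "card S \<le> card ({..<n} \<times> {..<n} \<times> {..<n})" by (rule surj_card_le[rotated]) simp
  also have "\<dots> = n ^ 3" by (simp add: eval_nat_numeral)
  finally have "card S \<le> n ^ 3" .
  then have "real (card S) \<le> real (n ^ 3)" by (simp only: of_nat_le_iff)
  then show "real (coplanar_quadruples (p ` {..<n})) \<le> real n ^ 3"
    by (simp add: coplanar_quadruples_def S_def)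
  have m6: "6 * m < n" "n \<le> 6 * m + 6" using n m by auto
  define F where "F = (\<lambda>(a, b, c). {a, m + b, 2 * m + c, 6 * m - (a + b + c)})"
  have F: "F (a, b, c) \<subseteq> {..<n}" "distinct [a, m + b, 2 * m + c, 6 * m - (a + b + c)]"
    "a + (m + b) + (2 * m + c) + (6 * m - (a + b + c)) = 9 * m" if "a < m" "b < m" "c < m" for a b c
    using that m6 by (auto simp: F_def)
  have injF: "inj_on F ({..<m} \<times> {..<m} \<times> {..<m})"
  proof (rule inj_onI)
    fix x y assume x: "x \<in> {..<m} \<times> {..<m} \<times> {..<m}" and y: "y \<in> {..<m} \<times> {..<m} \<times> {..<m}" and e: "F x = F y"
    obtain a b c where x': "x = (a, b, c)" by (metis surj_pair)
    obtain a' b' c' where y': "y = (a', b', c')" by (metis surj_pair)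
    have bd: "a < m" "b < m" "c < m" "a' < m" "b' < m" "c' < m" using x y x' y' by auto
    have "a \<in> F y" "m + b \<in> F y" "2 * m + c \<in> F y" using e by (auto simp: x' F_def)
    then show "x = y" using bd by (auto simp: x' y' F_def)
  qed
  have injp: "inj_on ((`) p \<circ> F) ({..<m} \<times> {..<m} \<times> {..<m})"
  proof (rule comp_inj_on[OF injF])
    show "inj_on ((`) p) (F ` ({..<m} \<times> {..<m} \<times> {..<m}))"
      by (rule inj_on_subset[OF inj_on_image_Pow[OF inj]]) (use F(1) in auto)
  qed
  have sub: "((`) p \<circ> F) ` ({..<m} \<times> {..<m} \<times> {..<m}) \<subseteq> S"
  proof
    fix Q assume "Q \<in> ((`) p \<circ> F) ` ({..<m} \<times> {..<m} \<times> {..<m})"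
    then obtain a b c where Q: "Q = p ` F (a, b, c)" and bd: "a < m" "b < m" "c < m" by auto
    note F' = F[OF bd]
    have "card (F (a, b, c)) = 4" using distinct_card[OF F'(2)] by (simp add: F_def)
    then have "card Q = 4" unfolding Q using card_image[OF inj_on_subset[OF inj F'(1)]] by simp
    moreover have "\<exists>H. plane H \<and> Q \<subseteq> H"
      using cop[OF F'(2)] F'(1,3) unfolding Q F_def by simp
    ultimately show "Q \<in> S" using F'(1) by (auto simp: S_def Q)
  qed
  have "card ({..<m} \<times> {..<m} \<times> {..<m}) \<le> card S"
    using card_mono[OF fS sub] card_image[OF injp] by simp
  then have "m ^ 3 \<le> card S" by (simp add: eval_nat_numeral)
  then have 1: "real m ^ 3 \<le> real (card S)" by (metis of_nat_le_iff of_nat_power)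
  have "real n / 12 \<le> real m" using m6(2) n by linarith
  then have "(real n / 12) ^ 3 \<le> real m ^ 3" by (intro power_mono) auto
  also have "\<dots> \<le> real (coplanar_quadruples (p ` {..<n}))"
    using 1 by (simp only: coplanar_quadruples_def S_def)
  finally show "real n ^ 3 / 1728 \<le> real (coplanar_quadruples (p ` {..<n}))"
    by (simp add: power_divide)
qed

text \<open>The index sum \<open>N\<close> is arbitrary because the sum wanted grows with the number
  of points; the scale or shift \<open>\<tau>\<close> of the progression adjusts the constant in the
  relation to it.\<close>

lemma special_progression:
  assumes c: "parametrizes c \<delta>" and sp: "special c"
  shows "\<exists>p. range p \<subseteq> \<delta> \<and> inj p \<and> (\<forall>i j k l. distinct [i, j, k, l] \<longrightarrow>
    (\<exists>H. plane H \<and> p ` {i, j, k, l} \<subseteq> H) \<longleftrightarrow> i + j + k + l = (N::nat))"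
    and "\<not> second_species \<delta>"
proof -
  obtain c' where c': "parametrizes c' \<delta>"
    and dv: "divides_sections (\<lambda>s t. s * t) c' \<or> divides_sections (\<lambda>s t. t * t) c'"
    using special_normal_form[OF c sp] by blast
  obtain g where g: "annihilates g c'" using annihilates_exists by blast
  have allz: False if "g 0 = 0" "g 1 = 0" "g 2 = 0" "g 3 = 0" "g 4 = 0"
  proof -
    have "g k = 0" if "k \<le> 4" for k
      using that \<open>g 0 = 0\<close> \<open>g 1 = 0\<close> \<open>g 2 = 0\<close> \<open>g 3 = 0\<close> \<open>g 4 = 0\<close> by (auto simp: le_Suc_eq eval_nat_numeral)
    then show False using g by (auto simp: annihilates_def)
  qed
  note ends = parametrizes_ends[OF c']
  \<comment> \<open>Injectivity is required on the progression only: in the multiplicative case the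
    whole parametrization identifies 0 with infinity.\<close>
  have progression: "\<exists>p. range p \<subseteq> \<delta> \<and> inj p \<and> (\<forall>i j k l. distinct [i, j, k, l] \<longrightarrow>
    (\<exists>H. plane H \<and> p ` {i, j, k, l} \<subseteq> H) \<longleftrightarrow> i + j + k + l = N)"
    if x: "inj x" and inj: "\<And>i j. pt (bq c' (x i) 1) = pt (bq c' (x j) 1) \<Longrightarrow> x i = x j"
      and ap: "\<And>i j k l. apolar g (x i) (x j) (x k) (x l) = 0 \<longleftrightarrow> i + j + k + l = N" for x :: "nat \<Rightarrow> complex"
  proof (intro exI[of _ "\<lambda>i. pt (bq c' (x i) 1)"] conjI allI impI)
    have "pt (bq c' w 1) \<in> \<delta>" for w
      using c' unfolding parametrizes_def by (metis (mono_tags, lifting) mem_Collect_eq prod.inject zero_neq_one)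
    then show "range (\<lambda>i. pt (bq c' (x i) 1)) \<subseteq> \<delta>" by auto
    show "inj (\<lambda>i. pt (bq c' (x i) 1))" using inj x by (meson injD injI)
    fix i j k l :: nat assume "distinct [i, j, k, l]"
    then have "distinct [x i, x j, x k, x l]" using x by (auto dest: injD)
    from coplanar_iff_apolar[OF c' g this]
    show "(\<exists>H. plane H \<and> (\<lambda>i. pt (bq c' (x i) 1)) ` {i, j, k, l} \<subseteq> H) \<longleftrightarrow> i + j + k + l = N"
      by (simp add: ap)
  qed
  have "(\<exists>p. range p \<subseteq> \<delta> \<and> inj p \<and> (\<forall>i j k l. distinct [i, j, k, l] \<longrightarrow>
    (\<exists>H. plane H \<and> p ` {i, j, k, l} \<subseteq> H) \<longleftrightarrow> i + j + k + l = N)) \<and> \<not> second_species \<delta>"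
    using dv
  proof
    assume d: "divides_sections (\<lambda>s t. s * t) c'"
    note gz = annihilator_multiplicative[OF d g]
    have rel: "g 0 *s c' 0 + g 4 *s c' 4 = 0" using g gz by (simp add: annihilates_def)
    have g0: "g 0 \<noteq> 0" using rel ends allz gz by auto
    have g4: "g 4 \<noteq> 0" using rel ends allz gz by auto
    obtain a1 where a1: "lin a1 (c' 0) = 0" "lin a1 (c' 1) = 1" "lin a1 (c' 2) = 0" "lin a1 (c' 3) = 0" "lin a1 (c' 4) = 0"
      using section_exists[OF c' g, of 0 1 0 0 0] gz by auto
    obtain a2 where a2: "lin a2 (c' 0) = 0" "lin a2 (c' 1) = 0" "lin a2 (c' 2) = 1" "lin a2 (c' 3) = 0" "lin a2 (c' 4) = 0"
      using section_exists[OF c' g, of 0 0 1 0 0] gz by auto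
    obtain a3 where a3: "lin a3 (c' 0) = 0" "lin a3 (c' 1) = 0" "lin a3 (c' 2) = 0" "lin a3 (c' 3) = 1" "lin a3 (c' 4) = 0"
      using section_exists[OF c' g, of 0 0 0 1 0] gz by auto
    obtain a0 where a0: "lin a0 (c' 0) = g 4" "lin a0 (c' 1) = 0" "lin a0 (c' 2) = 0" "lin a0 (c' 3) = 0" "lin a0 (c' 4) = - g 0"
      using section_exists[OF c' g, of "g 4" 0 0 0 "- g 0"] by auto
    \<comment> \<open>The sections are \<open>s * t ^ 3\<close>,
      \<open>s\<^sup>2 * t\<^sup>2\<close>, \<open>s ^ 3 * t\<close> for \<open>a1\<close>,
      \<open>a2\<close>, \<open>a3\<close>, and \<open>g 4 * t ^ 4 - g 0 * s ^ 4\<close> for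
      \<open>a0\<close>. The quadrics express \<open>a2\<^sup>2 = a1 * a3\<close> and
      \<open>a0 * a2 = g 4 * a1\<^sup>2 - g 0 * a3\<^sup>2\<close>.\<close>
    have "\<not> second_species \<delta>"
    proof (rule not_second_species_if_separated[OF c', where A = "outer a2 a2 - outer a1 a3"
          and B = "outer a0 a2 - outer (g 4 *s a1) a1 - outer ((- g 0) *s a3) a3" and ?v0.0 = "c' 2" and v = "c' 1"])
      show "qf (outer a2 a2 - outer a1 a3) (bq c' s t) = 0" for s t
        unfolding qf_diff qf_outer lin_bq a1 a2 a3 by (simp add: eval_nat_numeral)
      show "qf (outer a0 a2 - outer (g 4 *s a1) a1 - outer ((- g 0) *s a3) a3) (bq c' s t) = 0" for s t
        unfolding qf_diff qf_outer lin_scale_left lin_bq a0 a1 a2 a3 by (simp add: eval_nat_numeral algebra_simps)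
      show "qf (outer a2 a2 - outer a1 a3) (c' 2) \<noteq> 0" "qf (outer a2 a2 - outer a1 a3) (c' 1) = 0"
        unfolding qf_diff qf_outer a1 a2 a3 by simp_all
      show "qf (outer a0 a2 - outer (g 4 *s a1) a1 - outer ((- g 0) *s a3) a3) (c' 1) \<noteq> 0"
        unfolding qf_diff qf_outer lin_scale_left a0 a1 a2 a3 using g4 by simp
    qed
    moreover have "\<exists>p. range p \<subseteq> \<delta> \<and> inj p \<and> (\<forall>i j k l. distinct [i, j, k, l] \<longrightarrow>
      (\<exists>H. plane H \<and> p ` {i, j, k, l} \<subseteq> H) \<longleftrightarrow> i + j + k + l = N)"
    proof -
      \<comment> \<open>A fourth root chosen to satisfy
        \<open>g 4 + g 0 * (\<tau> ^ 4 * 2 ^ N) = 0\<close>.\<close>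
      define \<tau> where "\<tau> = csqrt (csqrt (- g 4 / g 0 / 2 ^ N))"
      have "\<tau> ^ 4 = (\<tau>\<^sup>2)\<^sup>2" by (simp flip: power_mult)
      then have t4: "\<tau> ^ 4 = - g 4 / g 0 / 2 ^ N" by (simp add: \<tau>_def)
      have t0: "\<tau> \<noteq> 0" using t4 g0 g4 by auto
      define x where "x i = \<tau> * 2 ^ i" for i :: nat
      have pow: "(2 :: complex) ^ a = 2 ^ b \<longleftrightarrow> a = b" for a b
      proof -
        have "(2 :: complex) ^ a = 2 ^ b \<longleftrightarrow> of_nat (2 ^ a) = (of_nat (2 ^ b) :: complex)" by simp
        also have "\<dots> \<longleftrightarrow> a = b" by (simp only: of_nat_eq_iff) simp
        finally show ?thesis .
      qed
      show ?thesis
      proof (rule progression[of x])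
        show "inj x" using t0 by (auto simp: inj_def x_def pow)
        fix i j
        assume "pt (bq c' (x i) 1) = pt (bq c' (x j) 1)"
        then obtain k where k: "bq c' (x i) 1 = k *s bq c' (x j) 1" using pt_eqD by blast
        have "lin a (bq c' (x i) 1) = k * lin a (bq c' (x j) 1)" for a by (simp only: k lin_scale)
        \<comment> \<open>The quotient of the sections by \<open>a3\<close> and \<open>a2\<close> is
          the parameter itself.\<close>
        from this[of a2] this[of a3] have "(x i)\<^sup>2 = k * (x j)\<^sup>2" "(x i) ^ 3 = k * (x j) ^ 3"
          unfolding lin_bq a2 a3 by simp_all
        then have "(x i)\<^sup>2 * (x i - x j) = 0" by algebra
        then show "x i = x j" using t0 by (simp add: x_def)
      next
        fix i j k l
        have "apolar g (x i) (x j) (x k) (x l) = g 4 + g 0 * (\<tau> ^ 4 * 2 ^ (i + j + k + l))"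
          unfolding apolar_def gz x_def by (simp add: power_add eval_nat_numeral mult_ac)
        also have "\<dots> = g 4 * (2 ^ N - 2 ^ (i + j + k + l)) / 2 ^ N"
          unfolding t4 using g0 by (simp add: field_simps)
        finally show "apolar g (x i) (x j) (x k) (x l) = 0 \<longleftrightarrow> i + j + k + l = N"
          using g4 pow[of N "i + j + k + l"] by auto
      qed
    qed
    ultimately show ?thesis by blast
  next
    assume d: "divides_sections (\<lambda>s t. t * t) c'"
    note gz = annihilator_additive[OF d g]
    have rel: "g 3 *s c' 3 + g 4 *s c' 4 = 0" using g gz by (simp add: annihilates_def)
    have g3: "g 3 \<noteq> 0" using rel ends allz gz by auto
    obtain a0 where a0: "lin a0 (c' 0) = 1" "lin a0 (c' 1) = 0" "lin a0 (c' 2) = 0" "lin a0 (c' 3) = 0" "lin a0 (c' 4) = 0"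
      using section_exists[OF c' g, of 1 0 0 0 0] gz by auto
    obtain a1 where a1: "lin a1 (c' 0) = 0" "lin a1 (c' 1) = 1" "lin a1 (c' 2) = 0" "lin a1 (c' 3) = 0" "lin a1 (c' 4) = 0"
      using section_exists[OF c' g, of 0 1 0 0 0] gz by auto
    obtain a2 where a2: "lin a2 (c' 0) = 0" "lin a2 (c' 1) = 0" "lin a2 (c' 2) = 1" "lin a2 (c' 3) = 0" "lin a2 (c' 4) = 0"
      using section_exists[OF c' g, of 0 0 1 0 0] gz by auto
    obtain a4 where a4: "lin a4 (c' 0) = 0" "lin a4 (c' 1) = 0" "lin a4 (c' 2) = 0" "lin a4 (c' 3) = - g 4" "lin a4 (c' 4) = g 3"
      using section_exists[OF c' g, of 0 0 0 "- g 4" "g 3"] by auto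
    \<comment> \<open>The sections are \<open>t ^ 4\<close>, \<open>s * t ^ 3\<close>,
      \<open>s\<^sup>2 * t\<^sup>2\<close> for \<open>a0\<close>, \<open>a1\<close>,
      \<open>a2\<close>, and \<open>g 3 * s ^ 4 - g 4 * (s ^ 3 * t)\<close> for \<open>a4\<close>.
      The quadrics express \<open>a1\<^sup>2 = a0 * a2\<close> and
      \<open>a4 * a0 = g 3 * a2\<^sup>2 - g 4 * (a1 * a2)\<close>.\<close>
    have "\<not> second_species \<delta>"
    proof (rule not_second_species_if_separated[OF c', where A = "outer a1 a1 - outer a0 a2"
          and B = "outer a4 a0 - outer (g 3 *s a2) a2 - outer ((- g 4) *s a1) a2" and ?v0.0 = "c' 1" and v = "c' 2"])
      show "qf (outer a1 a1 - outer a0 a2) (bq c' s t) = 0" for s t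
        unfolding qf_diff qf_outer lin_bq a0 a1 a2 by (simp add: eval_nat_numeral)
      show "qf (outer a4 a0 - outer (g 3 *s a2) a2 - outer ((- g 4) *s a1) a2) (bq c' s t) = 0" for s t
        unfolding qf_diff qf_outer lin_scale_left lin_bq a0 a1 a2 a4 by (simp add: eval_nat_numeral algebra_simps)
      show "qf (outer a1 a1 - outer a0 a2) (c' 1) \<noteq> 0" "qf (outer a1 a1 - outer a0 a2) (c' 2) = 0"
        unfolding qf_diff qf_outer a0 a1 a2 by simp_all
      show "qf (outer a4 a0 - outer (g 3 *s a2) a2 - outer ((- g 4) *s a1) a2) (c' 2) \<noteq> 0"
        unfolding qf_diff qf_outer lin_scale_left a0 a1 a2 a4 using g3 by simp
    qed
    moreover have "\<exists>p. range p \<subseteq> \<delta> \<and> inj p \<and> (\<forall>i j k l. distinct [i, j, k, l] \<longrightarrow>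
      (\<exists>H. plane H \<and> p ` {i, j, k, l} \<subseteq> H) \<longleftrightarrow> i + j + k + l = N)"
    proof -
      \<comment> \<open>Coplanar parameters have sum \<open>g 4 / g 3\<close>, and four terms of the
        progression have sum \<open>4 * \<tau>\<close> plus the index sum.\<close>
      define \<tau> where "\<tau> = (g 4 / g 3 - of_nat N) / 4"
      define x where "x i = \<tau> + of_nat i" for i :: nat
      show ?thesis
      proof (rule progression[of x])
        show "inj x" by (auto simp: inj_def x_def)
        fix i j
        assume "pt (bq c' (x i) 1) = pt (bq c' (x j) 1)"
        then obtain k where k: "bq c' (x i) 1 = k *s bq c' (x j) 1" using pt_eqD by blast
        have "lin a (bq c' (x i) 1) = k * lin a (bq c' (x j) 1)" for a by (simp only: k lin_scale)
        from this[of a0] this[of a1] show "x i = x j" unfolding lin_bq a0 a1 by simp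
      next
        fix i j k l
        have "g 3 * (4 * \<tau>) = g 4 - g 3 * of_nat N" using g3 by (simp add: \<tau>_def field_simps)
        then have "apolar g (x i) (x j) (x k) (x l) = g 3 * (of_nat N - of_nat (i + j + k + l))"
          unfolding apolar_def gz x_def by (simp add: algebra_simps)
        then show "apolar g (x i) (x j) (x k) (x l) = 0 \<longleftrightarrow> i + j + k + l = N"
          using g3 by (simp del: of_nat_add) (metis of_nat_eq_iff)
      qed
    qed
    ultimately show ?thesis by blast
  qed
  then show "\<exists>p. range p \<subseteq> \<delta> \<and> inj p \<and> (\<forall>i j k l. distinct [i, j, k, l] \<longrightarrow>
    (\<exists>H. plane H \<and> p ` {i, j, k, l} \<subseteq> H) \<longleftrightarrow> i + j + k + l = N)" "\<not> second_species \<delta>" by blast+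
qed

section \<open>Moving the given points to finite parameters\<close>

lemma exists_plane_through: "\<exists>a. a \<noteq> 0 \<and> lin a v = 0"
proof (cases "v $ 1 = 0")
  case True
  define a :: cvec where "a = (\<chi> i. if i = 1 then 1 else 0)"
  have "a $ 1 = 1" by (simp add: a_def)
  then have "a \<noteq> 0" by auto
  moreover have "lin a v = 0" using True by (simp add: lin_def sum_4 a_def)
  ultimately show ?thesis by blast
next
  case False
  define a :: cvec where "a = (\<chi> i. if i = 1 then - v $ 2 else if i = 2 then v $ 1 else 0)"
  have "a $ 2 = v $ 1" by (simp add: a_def)
  then have "a \<noteq> 0" using False by auto
  moreover have "lin a v = 0" by (simp add: lin_def sum_4 a_def)
  ultimately show ?thesis by blast
qed

text \<open>A plane through the point pulls back to a polynomial in \<open>\<mu>\<close> of degree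
  at most 4, nonzero because the curve is not planar.\<close>

lemma finite_fibre:
  assumes c: "parametrizes c \<delta>"
  shows "finite {\<mu>. pt (bq c 1 \<mu>) = pt v}"
proof -
  obtain a where a: "a \<noteq> 0" "lin a v = 0" using exists_plane_through by blast
  obtain k where k: "k \<le> 4" "lin a (c k) \<noteq> 0" using parametrizes_nonplanar[OF c] a(1) by blast
  define f where "f i = lin a (c (4 - i))" for i
  have "finite {\<mu>. (\<Sum>i\<le>4. f i * \<mu> ^ i) = 0}"
    using k polyfun_finite_roots[of f 4] by (auto simp: f_def intro!: exI[of _ "4 - k"])
  moreover have "{\<mu>. pt (bq c 1 \<mu>) = pt v} \<subseteq> {\<mu>. (\<Sum>i\<le>4. f i * \<mu> ^ i) = 0}"
  proof
    fix \<mu> assume "\<mu> \<in> {\<mu>. pt (bq c 1 \<mu>) = pt v}"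
    then obtain k where "bq c 1 \<mu> = k *s v" using pt_eqD by blast
    then have "lin a (bq c 1 \<mu>) = 0" using a(2) by (simp add: lin_scale)
    moreover have "(\<Sum>i\<le>4. f i * \<mu> ^ i) = lin a (bq c 1 \<mu>)"
      unfolding lin_bq sum_atMost_4 f_def by simp
    ultimately show "\<mu> \<in> {\<mu>. (\<Sum>i\<le>4. f i * \<mu> ^ i) = 0}" by simp
  qed
  ultimately show ?thesis by (rule finite_subset[rotated])
qed

text \<open>The new infinity is the old parameter \<open>(1, \<mu>)\<close>, with
  \<open>\<mu>\<close> outside the finitely many values that hit \<open>P\<close>.\<close>

lemma affine_parametrization:
  assumes c: "parametrizes c \<delta>" and ns: "\<not> special c" and P: "finite P" "P \<subseteq> \<delta>"
  shows "\<exists>c'. parametrizes c' \<delta> \<and> \<not> special c' \<and> (\<forall>x\<in>P. \<exists>w. x = pt (bq c' w 1))"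
proof -
  have P': "\<exists>v. x = pt v" if "x \<in> P" for x using that P(2) c unfolding parametrizes_def by blast
  have "finite (\<Union>x\<in>P. {\<mu>. pt (bq c 1 \<mu>) = x})" using P(1) P' finite_fibre[OF c] by (intro finite_UN_I) auto
  then obtain \<mu> where "\<mu> \<notin> (\<Union>x\<in>P. {\<mu>. pt (bq c 1 \<mu>) = x})" using ex_new_if_finite[OF infinite_UNIV_char_0] by blast
  then have mu: "pt (bq c 1 \<mu>) \<notin> P" by auto
  obtain c' where c': "\<And>s t. bq c' s t = bq c (1 * s + 0 * t) (\<mu> * s + 1 * t)" using bq_substitute by blast
  have p: "parametrizes c' \<delta>" by (rule parametrizes_substitute[OF c _ c']) simp
  have "\<not> special c'" using special_substitute[OF _ _ c'] ns by auto
  moreover have "\<exists>w. x = pt (bq c' w 1)" if x: "x \<in> P" for x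
  proof -
    obtain s t where st: "x = pt (bq c' s t)" "(s, t) \<noteq> (0, 0)" using x P(2) p unfolding parametrizes_def by blast
    have t: "t \<noteq> 0"
    proof
      assume z: "t = 0"
      then have s: "s \<noteq> 0" using st(2) by simp
      have "bq c' s t = bq c (s * 1) (s * \<mu>)" unfolding c' z by (simp add: mult.commute)
      also have "\<dots> = (s ^ 4) *s bq c 1 \<mu>" by (rule bq_homogeneous)
      finally have "x = pt (bq c 1 \<mu>)" using st(1) s by (simp add: pt_scale)
      then show False using mu x by simp
    qed
    have "bq c' s t = bq c' (t * (s / t)) (t * 1)" using t by simp
    also have "\<dots> = (t ^ 4) *s bq c' (s / t) 1" by (rule bq_homogeneous)
    finally have "x = pt (bq c' (s / t) 1)" using st(1) t by (simp add: pt_scale)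
    then show ?thesis by blast
  qed
  ultimately show ?thesis using p by blast
qed

lemma coplanar_quadruples_le_apolar:
  assumes c: "parametrizes c \<delta>" and g: "annihilates g c" and P: "finite P" "\<forall>x\<in>P. \<exists>w. x = pt (bq c w 1)"
  shows "\<exists>A. finite A \<and> card A = card P \<and> coplanar_quadruples P \<le> card (apolar_quadruples g A)"
proof -
  obtain w where w: "\<And>x. x \<in> P \<Longrightarrow> x = pt (bq c (w x) 1)" using P(2) by metis
  have inj: "inj_on w P" by (rule inj_onI) (metis w)
  define S where "S = {Q. Q \<subseteq> P \<and> card Q = 4 \<and> (\<exists>H. plane H \<and> Q \<subseteq> H)}"
  have fA: "finite (apolar_quadruples g (w ` P))"
    by (rule finite_subset[of _ "Pow (w ` P)"]) (use P in \<open>auto simp: apolar_quadruples_def\<close>)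
  have "(`) w ` S \<subseteq> apolar_quadruples g (w ` P)"
  proof
    fix R assume "R \<in> (`) w ` S"
    then obtain Q where Q: "Q \<in> S" "R = w ` Q" by blast
    have QP: "Q \<subseteq> P" and "card Q = 4" and H: "\<exists>H. plane H \<and> Q \<subseteq> H" using Q(1) by (auto simp: S_def)
    then obtain x y z t where q: "Q = {x, y, z, t}" "distinct [x, y, z, t]" by (auto simp: card_Suc_eq numeral_eq_Suc)
    have d: "distinct [w x, w y, w z, w t]" using q(2) QP inj unfolding q(1) by (simp add: inj_on_eq_iff)
    have "(\<lambda>v. pt (bq c v 1)) ` {w x, w y, w z, w t} = Q" using w q(1) QP by auto
    then have "apolar g (w x) (w y) (w z) (w t) = 0" using coplanar_iff_apolar[OF c g d] H by simp
    then show "R \<in> apolar_quadruples g (w ` P)" unfolding apolar_quadruples_def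
      using d q(1) Q(2) QP by (intro CollectI conjI, blast) (rule exI[of _ "w x"], rule exI[of _ "w y"], rule exI[of _ "w z"], rule exI[of _ "w t"], simp)
  qed
  moreover have "inj_on ((`) w) S"
    by (rule inj_on_subset[OF inj_on_image_Pow[OF inj]]) (auto simp: S_def)
  ultimately have "card S \<le> card (apolar_quadruples g (w ` P))" using fA by (metis card_image card_mono)
  then show ?thesis using P(1) card_image[OF inj]
    by (intro exI[of _ "w ` P"]) (simp add: coplanar_quadruples_def S_def)
qed

theorem theorem1p4:
  fixes \<delta> :: "ppoint set"
  assumes "rational_space_quartic \<delta>"
  shows "(first_species \<delta> \<longrightarrow>
            (\<exists>c1 c2 :: real. \<exists>N::nat. c1 > 0 \<and> c2 > 0 \<and>
               (\<forall>n\<ge>N. \<exists>P. P \<subseteq> \<delta> \<and> finite P \<and> card P = n \<and>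
                   c1 * real n ^ 3 \<le> real (coplanar_quadruples P) \<and>
                   real (coplanar_quadruples P) \<le> c2 * real n ^ 3)))
       \<and> (second_species \<delta> \<longrightarrow>
            (\<exists>C :: real. \<forall>P. P \<subseteq> \<delta> \<and> finite P \<longrightarrow>
               real (coplanar_quadruples P) \<le> C * real (card P) powr (8 / 3)))"
proof -
  obtain c where c: "parametrizes c \<delta>"
    using assms unfolding rational_space_quartic_def parametrizes_def by blast
  show ?thesis
  proof (intro conjI impI)
    assume "first_species \<delta>"
    then have sp: "special c" using not_special_unique_quadric[OF c] by blast
    show "\<exists>c1 c2 :: real. \<exists>N::nat. c1 > 0 \<and> c2 > 0 \<and>
               (\<forall>n\<ge>N. \<exists>P. P \<subseteq> \<delta> \<and> finite P \<and> card P = n \<and>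
                   c1 * real n ^ 3 \<le> real (coplanar_quadruples P) \<and>
                   real (coplanar_quadruples P) \<le> c2 * real n ^ 3)"
    proof (rule exI[of _ "1/1728"], rule exI[of _ 1], rule exI[of _ 12], intro conjI allI impI)
      fix n :: nat assume n: "12 \<le> n"
      obtain p where p: "range p \<subseteq> \<delta>" "inj p" "\<And>i j k l. distinct [i, j, k, l] \<Longrightarrow>
        (\<exists>H. plane H \<and> p ` {i, j, k, l} \<subseteq> H) \<longleftrightarrow> i + j + k + l = 9 * ((n - 1) div 6)"
        using special_progression(1)[OF c sp, of "9 * ((n - 1) div 6)"] by blast
      have inj: "inj_on p {..<n}" using p(2) by (rule inj_on_subset) simp
      note q = arithmetic_quadruples[OF inj n refl p(3)]
      show "\<exists>P. P \<subseteq> \<delta> \<and> finite P \<and> card P = n \<and> 1/1728 * real n ^ 3 \<le> real (coplanar_quadruples P) \<and>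
                   real (coplanar_quadruples P) \<le> 1 * real n ^ 3"
        using q p(1) card_image[OF inj] by (intro exI[of _ "p ` {..<n}"]) auto
    qed simp_all
  next
    assume "second_species \<delta>"
    then have ns: "\<not> special c" using special_progression(2)[OF c] by blast
    obtain C where C: "\<And>g A. hankel_regular g \<Longrightarrow> finite A \<Longrightarrow>
        real (card (apolar_quadruples g A)) \<le> C * real (card A) powr (8/3)"
      using apolar_quadruples_bound by blast
    have "real (coplanar_quadruples P) \<le> C * real (card P) powr (8 / 3)" if P: "P \<subseteq> \<delta>" "finite P" for P
    proof -
      obtain c' where c': "parametrizes c' \<delta>" "\<not> special c'" "\<forall>x\<in>P. \<exists>w. x = pt (bq c' w 1)"
        using affine_parametrization[OF c ns P(2,1)] by blast
      obtain g where g: "annihilates g c'" using annihilates_exists by blast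
      obtain A where A: "finite A" "card A = card P" "coplanar_quadruples P \<le> card (apolar_quadruples g A)"
        using coplanar_quadruples_le_apolar[OF c'(1) g P(2) c'(3)] by blast
      have "real (coplanar_quadruples P) \<le> real (card (apolar_quadruples g A))" using A(3) by simp
      also have "\<dots> \<le> C * real (card A) powr (8/3)"
        by (rule C[OF hankel_regular_if_not_special[OF c'(1) g c'(2)] A(1)])
      finally show ?thesis using A(2) by simp
    qed
    then show "\<exists>C :: real. \<forall>P. P \<subseteq> \<delta> \<and> finite P \<longrightarrow>
               real (coplanar_quadruples P) \<le> C * real (card P) powr (8 / 3)" by blast
  qed
qed

end
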